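(* Let $\overline{\mathcal{E}}$ be the class of surjective maps $f\colon(A,\rho)\to(B,\sigma)$ in $\mathsf{PreOrd}(\mathsf{Set})$ that are fully faithful. The adjunction $F\dashv U\colon\mathsf{ParOrd}(\mathsf{Set})\to\mathsf{PreOrd}(\mathsf{Set})$ induces the monotone-light factorization system $(\overline{\mathcal{E}},\mathcal{M}^* )$; that is, $\overline{\mathcal{E}}=\mathcal{E}'$ and $(\mathcal{E}',\mathcal{M}^* )$ is a factorization system in $\mathsf{PreOrd}(\mathsf{Set})$.
   Context: $\mathsf{PreOrd}(\mathsf{Set})$ is the category of preordered sets and monotone maps; $\mathsf{ParOrd}(\mathsf{Set})$ is the full subcategory of partially ordered sets; $U$ is the inclusion and $F$ its left adjoint, sending $(A,\rho)$ to the quotient $A/\!\sim_\rho$ (where $a\sim_\rho a'$ iff $a\rho a'$ and $a'\rho a$) with the partial order $[a]\le[a']\iff a\rho a'$; the unit $\eta_A\colon A\to A/\!\sim_\rho$ is the canonical projection. A morphism $f\colon(A,\rho)\to(B,\sigma)$ is fully faithful if $a\rho a'\iff f(a)\sigma f(a')$ for all $a,a'\in A$. $\mathcal{E}$ is the class of morphisms inverted by $F$; $\mathcal{E}'$ is the class of morphisms stably in $\mathcal{E}$, i.e. those all of whose pullbacks (along arbitrary morphisms) lie in $\mathcal{E}$. $\mathcal{M}$ is the class of trivial coverings: morphisms $g\colon X\to Y$ whose naturality square ($F(g)\,\eta_X=\eta_Y\,g$) is a pullback. An effective descent morphism is a morphism $p\colon E\to B$ such that the pullback functor $p^*\colon(\mathsf{PreOrd}(\mathsf{Set})\downarrow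 B)\to(\mathsf{PreOrd}(\mathsf{Set})\downarrow E)$ is monadic. $\mathcal{M}^*$ is the class of coverings: morphisms $f\colon A\to B$ for which there is an effective descent morphism $p\colon E\to B$ such that the projection $E\times_BA\to E$ is in $\mathcal{M}$. Factorization system means orthogonal factorization system: both classes are closed under composition with isomorphisms, every morphism factors as a member of the first class followed by a member of the second, and each member of the first class is orthogonal to each member of the second (unique diagonal fill-in). The adjunction is said to induce a monotone-light factorization system when $(\mathcal{E}',\mathcal{M}^* )$ is a factorization system. *)

theory Defs
  imports Main "HOL-Library.FuncSet"
begin

section \<open>Categories, functors, adjunctions\<close>

record ('o, 'm) cat =
  Obj :: "'o set"
  Arr :: "'m set"
  Dom :: "'m \<Rightarrow> 'o"
  Cod :: "'m \<Rightarrow> 'o"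
  Idt :: "'o \<Rightarrow> 'm"
  Comp :: "'m \<Rightarrow> 'm \<Rightarrow> 'm"

text \<open>\<^term>\<open>Comp C g f\<close> is ``g after f''; it is meaningful only for
  \<^term>\<open>Dom C g = Cod C f\<close>.\<close>

definition Hom :: "('o, 'm) cat \<Rightarrow> 'o \<Rightarrow> 'o \<Rightarrow> 'm set" where
  "Hom C a b = {f \<in> Arr C. Dom C f = a \<and> Cod C f = b}"

definition is_category :: "('o, 'm) cat \<Rightarrow> bool" where
  "is_category C \<longleftrightarrow>
     (\<forall>f\<in>Arr C. Dom C f \<in> Obj C \<and> Cod C f \<in> Obj C) \<and>
     (\<forall>a\<in>Obj C. Idt C a \<in> Hom C a a) \<and>
     (\<forall>f\<in>Arr C. \<forall>g\<in>Arr C. Cod C f = Dom C g \<longrightarrow> Comp C g f \<in> Hom C (Dom C f) (Cod C g)) \<and>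
     (\<forall>f\<in>Arr C. Comp C f (Idt C (Dom C f)) = f \<and> Comp C (Idt C (Cod C f)) f = f) \<and>
     (\<forall>f\<in>Arr C. \<forall>g\<in>Arr C. \<forall>h\<in>Arr C. Cod C f = Dom C g \<longrightarrow> Cod C g = Dom C h \<longrightarrow>
        Comp C h (Comp C g f) = Comp C (Comp C h g) f)"

definition is_iso :: "('o, 'm) cat \<Rightarrow> 'm \<Rightarrow> bool" where
  "is_iso C f \<longleftrightarrow> f \<in> Arr C \<and>
     (\<exists>g \<in> Hom C (Cod C f) (Dom C f).
        Comp C g f = Idt C (Dom C f) \<and> Comp C f g = Idt C (Cod C f))"

record ('o, 'm, 'p, 'n) func =
  FObj :: "'o \<Rightarrow> 'p"
  FArr :: "'m \<Rightarrow> 'n"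

definition is_functor ::
  "('o, 'm) cat \<Rightarrow> ('p, 'n) cat \<Rightarrow> ('o, 'm, 'p, 'n) func \<Rightarrow> bool" where
  "is_functor C D F \<longleftrightarrow>
     (\<forall>a\<in>Obj C. FObj F a \<in> Obj D \<and> FArr F (Idt C a) = Idt D (FObj F a)) \<and>
     (\<forall>f\<in>Arr C. FArr F f \<in> Hom D (FObj F (Dom C f)) (FObj F (Cod C f))) \<and>
     (\<forall>f\<in>Arr C. \<forall>g\<in>Arr C. Cod C f = Dom C g \<longrightarrow>
        FArr F (Comp C g f) = Comp D (FArr F g) (FArr F f))"

definition id_func :: "('o, 'm, 'o, 'm) func" where
  "id_func = \<lparr>FObj = (\<lambda>a. a), FArr = (\<lambda>f. f)\<rparr>"

definition comp_func ::
  "('p, 'n, 'q, 'r) func \<Rightarrow> ('o, 'm, 'p, 'n) func \<Rightarrow> ('o, 'm, 'q, 'r) func" where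
  "comp_func G F = \<lparr>FObj = (\<lambda>a. FObj G (FObj F a)), FArr = (\<lambda>f. FArr G (FArr F f))\<rparr>"

definition nat_trans ::
  "('o, 'm) cat \<Rightarrow> ('p, 'n) cat \<Rightarrow> ('o, 'm, 'p, 'n) func \<Rightarrow> ('o, 'm, 'p, 'n) func
     \<Rightarrow> ('o \<Rightarrow> 'n) \<Rightarrow> bool" where
  "nat_trans C D F G \<tau> \<longleftrightarrow>
     (\<forall>a\<in>Obj C. \<tau> a \<in> Hom D (FObj F a) (FObj G a)) \<and>
     (\<forall>f\<in>Arr C. Comp D (\<tau> (Cod C f)) (FArr F f) = Comp D (FArr G f) (\<tau> (Dom C f)))"

definition nat_iso ::
  "('o, 'm) cat \<Rightarrow> ('p, 'n) cat \<Rightarrow> ('o, 'm, 'p, 'n) func \<Rightarrow> ('o, 'm, 'p, 'n) func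
     \<Rightarrow> ('o \<Rightarrow> 'n) \<Rightarrow> bool" where
  "nat_iso C D F G \<tau> \<longleftrightarrow> nat_trans C D F G \<tau> \<and> (\<forall>a\<in>Obj C. is_iso D (\<tau> a))"

definition is_equivalence ::
  "('o, 'm) cat \<Rightarrow> ('p, 'n) cat \<Rightarrow> ('o, 'm, 'p, 'n) func \<Rightarrow> bool" where
  "is_equivalence C D K \<longleftrightarrow> is_functor C D K \<and>
     (\<exists>H. is_functor D C H \<and>
        (\<exists>\<alpha>. nat_iso C C id_func (comp_func H K) \<alpha>) \<and>
        (\<exists>\<beta>. nat_iso D D (comp_func K H) id_func \<beta>))"

text \<open>\<open>is_adjunction C D L R \<eta> \<epsilon>\<close>: the functor \<open>L : C \<rightarrow> D\<close> is left adjoint to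
  \<open>R : D \<rightarrow> C\<close>, with unit \<open>\<eta>\<close> and counit \<open>\<epsilon>\<close>.\<close>

definition is_adjunction ::
  "('o, 'm) cat \<Rightarrow> ('p, 'n) cat \<Rightarrow> ('o, 'm, 'p, 'n) func \<Rightarrow> ('p, 'n, 'o, 'm) func
     \<Rightarrow> ('o \<Rightarrow> 'm) \<Rightarrow> ('p \<Rightarrow> 'n) \<Rightarrow> bool" where
  "is_adjunction C D L R \<eta> \<epsilon> \<longleftrightarrow>
     is_functor C D L \<and> is_functor D C R \<and>
     nat_trans C C id_func (comp_func R L) \<eta> \<and>
     nat_trans D D (comp_func L R) id_func \<epsilon> \<and>
     (\<forall>a\<in>Obj C. Comp D (\<epsilon> (FObj L a)) (FArr L (\<eta> a)) = Idt D (FObj L a)) \<and>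
     (\<forall>x\<in>Obj D. Comp C (FArr R (\<epsilon> x)) (\<eta> (FObj R x)) = Idt C (FObj R x))"


section \<open>Monadic functors\<close>

text \<open>The category of Eilenberg--Moore algebras of a monad \<open>(T, \<eta>, \<mu>)\<close> on \<open>C\<close>.
  An arrow carries its source and target algebra.\<close>

definition em_algebras ::
  "('o, 'm) cat \<Rightarrow> ('o, 'm, 'o, 'm) func \<Rightarrow> ('o \<Rightarrow> 'm) \<Rightarrow> ('o \<Rightarrow> 'm) \<Rightarrow> ('o \<times> 'm) set" where
  "em_algebras C T \<eta> \<mu> = {(a, h). a \<in> Obj C \<and> h \<in> Hom C (FObj T a) a \<and>
     Comp C h (\<eta> a) = Idt C a \<and> Comp C h (FArr T h) = Comp C h (\<mu> a)}"

definition em_cat ::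
  "('o, 'm) cat \<Rightarrow> ('o, 'm, 'o, 'm) func \<Rightarrow> ('o \<Rightarrow> 'm) \<Rightarrow> ('o \<Rightarrow> 'm)
     \<Rightarrow> ('o \<times> 'm, ('o \<times> 'm) \<times> 'm \<times> ('o \<times> 'm)) cat" where
  "em_cat C T \<eta> \<mu> =
     \<lparr>Obj = em_algebras C T \<eta> \<mu>,
      Arr = {((a, h), f, (b, k)). (a, h) \<in> em_algebras C T \<eta> \<mu> \<and> (b, k) \<in> em_algebras C T \<eta> \<mu> \<and>
               f \<in> Hom C a b \<and> Comp C f h = Comp C k (FArr T f)},
      Dom = (\<lambda>(x, f, y). x),
      Cod = (\<lambda>(x, f, y). y),
      Idt = (\<lambda>x. (x, Idt C (fst x), x)),
      Comp = (\<lambda>(y, g, z) (x, f, y'). (x, Comp C g f, z))\<rparr>"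

text \<open>For an adjunction \<open>L \<stileturn> R\<close> with \<open>R : D \<rightarrow> C\<close>, the induced monad on \<open>C\<close> is
  \<open>(R L, \<eta>, R \<epsilon> L)\<close>, and the comparison functor sends \<open>x\<close> to the algebra \<open>(R x, R \<epsilon>\<^sub>x)\<close>.\<close>

definition comparison ::
  "('p, 'n) cat \<Rightarrow> ('p, 'n, 'o, 'm) func \<Rightarrow> ('p \<Rightarrow> 'n)
     \<Rightarrow> ('p, 'n, 'o \<times> 'm, ('o \<times> 'm) \<times> 'm \<times> ('o \<times> 'm)) func" where
  "comparison D R \<epsilon> =
     \<lparr>FObj = (\<lambda>x. (FObj R x, FArr R (\<epsilon> x))),
      FArr = (\<lambda>f. ((FObj R (Dom D f), FArr R (\<epsilon> (Dom D f))),
                   FArr R f,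
                   (FObj R (Cod D f), FArr R (\<epsilon> (Cod D f)))))\<rparr>"

definition monadic ::
  "('p, 'n) cat \<Rightarrow> ('o, 'm) cat \<Rightarrow> ('p, 'n, 'o, 'm) func \<Rightarrow> bool" where
  "monadic D C R \<longleftrightarrow>
     (\<exists>L \<eta> \<epsilon>. is_adjunction C D L R \<eta> \<epsilon> \<and>
        is_equivalence D
          (em_cat C (comp_func R L) \<eta> (\<lambda>a. FArr R (\<epsilon> (FObj L a))))
          (comparison D R \<epsilon>))"


section \<open>Pullbacks, slices, effective descent\<close>

text \<open>\<open>is_pullback C p q f g\<close>: the square \<open>f p = g q\<close> is a pullback; so \<open>p\<close> is a pullback
  of \<open>g\<close> along \<open>f\<close>.\<close>

definition is_pullback :: "('o, 'm) cat \<Rightarrow> 'm \<Rightarrow> 'm \<Rightarrow> 'm \<Rightarrow> 'm \<Rightarrow> bool" where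
  "is_pullback C p q f g \<longleftrightarrow>
     p \<in> Arr C \<and> q \<in> Arr C \<and> f \<in> Arr C \<and> g \<in> Arr C \<and>
     Dom C p = Dom C q \<and> Cod C p = Dom C f \<and> Cod C q = Dom C g \<and> Cod C f = Cod C g \<and>
     Comp C f p = Comp C g q \<and>
     (\<forall>u\<in>Arr C. \<forall>v\<in>Arr C.
        Dom C u = Dom C v \<and> Cod C u = Dom C f \<and> Cod C v = Dom C g \<and> Comp C f u = Comp C g v \<longrightarrow>
        (\<exists>!k. k \<in> Hom C (Dom C u) (Dom C p) \<and> Comp C p k = u \<and> Comp C q k = v))"

text \<open>A chosen pullback of \<open>f\<close> and \<open>g\<close>, as its pair of projections to
  \<^term>\<open>Dom C f\<close> and \<^term>\<open>Dom C g\<close>.\<close>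

definition pb :: "('o, 'm) cat \<Rightarrow> 'm \<Rightarrow> 'm \<Rightarrow> 'm \<times> 'm" where
  "pb C f g = (SOME (p, q). is_pullback C p q f g)"

abbreviation pb1 :: "('o, 'm) cat \<Rightarrow> 'm \<Rightarrow> 'm \<Rightarrow> 'm" where
  "pb1 C f g \<equiv> fst (pb C f g)"

abbreviation pb2 :: "('o, 'm) cat \<Rightarrow> 'm \<Rightarrow> 'm \<Rightarrow> 'm" where
  "pb2 C f g \<equiv> snd (pb C f g)"

text \<open>The slice \<open>C \<down> b\<close>; an arrow \<open>(f, h, g)\<close> is an \<open>h\<close> with \<open>g h = f\<close>.\<close>

definition slice_cat :: "('o, 'm) cat \<Rightarrow> 'o \<Rightarrow> ('m, 'm \<times> 'm \<times> 'm) cat" where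
  "slice_cat C b =
     \<lparr>Obj = {f \<in> Arr C. Cod C f = b},
      Arr = {(f, h, g). f \<in> Arr C \<and> Cod C f = b \<and> g \<in> Arr C \<and> Cod C g = b \<and>
               h \<in> Hom C (Dom C f) (Dom C g) \<and> Comp C g h = f},
      Dom = (\<lambda>(f, h, g). f),
      Cod = (\<lambda>(f, h, g). g),
      Idt = (\<lambda>f. (f, Idt C (Dom C f), f)),
      Comp = (\<lambda>(g, k, l) (f, h, g'). (f, Comp C k h, l))\<rparr>"

text \<open>The functor \<open>p\<^sup>* : (C \<down> B) \<rightarrow> (C \<down> E)\<close> for \<open>p : E \<rightarrow> B\<close>.\<close>

definition pullback_functor ::
  "('o, 'm) cat \<Rightarrow> 'm \<Rightarrow> ('m, 'm \<times> 'm \<times> 'm, 'm, 'm \<times> 'm \<times> 'm) func" where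
  "pullback_functor C p =
     \<lparr>FObj = (\<lambda>f. pb1 C p f),
      FArr = (\<lambda>(f, h, g).
        (pb1 C p f,
         (THE k. k \<in> Hom C (Dom C (pb1 C p f)) (Dom C (pb1 C p g)) \<and>
            Comp C (pb1 C p g) k = pb1 C p f \<and>
            Comp C (pb2 C p g) k = Comp C h (pb2 C p f)),
         pb1 C p g))\<rparr>"

definition effective_descent :: "('o, 'm) cat \<Rightarrow> 'm \<Rightarrow> bool" where
  "effective_descent C p \<longleftrightarrow> p \<in> Arr C \<and>
     monadic (slice_cat C (Cod C p)) (slice_cat C (Dom C p)) (pullback_functor C p)"


section \<open>Classes of morphisms and factorization systems\<close>

definition inverted_by ::
  "('o, 'm) cat \<Rightarrow> ('p, 'n) cat \<Rightarrow> ('o, 'm, 'p, 'n) func \<Rightarrow> 'm set" where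
  "inverted_by C D F = {f \<in> Arr C. is_iso D (FArr F f)}"

definition stably_in :: "('o, 'm) cat \<Rightarrow> 'm set \<Rightarrow> 'm set" where
  "stably_in C E = {f \<in> Arr C. \<forall>p q g. is_pullback C p q g f \<longrightarrow> p \<in> E}"

definition trivial_coverings ::
  "('o, 'm) cat \<Rightarrow> ('o, 'm, 'p, 'n) func \<Rightarrow> ('p, 'n, 'o, 'm) func \<Rightarrow> ('o \<Rightarrow> 'm) \<Rightarrow> 'm set" where
  "trivial_coverings C F U \<eta> =
     {g \<in> Arr C. is_pullback C (\<eta> (Dom C g)) g (FArr U (FArr F g)) (\<eta> (Cod C g))}"

definition coverings :: "('o, 'm) cat \<Rightarrow> 'm set \<Rightarrow> 'm set" where
  "coverings C M =
     {f \<in> Arr C. \<exists>p. effective_descent C p \<and> Cod C p = Cod C f \<and> pb1 C p f \<in> M}"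

definition orthogonal :: "('o, 'm) cat \<Rightarrow> 'm \<Rightarrow> 'm \<Rightarrow> bool" where
  "orthogonal C e m \<longleftrightarrow>
     (\<forall>u \<in> Hom C (Dom C e) (Dom C m). \<forall>v \<in> Hom C (Cod C e) (Cod C m).
        Comp C v e = Comp C m u \<longrightarrow>
        (\<exists>!d. d \<in> Hom C (Cod C e) (Dom C m) \<and> Comp C d e = u \<and> Comp C m d = v))"

definition closed_under_isos :: "('o, 'm) cat \<Rightarrow> 'm set \<Rightarrow> bool" where
  "closed_under_isos C S \<longleftrightarrow>
     (\<forall>f\<in>S. \<forall>i. is_iso C i \<longrightarrow>
        (Dom C i = Cod C f \<longrightarrow> Comp C i f \<in> S) \<and> (Cod C i = Dom C f \<longrightarrow> Comp C f i \<in> S))"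

definition factorization_system :: "('o, 'm) cat \<Rightarrow> 'm set \<Rightarrow> 'm set \<Rightarrow> bool" where
  "factorization_system C E M \<longleftrightarrow>
     E \<subseteq> Arr C \<and> M \<subseteq> Arr C \<and>
     closed_under_isos C E \<and> closed_under_isos C M \<and>
     (\<forall>f\<in>Arr C. \<exists>e\<in>E. \<exists>m\<in>M. Cod C e = Dom C m \<and> f = Comp C m e) \<and>
     (\<forall>e\<in>E. \<forall>m\<in>M. orthogonal C e m)"


section \<open>Preordered sets and the reflection onto partially ordered sets\<close>

text \<open>The small sets are certain subsets of a type \<^typ>\<open>'u\<close>. The conditions below are properties
  which the members of any Grothendieck universe with an infinite member have when they
  are seen as subsets of that universe; they also hold for the family of all subsets of any
  infinite type. Closure under binary products, up to bijection, follows, because an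
  infinite set is equinumerous to its square.\<close>

definition small_sets :: "'u set set \<Rightarrow> bool" where
  "small_sets \<U> \<longleftrightarrow>
     (\<forall>A\<in>\<U>. \<forall>B. B \<subseteq> A \<longrightarrow> B \<in> \<U>) \<and>
     (\<forall>A\<in>\<U>. \<forall>f :: 'u \<Rightarrow> 'u. f ` A \<in> \<U>) \<and>
     (\<exists>A\<in>\<U>. infinite A)"

type_synonym 'u preord = "'u set \<times> 'u rel"
type_synonym 'u mor = "'u preord \<times> ('u \<Rightarrow> 'u) \<times> 'u preord"

definition monotone_maps :: "'u preord \<Rightarrow> 'u preord \<Rightarrow> ('u \<Rightarrow> 'u) set" where
  "monotone_maps X Y = {f \<in> fst X \<rightarrow>\<^sub>E fst Y. \<forall>(a, a') \<in> snd X. (f a, f a') \<in> snd Y}"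

text \<open>The full subcategory of the category of preordered sets on the class \<^term>\<open>P\<close>; underlying
  functions are extensional, so that equality of arrows is equality of maps.\<close>

definition preord_subcat :: "'u preord set \<Rightarrow> ('u preord, 'u mor) cat" where
  "preord_subcat P =
     \<lparr>Obj = P,
      Arr = {(X, f, Y). X \<in> P \<and> Y \<in> P \<and> f \<in> monotone_maps X Y},
      Dom = (\<lambda>(X, f, Y). X),
      Cod = (\<lambda>(X, f, Y). Y),
      Idt = (\<lambda>X. (X, restrict (\<lambda>a. a) (fst X), X)),
      Comp = (\<lambda>(Y, g, Z) (X, f, Y'). (X, compose (fst X) g f, Z))\<rparr>"

definition PreOrd :: "'u set set \<Rightarrow> ('u preord, 'u mor) cat" where
  "PreOrd \<U> = preord_subcat {(A, \<rho>). A \<in> \<U> \<and> preorder_on A \<rho>}"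

definition ParOrd :: "'u set set \<Rightarrow> ('u preord, 'u mor) cat" where
  "ParOrd \<U> = preord_subcat {(A, \<rho>). A \<in> \<U> \<and> partial_order_on A \<rho>}"

definition inclusion :: "('u preord, 'u mor, 'u preord, 'u mor) func" where
  "inclusion = \<lparr>FObj = (\<lambda>X. X), FArr = (\<lambda>f. f)\<rparr>"

definition sim :: "'u rel \<Rightarrow> 'u rel" where
  "sim \<rho> = {(a, a'). (a, a') \<in> \<rho> \<and> (a', a) \<in> \<rho>}"

text \<open>The objects of \<^term>\<open>ParOrd \<U>\<close> live on subsets of \<^typ>\<open>'u\<close>, so an equivalence
  class \<open>[a] \<in> A // sim \<rho>\<close> is represented by one chosen element of it. On distinct classes
  the representatives are distinct, so this is a copy of the quotient.\<close>

definition cls :: "'u rel \<Rightarrow> 'u \<Rightarrow> 'u" where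
  "cls \<rho> a = (SOME b. b \<in> sim \<rho> `` {a})"

definition refl_obj :: "'u preord \<Rightarrow> 'u preord" where
  "refl_obj = (\<lambda>(A, \<rho>). (cls \<rho> ` A, {(cls \<rho> a, cls \<rho> a') | a a'. (a, a') \<in> \<rho>}))"

text \<open>On arrows \<open>F f [a] = [f a]\<close>; here the argument \<open>x\<close> is itself a member of the class
  it represents.\<close>

definition reflector :: "('u preord, 'u mor, 'u preord, 'u mor) func" where
  "reflector =
     \<lparr>FObj = refl_obj,
      FArr = (\<lambda>(X, f, Y).
        (refl_obj X, restrict (\<lambda>x. cls (snd Y) (f x)) (fst (refl_obj X)), refl_obj Y))\<rparr>"

definition refl_unit :: "'u preord \<Rightarrow> 'u mor" where
  "refl_unit X = (X, restrict (cls (snd X)) (fst X), refl_obj X)"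

definition fully_faithful :: "'u mor \<Rightarrow> bool" where
  "fully_faithful = (\<lambda>((A, \<rho>), f, (B, \<sigma>)).
     \<forall>a\<in>A. \<forall>a'\<in>A. (a, a') \<in> \<rho> \<longleftrightarrow> (f a, f a') \<in> \<sigma>)"

definition surjective :: "'u mor \<Rightarrow> bool" where
  "surjective = (\<lambda>((A, \<rho>), f, (B, \<sigma>)). f ` A = B)"

text \<open>The classes \<open>\<E>\<close>, \<open>\<E>'\<close>, \<open>\<M>\<close>, \<open>\<M>\<^sup>*\<close> and the overlined \<open>\<E>\<close>.\<close>

definition E_class :: "'u set set \<Rightarrow> 'u mor set" where
  "E_class \<U> = inverted_by (PreOrd \<U>) (ParOrd \<U>) reflector"

definition E_stable :: "'u set set \<Rightarrow> 'u mor set" where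
  "E_stable \<U> = stably_in (PreOrd \<U>) (E_class \<U>)"

definition M_class :: "'u set set \<Rightarrow> 'u mor set" where
  "M_class \<U> = trivial_coverings (PreOrd \<U>) reflector inclusion refl_unit"

definition M_star :: "'u set set \<Rightarrow> 'u mor set" where
  "M_star \<U> = coverings (PreOrd \<U>) (M_class \<U>)"

definition E_bar :: "'u set set \<Rightarrow> 'u mor set" where
  "E_bar \<U> = {f \<in> Arr (PreOrd \<U>). surjective f \<and> fully_faithful f}"

end

theory Submission
  imports Defs
begin

text \<open>A morphism \<open>f\<close> turns out to be a covering iff \<open>a \<le> a' \<le> a\<close> and \<open>f a = f a'\<close> imply
  \<open>a = a'\<close>. Effective descent morphisms are surjective, because their pullback functors reflect
  isomorphisms, and pulling \<open>f\<close> back along a surjection does not hide a collapsed pair. Conversely,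
  every preordered set \<open>B\<close> is covered by a poset along a map \<open>p : E \<rightarrow> B\<close> lifting chains
  \<open>b\<^sub>0 \<le> b\<^sub>1 \<le> b\<^sub>2\<close>, and pulling back along it turns an \<open>f\<close> with the
  stated property into a map of posets, which is a trivial covering. Lifting of such chains implies
  effective descent: the quotient of a descent datum by its action has an order in which
  transitivity needs no zigzags. Finally \<open>f\<close> factors through the quotient of its domain
  identifying \<open>a, a'\<close> whenever \<open>a \<le> a' \<le> a\<close> and \<open>f a = f a'\<close>.\<close>

section \<open>Categories, functors and equivalences\<close>

text \<open>Effective descent is handled in two very different strengths. Where it is given, one
  consequence valid for every left adjoint suffices: reflection of isomorphisms, applied to the
  inclusion of the image of \<open>p\<close> into \<open>B\<close>, which becomes invertible after
  pulling back along \<open>p\<close>. Where it must be established, the left adjoint is fixed as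
  composition with \<open>p\<close>; an algebra on \<open>f : A -> E\<close> is an action moving a
  point \<open>a\<close> to any point \<open>e\<close> of \<open>E\<close> with
  \<open>p e = p (f a)\<close>. Lifting pairs already makes the comparison functor fully faithful.
  The third element of the chain serves essential surjectivity: comparisons
  \<open>q \<le> q' \<le> q''\<close> between orbits must be witnessed over a common middle point
  before they can be composed. The encoding adds an obstacle of its own: objects live on small
  subsets of one type, and pullbacks are arbitrary choices. Hence sets of pairs are moved into
  \<open>'u\<close> along injections, quotients live on chosen representatives, and pullbacks of
  preorders are handled by the elementwise criterion \<open>ptwise_pullback\<close>.\<close>

lemma HomD:
  assumes "f \<in> Hom C a b"
  shows "f \<in> Arr C" "Dom C f = a" "Cod C f = b"
  using assms by (auto simp: Hom_def)

lemma Arr_Hom: "f \<in> Arr C \<Longrightarrow> f \<in> Hom C (Dom C f) (Cod C f)"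
  by (simp add: Hom_def)

lemma
  assumes "is_category C"
  shows Idt_Hom: "a \<in> Obj C \<Longrightarrow> Idt C a \<in> Hom C a a"
    and Comp_Hom: "f \<in> Hom C a b \<Longrightarrow> g \<in> Hom C b c \<Longrightarrow> Comp C g f \<in> Hom C a c"
    and Comp_Idt_right: "f \<in> Hom C a b \<Longrightarrow> Comp C f (Idt C a) = f"
    and Comp_Idt_left: "f \<in> Hom C a b \<Longrightarrow> Comp C (Idt C b) f = f"
    and Comp_assoc: "f \<in> Hom C a b \<Longrightarrow> g \<in> Hom C b c \<Longrightarrow> h \<in> Hom C c d \<Longrightarrow>
      Comp C (Comp C h g) f = Comp C h (Comp C g f)"
    and Hom_Obj: "f \<in> Hom C a b \<Longrightarrow> a \<in> Obj C" "f \<in> Hom C a b \<Longrightarrow> b \<in> Obj C"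
  using assms unfolding is_category_def Hom_def by auto

lemma is_categoryI:
  assumes "\<And>f a b. f \<in> Hom C a b \<Longrightarrow> a \<in> Obj C \<and> b \<in> Obj C"
    and "\<And>a. a \<in> Obj C \<Longrightarrow> Idt C a \<in> Hom C a a"
    and "\<And>f g a b c. f \<in> Hom C a b \<Longrightarrow> g \<in> Hom C b c \<Longrightarrow> Comp C g f \<in> Hom C a c"
    and "\<And>f a b. f \<in> Hom C a b \<Longrightarrow> Comp C f (Idt C a) = f \<and> Comp C (Idt C b) f = f"
    and "\<And>f g h a b c d. f \<in> Hom C a b \<Longrightarrow> g \<in> Hom C b c \<Longrightarrow> h \<in> Hom C c d \<Longrightarrow>
      Comp C h (Comp C g f) = Comp C (Comp C h g) f"
  shows "is_category C"
  using assms unfolding is_category_def Hom_def by simp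

lemma is_isoI:
  assumes "f \<in> Hom C a b" "g \<in> Hom C b a" "Comp C g f = Idt C a" "Comp C f g = Idt C b"
  shows "is_iso C f"
  using assms unfolding is_iso_def Hom_def by auto

lemma is_isoE:
  assumes "is_iso C f" "f \<in> Hom C a b"
  obtains g where "g \<in> Hom C b a" "Comp C g f = Idt C a" "Comp C f g = Idt C b"
  using assms unfolding is_iso_def Hom_def by auto

lemma is_iso_Comp:
  assumes C: "is_category C" and f: "is_iso C f" "f \<in> Hom C a b" and g: "is_iso C g" "g \<in> Hom C b c"
  shows "is_iso C (Comp C g f)"
proof -
  obtain f' where f': "f' \<in> Hom C b a" "Comp C f' f = Idt C a" "Comp C f f' = Idt C b"
    using f by (rule is_isoE)
  obtain g' where g': "g' \<in> Hom C c b" "Comp C g' g = Idt C b" "Comp C g g' = Idt C c"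
    using g by (rule is_isoE)
  have gf: "Comp C g f \<in> Hom C a c" and fg': "Comp C f' g' \<in> Hom C c a"
    using C f g f' g' by (blast intro: Comp_Hom)+
  have "Comp C (Comp C f' g') (Comp C g f) = Comp C f' (Comp C (Comp C g' g) f)"
    using Comp_assoc[OF C gf g'(1) f'(1)] Comp_assoc[OF C f(2) g(2) g'(1)] by simp
  then have 1: "Comp C (Comp C f' g') (Comp C g f) = Idt C a"
    using g' f' f Comp_Idt_left[OF C f(2)] by simp
  have "Comp C (Comp C g f) (Comp C f' g') = Comp C g (Comp C (Comp C f f') g')"
    using Comp_assoc[OF C fg' f(2) g(2)] Comp_assoc[OF C g'(1) f'(1) f(2)] by simp
  then have 2: "Comp C (Comp C g f) (Comp C f' g') = Idt C c"
    using g' f' f Comp_Idt_left[OF C g'(1)] by simp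
  show ?thesis
    using gf fg' 1 2 by (rule is_isoI)
qed

lemma inverse_is_iso:
  assumes "f \<in> Hom C a b" "g \<in> Hom C b a" "Comp C g f = Idt C a" "Comp C f g = Idt C b"
  shows "is_iso C g"
  using assms(2,1,4,3) by (rule is_isoI)

lemma
  assumes "is_functor C D F"
  shows functor_Obj: "a \<in> Obj C \<Longrightarrow> FObj F a \<in> Obj D"
    and functor_Idt: "a \<in> Obj C \<Longrightarrow> FArr F (Idt C a) = Idt D (FObj F a)"
    and functor_Hom: "f \<in> Hom C a b \<Longrightarrow> FArr F f \<in> Hom D (FObj F a) (FObj F b)"
    and functor_Comp: "f \<in> Hom C a b \<Longrightarrow> g \<in> Hom C b c \<Longrightarrow>
      FArr F (Comp C g f) = Comp D (FArr F g) (FArr F f)"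
  using assms unfolding is_functor_def Hom_def by auto

lemma functor_iso:
  assumes C: "is_category C" and F: "is_functor C D F" and f: "is_iso C f" "f \<in> Hom C a b"
  shows "is_iso D (FArr F f)"
proof -
  obtain g where g: "g \<in> Hom C b a" "Comp C g f = Idt C a" "Comp C f g = Idt C b"
    using f by (rule is_isoE)
  show ?thesis
  proof (rule is_isoI)
    show "FArr F f \<in> Hom D (FObj F a) (FObj F b)" "FArr F g \<in> Hom D (FObj F b) (FObj F a)"
      using F f g by (blast intro: functor_Hom)+
    show "Comp D (FArr F g) (FArr F f) = Idt D (FObj F a)"
      "Comp D (FArr F f) (FArr F g) = Idt D (FObj F b)"
      using functor_Comp[OF F f(2) g(1)] functor_Comp[OF F g(1) f(2)] g
        functor_Idt[OF F] Hom_Obj[OF C f(2)] by auto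
  qed
qed

lemma comp_functor:
  assumes "is_functor C D F" "is_functor D E G"
  shows "is_functor C E (comp_func G F)"
  using assms unfolding is_functor_def comp_func_def Hom_def by auto

lemma
  assumes "nat_trans C D F G \<tau>"
  shows nat_trans_Hom: "a \<in> Obj C \<Longrightarrow> \<tau> a \<in> Hom D (FObj F a) (FObj G a)"
    and nat_trans_natural: "f \<in> Hom C a b \<Longrightarrow> Comp D (\<tau> b) (FArr F f) = Comp D (FArr G f) (\<tau> a)"
  using assms unfolding nat_trans_def Hom_def by auto

lemma id_func_simps [simp]: "FObj id_func a = a" "FArr id_func f = f"
  by (simp_all add: id_func_def)

lemma comp_func_simps [simp]:
  "FObj (comp_func G F) a = FObj G (FObj F a)" "FArr (comp_func G F) f = FArr G (FArr F f)"
  by (simp_all add: comp_func_def)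

text \<open>Choose \<open>h d\<close> with an isomorphism \<open>i d\<close> from
  \<open>K (h d)\<close> to \<open>d\<close> and its inverse \<open>j d\<close>. The quasi-inverse
  sends \<open>g : a -> b\<close> to the unique arrow lying over the composite of
  \<open>i a\<close>, \<open>g\<close> and \<open>j b\<close>. Since \<open>K\<close> is faithful,
  every equation in \<open>C\<close> may be checked after applying \<open>K\<close>, where adjacent
  \<open>i\<close> and \<open>j\<close> cancel.\<close>

lemma equivalence_if_fully_faithful_ess_surj:
  assumes C: "is_category C" and D: "is_category D" and K: "is_functor C D K"
    and ff: "\<And>a b g. a \<in> Obj C \<Longrightarrow> b \<in> Obj C \<Longrightarrow> g \<in> Hom D (FObj K a) (FObj K b) \<Longrightarrow>
      \<exists>!f. f \<in> Hom C a b \<and> FArr K f = g"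
    and es: "\<And>d. d \<in> Obj D \<Longrightarrow> \<exists>c\<in>Obj C. \<exists>i\<in>Hom D (FObj K c) d. is_iso D i"
  shows "is_equivalence C D K"
proof -
  obtain h i where h: "\<And>d. d \<in> Obj D \<Longrightarrow> h d \<in> Obj C"
    and i: "\<And>d. d \<in> Obj D \<Longrightarrow> i d \<in> Hom D (FObj K (h d)) d"
    and i_iso: "\<And>d. d \<in> Obj D \<Longrightarrow> is_iso D (i d)"
    using es by metis
  have "\<exists>g. g \<in> Hom D d (FObj K (h d)) \<and> Comp D g (i d) = Idt D (FObj K (h d)) \<and>
      Comp D (i d) g = Idt D d" if "d \<in> Obj D" for d
    using is_isoE[OF i_iso[OF that] i[OF that]] by blast
  then obtain j where j: "\<And>d. d \<in> Obj D \<Longrightarrow> j d \<in> Hom D d (FObj K (h d))"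
    and ji: "\<And>d. d \<in> Obj D \<Longrightarrow> Comp D (j d) (i d) = Idt D (FObj K (h d))"
    and ij: "\<And>d. d \<in> Obj D \<Longrightarrow> Comp D (i d) (j d) = Idt D d"
    by metis
  define lift where "lift a b g = (THE f. f \<in> Hom C a b \<and> FArr K f = g)" for a b g
  have lift: "lift a b g \<in> Hom C a b" "FArr K (lift a b g) = g"
    if "a \<in> Obj C" "b \<in> Obj C" "g \<in> Hom D (FObj K a) (FObj K b)" for a b g
    using theI'[OF ff[OF that]] by (auto simp: lift_def)
  have faithful: "f = f'" if "f \<in> Hom C a b" "f' \<in> Hom C a b" "FArr K f = FArr K f'" for a b f f'
    using ff[OF Hom_Obj[OF C that(1)] functor_Hom[OF K that(1)]] that by metis
  define H where "H = \<lparr>FObj = h, FArr = (\<lambda>g. lift (h (Dom D g)) (h (Cod D g))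
    (Comp D (j (Cod D g)) (Comp D g (i (Dom D g)))))\<rparr>"
  have H_Obj: "FObj H d = h d" for d
    by (simp add: H_def)
  have conj: "Comp D (j e) (Comp D g (i d)) \<in> Hom D (FObj K (h d)) (FObj K (h e))"
    if "g \<in> Hom D d e" for g d e
    using Comp_Hom[OF D Comp_Hom[OF D i that] j] Hom_Obj[OF D that] by blast
  have H_Hom: "FArr H g \<in> Hom C (h d) (h e)"
    and KH: "FArr K (FArr H g) = Comp D (j e) (Comp D g (i d))" if "g \<in> Hom D d e" for g d e
    using lift[OF h h conj[OF that]] Hom_Obj[OF D that] HomD[OF that] by (auto simp: H_def)
  have H: "is_functor D C H"
    unfolding is_functor_def H_Obj
  proof (intro conjI ballI impI)
    fix d assume d: "d \<in> Obj D"
    show "h d \<in> Obj C" by (rule h[OF d])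
    note idd = Idt_Hom[OF D d] and idhd = Idt_Hom[OF C h[OF d]]
    have "FArr K (FArr H (Idt D d)) = FArr K (Idt C (h d))"
      unfolding KH[OF idd] Comp_Idt_left[OF D i[OF d]] ji[OF d] functor_Idt[OF K h[OF d]] ..
    then show "FArr H (Idt D d) = Idt C (h d)"
      by (rule faithful[OF H_Hom[OF idd] idhd])
  next
    fix g assume "g \<in> Arr D"
    then show "FArr H g \<in> Hom C (h (Dom D g)) (h (Cod D g))"
      by (intro H_Hom Arr_Hom)
  next
    fix f g assume "f \<in> Arr D" "g \<in> Arr D" "Cod D f = Dom D g"
    then obtain a b c where f: "f \<in> Hom D a b" and g: "g \<in> Hom D b c"
      by (metis Arr_Hom)
    note obj = Hom_Obj[OF D f] Hom_Obj[OF D g]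
    have gf: "Comp D g f \<in> Hom D a c" by (rule Comp_Hom[OF D f g])
    have fi: "Comp D f (i a) \<in> Hom D (FObj K (h a)) b"
      by (rule Comp_Hom[OF D i[OF obj(1)] f])
    have jg: "Comp D (j c) g \<in> Hom D b (FObj K (h c))"
      by (rule Comp_Hom[OF D g j[OF obj(4)]])
    have KHf: "FArr K (FArr H f) \<in> Hom D (FObj K (h a)) (FObj K (h b))"
      using KH[OF f] conj[OF f] by simp
    show "FArr H (Comp D g f) = Comp C (FArr H g) (FArr H f)"
    proof (rule faithful[OF H_Hom[OF gf] Comp_Hom[OF C H_Hom[OF f] H_Hom[OF g]]])
      have "FArr K (Comp C (FArr H g) (FArr H f)) = Comp D (FArr K (FArr H g)) (FArr K (FArr H f))"
        by (rule functor_Comp[OF K H_Hom[OF f] H_Hom[OF g]])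
      also have "\<dots> = Comp D (Comp D (Comp D (j c) g) (i b)) (FArr K (FArr H f))"
        using KH[OF g] Comp_assoc[OF D i[OF obj(2)] g j[OF obj(4)]] by simp
      also have "\<dots> = Comp D (Comp D (j c) g) (Comp D (i b) (Comp D (j b) (Comp D f (i a))))"
        using Comp_assoc[OF D KHf i[OF obj(2)] jg] KH[OF f] by simp
      also have "Comp D (i b) (Comp D (j b) (Comp D f (i a))) = Comp D f (i a)"
        using Comp_assoc[OF D fi j[OF obj(2)] i[OF obj(2)]] ij[OF obj(2)] Comp_Idt_left[OF D fi]
        by simp
      also have "Comp D (Comp D (j c) g) (Comp D f (i a)) = Comp D (j c) (Comp D (Comp D g f) (i a))"
        using Comp_assoc[OF D fi g j[OF obj(4)]] Comp_assoc[OF D i[OF obj(1)] f g] by simp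
      finally show "FArr K (FArr H (Comp D g f)) = FArr K (Comp C (FArr H g) (FArr H f))"
        using KH[OF gf] by simp
    qed
  qed
  \<comment> \<open>Full faithfulness lifts \<open>j (K c)\<close> and its inverse
    \<open>i (K c)\<close> to arrows of \<open>C\<close>, and faithfulness makes the lifts inverse
    to each other.\<close>
  define \<alpha> where "\<alpha> c = lift c (h (FObj K c)) (j (FObj K c))" for c
  define \<alpha>' where "\<alpha>' c = lift (h (FObj K c)) c (i (FObj K c))" for c
  have \<alpha>: "\<alpha> c \<in> Hom C c (h (FObj K c))" "FArr K (\<alpha> c) = j (FObj K c)"
    "\<alpha>' c \<in> Hom C (h (FObj K c)) c" "FArr K (\<alpha>' c) = i (FObj K c)" if "c \<in> Obj C" for c
    unfolding \<alpha>_def \<alpha>'_def using functor_Obj[OF K that]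
    by (simp_all add: lift[OF that h j] lift[OF h that i])
  have \<alpha>_iso: "is_iso C (\<alpha> c)" if c: "c \<in> Obj C" for c
  proof (rule is_isoI[OF \<alpha>(1)[OF c] \<alpha>(3)[OF c]])
    note Kc = functor_Obj[OF K c]
    show "Comp C (\<alpha>' c) (\<alpha> c) = Idt C c"
      using faithful[OF Comp_Hom[OF C \<alpha>(1)[OF c] \<alpha>(3)[OF c]] Idt_Hom[OF C c]]
        functor_Comp[OF K \<alpha>(1)[OF c] \<alpha>(3)[OF c]] functor_Idt[OF K c] \<alpha>[OF c] ij[OF Kc] by simp
    show "Comp C (\<alpha> c) (\<alpha>' c) = Idt C (h (FObj K c))"
      using faithful[OF Comp_Hom[OF C \<alpha>(3)[OF c] \<alpha>(1)[OF c]] Idt_Hom[OF C h[OF Kc]]]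
        functor_Comp[OF K \<alpha>(3)[OF c] \<alpha>(1)[OF c]] functor_Idt[OF K h[OF Kc]] \<alpha>[OF c] ji[OF Kc] by simp
  qed
  have "nat_iso C C id_func (comp_func H K) \<alpha>"
    unfolding nat_iso_def nat_trans_def
  proof (intro conjI ballI)
    fix f assume "f \<in> Arr C"
    then obtain a b where f: "f \<in> Hom C a b" "Dom C f = a" "Cod C f = b"
      using Arr_Hom by metis
    note obj = Hom_Obj[OF C f(1)]
    note Kf = functor_Hom[OF K f(1)]
    note Kobj = functor_Obj[OF K obj(1)] functor_Obj[OF K obj(2)]
    note HKf = H_Hom[OF Kf]
    have "Comp C (\<alpha> b) f = Comp C (FArr H (FArr K f)) (\<alpha> a)"
    proof (rule faithful)
      show "Comp C (\<alpha> b) f \<in> Hom C a (h (FObj K b))"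
        by (rule Comp_Hom[OF C f(1) \<alpha>(1)[OF obj(2)]])
      show "Comp C (FArr H (FArr K f)) (\<alpha> a) \<in> Hom C a (h (FObj K b))"
        by (rule Comp_Hom[OF C \<alpha>(1)[OF obj(1)] HKf])
      have 1: "FArr K (Comp C (\<alpha> b) f) = Comp D (j (FObj K b)) (FArr K f)"
        using functor_Comp[OF K f(1) \<alpha>(1)[OF obj(2)]] \<alpha>(2)[OF obj(2)] by simp
      have "FArr K (Comp C (FArr H (FArr K f)) (\<alpha> a)) =
          Comp D (Comp D (j (FObj K b)) (Comp D (FArr K f) (i (FObj K a)))) (j (FObj K a))"
        using functor_Comp[OF K \<alpha>(1)[OF obj(1)] HKf] \<alpha>(2)[OF obj(1)] KH[OF Kf] by simp
      also have "\<dots> = Comp D (Comp D (Comp D (j (FObj K b)) (FArr K f)) (i (FObj K a))) (j (FObj K a))"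
        using Comp_assoc[OF D i[OF Kobj(1)] Kf j[OF Kobj(2)]] by simp
      also have "\<dots> = Comp D (j (FObj K b)) (FArr K f)"
        using Comp_assoc[OF D j[OF Kobj(1)] i[OF Kobj(1)] Comp_Hom[OF D Kf j[OF Kobj(2)]]]
          ij[OF Kobj(1)] Comp_Idt_right[OF D Comp_Hom[OF D Kf j[OF Kobj(2)]]] by simp
      finally show "FArr K (Comp C (\<alpha> b) f) = FArr K (Comp C (FArr H (FArr K f)) (\<alpha> a))"
        using 1 by simp
    qed
    then show "Comp C (\<alpha> (Cod C f)) (FArr id_func f) = Comp C (FArr (comp_func H K) f) (\<alpha> (Dom C f))"
      using f by simp
  qed (use \<alpha> \<alpha>_iso H_Obj in auto)
  moreover have "nat_iso D D (comp_func K H) id_func i"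
    unfolding nat_iso_def nat_trans_def
  proof (intro conjI ballI)
    fix g assume "g \<in> Arr D"
    then obtain a b where g: "g \<in> Hom D a b" "Dom D g = a" "Cod D g = b"
      using Arr_Hom by metis
    note obj = Hom_Obj[OF D g(1)]
    have gi: "Comp D g (i a) \<in> Hom D (FObj K (h a)) b"
      by (rule Comp_Hom[OF D i[OF obj(1)] g(1)])
    have "Comp D (i b) (FArr K (FArr H g)) = Comp D g (i a)"
      using KH[OF g(1)] Comp_assoc[OF D gi j[OF obj(2)] i[OF obj(2)]] ij[OF obj(2)]
        Comp_Idt_left[OF D gi] by simp
    then show "Comp D (i (Cod D g)) (FArr (comp_func K H) g) = Comp D (FArr id_func g) (i (Dom D g))"
      using g by simp
  qed (use i i_iso H_Obj in auto)
  ultimately show ?thesis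
    unfolding is_equivalence_def using K H by blast
qed

text \<open>By naturality of \<open>\<alpha>\<close>, \<open>f\<close> is the composite of
  \<open>\<alpha> a\<close>, \<open>H (K f)\<close> and the inverse \<open>\<beta>\<close> of
  \<open>\<alpha> b\<close>; all three are isomorphisms once \<open>K f\<close> is one.\<close>

lemma equivalence_reflects_iso:
  assumes C: "is_category C" and D: "is_category D" and K: "is_equivalence C D K"
    and f: "f \<in> Hom C a b" and Kf: "is_iso D (FArr K f)"
  shows "is_iso C f"
proof -
  from K obtain H \<alpha> where KF: "is_functor C D K" and H: "is_functor D C H"
    and \<alpha>: "nat_iso C C id_func (comp_func H K) \<alpha>"
    unfolding is_equivalence_def by blast
  have \<alpha>_nat: "nat_trans C C id_func (comp_func H K) \<alpha>" and \<alpha>_iso: "\<And>c. c \<in> Obj C \<Longrightarrow> is_iso C (\<alpha> c)"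
    using \<alpha> unfolding nat_iso_def by auto
  note obj = Hom_Obj[OF C f]
  note HKf = functor_Hom[OF H functor_Hom[OF KF f]]
  have \<alpha>a: "\<alpha> a \<in> Hom C a (FObj H (FObj K a))" and \<alpha>b: "\<alpha> b \<in> Hom C b (FObj H (FObj K b))"
    using nat_trans_Hom[OF \<alpha>_nat] obj by auto
  obtain \<beta> where \<beta>: "\<beta> \<in> Hom C (FObj H (FObj K b)) b" "Comp C \<beta> (\<alpha> b) = Idt C b"
      "Comp C (\<alpha> b) \<beta> = Idt C (FObj H (FObj K b))"
    using is_isoE[OF \<alpha>_iso[OF obj(2)] \<alpha>b] by blast
  have "is_iso C (Comp C \<beta> (Comp C (FArr H (FArr K f)) (\<alpha> a)))"
  proof (rule is_iso_Comp[OF C])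
    show "is_iso C (Comp C (FArr H (FArr K f)) (\<alpha> a))"
      by (rule is_iso_Comp[OF C \<alpha>_iso[OF obj(1)] \<alpha>a functor_iso[OF D H Kf functor_Hom[OF KF f]] HKf])
    show "Comp C (FArr H (FArr K f)) (\<alpha> a) \<in> Hom C a (FObj H (FObj K b))"
      by (rule Comp_Hom[OF C \<alpha>a HKf])
    show "is_iso C \<beta>"
      by (rule inverse_is_iso[OF \<alpha>b \<beta>])
  qed (rule \<beta>)
  moreover have "Comp C \<beta> (Comp C (FArr H (FArr K f)) (\<alpha> a)) = f"
    using nat_trans_natural[OF \<alpha>_nat f] Comp_assoc[OF C f \<alpha>b \<beta>(1)] \<beta>(2) Comp_Idt_left[OF C f]
    by simp
  ultimately show ?thesis by simp
qed

section \<open>Slices, Eilenberg--Moore algebras and monadicity\<close>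

lemma pullback_unique_exists:
  assumes pb: "is_pullback C q r f g" and u: "u \<in> Hom C c (Dom C f)" and v: "v \<in> Hom C c (Dom C g)"
    and uv: "Comp C f u = Comp C g v"
  shows "\<exists>!k. k \<in> Hom C c (Dom C q) \<and> Comp C q k = u \<and> Comp C r k = v"
proof -
  have "\<forall>u\<in>Arr C. \<forall>v\<in>Arr C.
      Dom C u = Dom C v \<and> Cod C u = Dom C f \<and> Cod C v = Dom C g \<and> Comp C f u = Comp C g v \<longrightarrow>
      (\<exists>!k. k \<in> Hom C (Dom C u) (Dom C q) \<and> Comp C q k = u \<and> Comp C r k = v)"
    using pb unfolding is_pullback_def by (elim conjE)
  from this[rule_format, OF HomD(1)[OF u] HomD(1)[OF v]] show ?thesis
    using HomD(2,3)[OF u] HomD(2,3)[OF v] uv by simp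
qed

lemma slice_simps [simp]:
  "Obj (slice_cat C b) = {f \<in> Arr C. Cod C f = b}"
  "Dom (slice_cat C b) (f, h, g) = f"
  "Cod (slice_cat C b) (f, h, g) = g"
  "Idt (slice_cat C b) f = (f, Idt C (Dom C f), f)"
  "Comp (slice_cat C b) (g, k, l) (f, h, g') = (f, Comp C k h, l)"
  by (simp_all add: slice_cat_def)

lemma slice_Arr: "\<phi> \<in> Arr (slice_cat C b) \<longleftrightarrow>
    (\<exists>f h g. \<phi> = (f, h, g) \<and> f \<in> Arr C \<and> Cod C f = b \<and> g \<in> Arr C \<and> Cod C g = b \<and>
      h \<in> Hom C (Dom C f) (Dom C g) \<and> Comp C g h = f)"
  by (auto simp: slice_cat_def)

lemma slice_ArrE:
  assumes "\<phi> \<in> Arr (slice_cat C b)"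
  obtains f h g where "\<phi> = (f, h, g)" "f \<in> Hom C (Dom C f) b" "g \<in> Hom C (Dom C g) b"
    "h \<in> Hom C (Dom C f) (Dom C g)" "Comp C g h = f"
  using assms unfolding slice_Arr Hom_def by blast

lemma slice_Hom: "\<phi> \<in> Hom (slice_cat C b) f g \<longleftrightarrow>
    (\<exists>h. \<phi> = (f, h, g) \<and> f \<in> Hom C (Dom C f) b \<and> g \<in> Hom C (Dom C g) b \<and>
      h \<in> Hom C (Dom C f) (Dom C g) \<and> Comp C g h = f)"
  by (auto simp: Hom_def slice_cat_def)

lemma slice_category:
  assumes C: "is_category C"
  shows "is_category (slice_cat C b)"
proof (rule is_categoryI, goal_cases)
  case (1 \<phi> f g)
  then show ?case by (auto simp: slice_Hom dest: HomD)
next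
  case (2 f)
  then have "f \<in> Hom C (Dom C f) b" by (auto simp: Hom_def)
  then show ?case
    using Idt_Hom[OF C] Hom_Obj(1)[OF C] Comp_Idt_right[OF C] by (simp add: slice_Hom)
next
  case (3 \<phi> \<psi> f g k)
  then obtain u v where uv: "\<phi> = (f, u, g)" "\<psi> = (g, v, k)"
    "f \<in> Hom C (Dom C f) b" "k \<in> Hom C (Dom C k) b" "u \<in> Hom C (Dom C f) (Dom C g)"
    "v \<in> Hom C (Dom C g) (Dom C k)" "Comp C g u = f" "Comp C k v = g"
    by (auto simp: slice_Hom)
  then show ?case
    using Comp_assoc[OF C uv(5,6,4)] Comp_Hom[OF C uv(5,6)] by (simp add: slice_Hom)
next
  case (4 \<phi> f g)
  then show ?case by (auto simp: slice_Hom Comp_Idt_left[OF C] Comp_Idt_right[OF C])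
next
  case (5 \<phi> \<psi> \<chi> f g k l)
  then obtain u v w where uvw: "\<phi> = (f, u, g)" "\<psi> = (g, v, k)" "\<chi> = (k, w, l)"
    "u \<in> Hom C (Dom C f) (Dom C g)" "v \<in> Hom C (Dom C g) (Dom C k)" "w \<in> Hom C (Dom C k) (Dom C l)"
    by (auto simp: slice_Hom)
  show ?case
    using Comp_assoc[OF C uvw(4-6)] by (simp add: uvw(1-3))
qed

text \<open>An inverse \<open>k\<close> of \<open>h\<close> lies over \<open>b\<close>
  automatically: \<open>f k = g h k = g\<close>.\<close>

lemma slice_iso:
  assumes \<phi>: "(f, h, g) \<in> Hom (slice_cat C b) f g" and C: "is_category C"
  shows "is_iso (slice_cat C b) (f, h, g) \<longleftrightarrow> is_iso C h"
proof
  from \<phi> have f: "f \<in> Hom C (Dom C f) b" and g: "g \<in> Hom C (Dom C g) b"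
    and h: "h \<in> Hom C (Dom C f) (Dom C g)" and gh: "Comp C g h = f"
    by (auto simp: slice_Hom)
  {
    assume "is_iso C h"
    then obtain k where k: "k \<in> Hom C (Dom C g) (Dom C f)"
      "Comp C k h = Idt C (Dom C f)" "Comp C h k = Idt C (Dom C g)"
      using h by (rule is_isoE)
    have "Comp C f k = g"
      using Comp_assoc[OF C k(1) h g] k gh Comp_Idt_right[OF C g] by simp
    then have "(g, k, f) \<in> Hom (slice_cat C b) g f"
      using f g k by (simp add: slice_Hom)
    then show "is_iso (slice_cat C b) (f, h, g)"
      using \<phi> k by (intro is_isoI[where g = "(g, k, f)"]) auto
  next
    assume "is_iso (slice_cat C b) (f, h, g)"
    then obtain \<psi> where "\<psi> \<in> Hom (slice_cat C b) g f"
      "Comp (slice_cat C b) \<psi> (f, h, g) = Idt (slice_cat C b) f"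
      "Comp (slice_cat C b) (f, h, g) \<psi> = Idt (slice_cat C b) g"
      using \<phi> by (rule is_isoE)
    then show "is_iso C h"
      using h by (auto simp: slice_Hom intro: is_isoI)
  }
qed

section \<open>Eilenberg--Moore algebras\<close>

lemma em_simps [simp]:
  "Obj (em_cat C T \<eta> \<mu>) = em_algebras C T \<eta> \<mu>"
  "Dom (em_cat C T \<eta> \<mu>) (x, f, y) = x"
  "Cod (em_cat C T \<eta> \<mu>) (x, f, y) = y"
  "Idt (em_cat C T \<eta> \<mu>) x = (x, Idt C (fst x), x)"
  "Comp (em_cat C T \<eta> \<mu>) (y, g, z) (x, f, y') = (x, Comp C g f, z)"
  by (simp_all add: em_cat_def)

lemma em_Hom: "\<phi> \<in> Hom (em_cat C T \<eta> \<mu>) (a, h) (b, k) \<longleftrightarrow>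
    (\<exists>f. \<phi> = ((a, h), f, (b, k)) \<and> (a, h) \<in> em_algebras C T \<eta> \<mu> \<and>
      (b, k) \<in> em_algebras C T \<eta> \<mu> \<and> f \<in> Hom C a b \<and> Comp C f h = Comp C k (FArr T f))"
  by (auto simp: Hom_def em_cat_def)

lemma em_algebra_Hom: "(a, h) \<in> em_algebras C T \<eta> \<mu> \<Longrightarrow> h \<in> Hom C (FObj T a) a"
  and em_algebra_Obj: "(a, h) \<in> em_algebras C T \<eta> \<mu> \<Longrightarrow> a \<in> Obj C"
  by (auto simp: em_algebras_def)

lemma em_category:
  assumes C: "is_category C" and T: "is_functor C C T"
  shows "is_category (em_cat C T \<eta> \<mu>)"
proof -
  have comp: "Comp C (Comp C g f) h = Comp C l (FArr T (Comp C g f))"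
    if "(a, h) \<in> em_algebras C T \<eta> \<mu>" "(b, k) \<in> em_algebras C T \<eta> \<mu>" "(c, l) \<in> em_algebras C T \<eta> \<mu>"
      "f \<in> Hom C a b" "Comp C f h = Comp C k (FArr T f)"
      "g \<in> Hom C b c" "Comp C g k = Comp C l (FArr T g)" for a h b k c l f g
    using Comp_assoc[OF C em_algebra_Hom[OF that(1)] that(4,6)] that(5,7)
      Comp_assoc[OF C functor_Hom[OF T that(4)] em_algebra_Hom[OF that(2)] that(6)]
      Comp_assoc[OF C functor_Hom[OF T that(4)] functor_Hom[OF T that(6)] em_algebra_Hom[OF that(3)]]
      functor_Comp[OF T that(4,6)] by simp
  have idt: "Comp C (Idt C a) h = Comp C h (FArr T (Idt C a))"
    if "(a, h) \<in> em_algebras C T \<eta> \<mu>" for a h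
    using em_algebra_Hom[OF that] em_algebra_Obj[OF that]
    by (simp add: functor_Idt[OF T] Comp_Idt_left[OF C] Comp_Idt_right[OF C])
  show ?thesis
  proof (rule is_categoryI, goal_cases)
    case (1 \<phi> x y)
    then show ?case by (cases x; cases y) (auto simp: em_Hom)
  next
    case (2 x)
    then show ?case
      by (cases x) (auto simp: em_Hom idt intro: Idt_Hom[OF C] em_algebra_Obj)
  next
    case (3 \<phi> \<psi> x y z)
    then show ?case
      by (cases x; cases y; cases z) (auto simp: em_Hom intro: Comp_Hom[OF C] comp)
  next
    case (4 \<phi> x y)
    then show ?case
      by (cases x; cases y) (auto simp: em_Hom Comp_Idt_left[OF C] Comp_Idt_right[OF C])
  next
    case (5 \<phi> \<psi> \<chi> x y z w)
    then show ?case
      by (cases x; cases y; cases z; cases w) (auto simp: em_Hom Comp_assoc[OF C])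
  qed
qed

text \<open>The inverse \<open>g\<close> of an algebra map commutes with the structure maps as well:
  insert \<open>T f\<close> after \<open>T g\<close>, which is an identity, into \<open>g k\<close>
  and use the equation for \<open>f\<close>. Hence the forgetful functor from algebras reflects
  isomorphisms.\<close>

lemma em_isoI:
  assumes C: "is_category C" and T: "is_functor C C T"
    and \<phi>: "((a, h), f, (b, k)) \<in> Hom (em_cat C T \<eta> \<mu>) (a, h) (b, k)" and f: "is_iso C f"
  shows "is_iso (em_cat C T \<eta> \<mu>) ((a, h), f, (b, k))"
proof -
  from \<phi> have ah: "(a, h) \<in> em_algebras C T \<eta> \<mu>" and bk: "(b, k) \<in> em_algebras C T \<eta> \<mu>"
    and fH: "f \<in> Hom C a b" and fh: "Comp C f h = Comp C k (FArr T f)"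
    by (auto simp: em_Hom)
  obtain g where g: "g \<in> Hom C b a" "Comp C g f = Idt C a" "Comp C f g = Idt C b"
    using f fH by (rule is_isoE)
  note h = em_algebra_Hom[OF ah] and k = em_algebra_Hom[OF bk]
  note Tf = functor_Hom[OF T fH] and Tg = functor_Hom[OF T g(1)]
  have TfTg: "Comp C (FArr T f) (FArr T g) = Idt C (FObj T b)"
    using functor_Comp[OF T g(1) fH] g(3) functor_Idt[OF T Hom_Obj(2)[OF C fH]] by simp
  have "Comp C g k = Comp C (Comp C g k) (Comp C (FArr T f) (FArr T g))"
    using Comp_Idt_right[OF C Comp_Hom[OF C k g(1)]] TfTg by simp
  also have "\<dots> = Comp C g (Comp C (Comp C k (FArr T f)) (FArr T g))"
    using Comp_assoc[OF C Comp_Hom[OF C Tg Tf] k g(1)] Comp_assoc[OF C Tg Tf k] by simp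
  also have "\<dots> = Comp C g (Comp C f (Comp C h (FArr T g)))"
    using fh Comp_assoc[OF C Tg h fH] by simp
  also have "\<dots> = Comp C h (FArr T g)"
    using Comp_assoc[OF C Comp_Hom[OF C Tg h] fH g(1)] g(2) Comp_Idt_left[OF C Comp_Hom[OF C Tg h]]
    by simp
  finally have "((b, k), g, (a, h)) \<in> Hom (em_cat C T \<eta> \<mu>) (b, k) (a, h)"
    using ah bk g by (simp add: em_Hom)
  then show ?thesis
    using \<phi> g by (intro is_isoI[where g = "((b, k), g, (a, h))"]) auto
qed

section \<open>The comparison functor and monadicity\<close>

lemma comparison_simps [simp]:
  "FObj (comparison D R \<epsilon>) x = (FObj R x, FArr R (\<epsilon> x))"
  "FArr (comparison D R \<epsilon>) f = ((FObj R (Dom D f), FArr R (\<epsilon> (Dom D f))), FArr R f,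
     (FObj R (Cod D f), FArr R (\<epsilon> (Cod D f))))"
  by (simp_all add: comparison_def)

lemma adjunctionD:
  assumes "is_adjunction C D L R \<eta> \<epsilon>"
  shows "is_functor C D L" "is_functor D C R"
    "nat_trans C C id_func (comp_func R L) \<eta>" "nat_trans D D (comp_func L R) id_func \<epsilon>"
    "a \<in> Obj C \<Longrightarrow> Comp D (\<epsilon> (FObj L a)) (FArr L (\<eta> a)) = Idt D (FObj L a)"
    "x \<in> Obj D \<Longrightarrow> Comp C (FArr R (\<epsilon> x)) (\<eta> (FObj R x)) = Idt C (FObj R x)"
  using assms unfolding is_adjunction_def by auto

lemma comparison_functor:
  assumes D: "is_category D" and adj: "is_adjunction C D L R \<eta> \<epsilon>"
  shows "is_functor D (em_cat C (comp_func R L) \<eta> (\<lambda>a. FArr R (\<epsilon> (FObj L a)))) (comparison D R \<epsilon>)"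
proof -
  note L = adjunctionD(1)[OF adj] and R = adjunctionD(2)[OF adj]
  note \<epsilon>n = adjunctionD(4)[OF adj]
  have \<epsilon>: "\<epsilon> x \<in> Hom D (FObj L (FObj R x)) x" if "x \<in> Obj D" for x
    using nat_trans_Hom[OF \<epsilon>n that] by simp
  have nat: "Comp C (FArr R (\<epsilon> y)) (FArr R (FArr L (FArr R f))) = Comp C (FArr R f) (FArr R (\<epsilon> x))"
    if f: "f \<in> Hom D x y" for f x y
    using nat_trans_natural[OF \<epsilon>n f] functor_Comp[OF R functor_Hom[OF L functor_Hom[OF R f]] \<epsilon>]
      functor_Comp[OF R \<epsilon> f] Hom_Obj[OF D f] by simp
  \<comment> \<open>Associativity of the structure map \<open>R (\<epsilon> x)\<close> is naturality
    of the counit at the counit itself; the unit law is a triangle identity.\<close>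
  have alg: "(FObj R x, FArr R (\<epsilon> x)) \<in> em_algebras C (comp_func R L) \<eta> (\<lambda>a. FArr R (\<epsilon> (FObj L a)))"
    if x: "x \<in> Obj D" for x
    using functor_Obj[OF R x] functor_Hom[OF R \<epsilon>[OF x]] adjunctionD(6)[OF adj x] nat[OF \<epsilon>[OF x]]
    by (simp add: em_algebras_def)
  show ?thesis
    unfolding is_functor_def
  proof (intro conjI ballI impI)
    fix f assume "f \<in> Arr D"
    then have f: "f \<in> Hom D (Dom D f) (Cod D f)"
      by (rule Arr_Hom)
    show "FArr (comparison D R \<epsilon>) f \<in> Hom (em_cat C (comp_func R L) \<eta> (\<lambda>a. FArr R (\<epsilon> (FObj L a))))
        (FObj (comparison D R \<epsilon>) (Dom D f)) (FObj (comparison D R \<epsilon>) (Cod D f))"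
      using alg Hom_Obj[OF D f] functor_Hom[OF R f] nat[OF f] by (simp add: em_Hom)
    fix g assume "g \<in> Arr D" "Cod D f = Dom D g"
    then have g: "g \<in> Hom D (Cod D f) (Cod D g)"
      by (simp add: Hom_def)
    show "FArr (comparison D R \<epsilon>) (Comp D g f) =
        Comp (em_cat C (comp_func R L) \<eta> (\<lambda>a. FArr R (\<epsilon> (FObj L a))))
          (FArr (comparison D R \<epsilon>) g) (FArr (comparison D R \<epsilon>) f)"
      using functor_Comp[OF R f g] HomD[OF Comp_Hom[OF D f g]] by simp
  next
    fix x assume x: "x \<in> Obj D"
    show "FObj (comparison D R \<epsilon>) x \<in> Obj (em_cat C (comp_func R L) \<eta> (\<lambda>a. FArr R (\<epsilon> (FObj L a))))"
      using alg[OF x] by simp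
    show "FArr (comparison D R \<epsilon>) (Idt D x) = Idt (em_cat C (comp_func R L) \<eta>
        (\<lambda>a. FArr R (\<epsilon> (FObj L a)))) (FObj (comparison D R \<epsilon>) x)"
      using functor_Idt[OF R x] HomD[OF Idt_Hom[OF D x]] by simp
  qed
qed

text \<open>The argument works for whichever left adjoint witnesses \<open>monadic\<close>:
  \<open>em_isoI\<close> makes the image of \<open>f\<close> among the algebras invertible, and the
  comparison functor, being an equivalence, reflects this.\<close>

lemma monadic_reflects_iso:
  assumes C: "is_category C" and D: "is_category D" and R: "monadic D C R"
    and f: "f \<in> Hom D x y" and Rf: "is_iso C (FArr R f)"
  shows "is_iso D f"
proof -
  from R obtain L \<eta> \<epsilon> where adj: "is_adjunction C D L R \<eta> \<epsilon>"
    and eq: "is_equivalence D (em_cat C (comp_func R L) \<eta> (\<lambda>a. FArr R (\<epsilon> (FObj L a))))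
      (comparison D R \<epsilon>)"
    unfolding monadic_def by blast
  note T = comp_functor[OF adjunctionD(1,2)[OF adj]]
  show ?thesis
  proof (rule equivalence_reflects_iso[OF D em_category[OF C T] eq f])
    show "is_iso (em_cat C (comp_func R L) \<eta> (\<lambda>a. FArr R (\<epsilon> (FObj L a)))) (FArr (comparison D R \<epsilon>) f)"
      using em_isoI[OF C T _ Rf] functor_Hom[OF comparison_functor[OF D adj] f] HomD[OF f] by simp
  qed
qed

text \<open>Assumption \<open>ff\<close> is full faithfulness of the comparison functor and
  \<open>es\<close> its essential surjectivity, both phrased in \<open>C\<close> and
  \<open>D\<close> so that the triples encoding algebra maps do not appear.\<close>

lemma monadicI:
  assumes C: "is_category C" and D: "is_category D" and adj: "is_adjunction C D L R \<eta> \<epsilon>"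
    and ff: "\<And>x y g. x \<in> Obj D \<Longrightarrow> y \<in> Obj D \<Longrightarrow> g \<in> Hom C (FObj R x) (FObj R y) \<Longrightarrow>
      Comp C g (FArr R (\<epsilon> x)) = Comp C (FArr R (\<epsilon> y)) (FArr R (FArr L g)) \<Longrightarrow>
      \<exists>!f. f \<in> Hom D x y \<and> FArr R f = g"
    and es: "\<And>a h. (a, h) \<in> em_algebras C (comp_func R L) \<eta> (\<lambda>a. FArr R (\<epsilon> (FObj L a))) \<Longrightarrow>
      \<exists>x\<in>Obj D. \<exists>i\<in>Hom C (FObj R x) a. is_iso C i \<and>
        Comp C i (FArr R (\<epsilon> x)) = Comp C h (FArr R (FArr L i))"
  shows "monadic D C R"
proof -
  note T = comp_functor[OF adjunctionD(1,2)[OF adj]]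
  note K = comparison_functor[OF D adj]
  let ?EM = "em_cat C (comp_func R L) \<eta> (\<lambda>a. FArr R (\<epsilon> (FObj L a)))"
  let ?K = "comparison D R \<epsilon>"
  have "is_equivalence D ?EM ?K"
  proof (rule equivalence_if_fully_faithful_ess_surj[OF D em_category[OF C T] K])
    fix x y \<phi> assume x: "x \<in> Obj D" and y: "y \<in> Obj D" and "\<phi> \<in> Hom ?EM (FObj ?K x) (FObj ?K y)"
    then obtain g where \<phi>: "\<phi> = ((FObj R x, FArr R (\<epsilon> x)), g, (FObj R y, FArr R (\<epsilon> y)))"
      and g: "g \<in> Hom C (FObj R x) (FObj R y)"
        "Comp C g (FArr R (\<epsilon> x)) = Comp C (FArr R (\<epsilon> y)) (FArr R (FArr L g))"
      by (auto simp: em_Hom)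
    have "(f \<in> Hom D x y \<and> FArr ?K f = \<phi>) \<longleftrightarrow> (f \<in> Hom D x y \<and> FArr R f = g)" for f
      by (auto simp: \<phi> Hom_def)
    then show "\<exists>!f. f \<in> Hom D x y \<and> FArr ?K f = \<phi>"
      using ff[OF x y g] by simp
  next
    fix d assume "d \<in> Obj ?EM"
    then obtain a h where d: "d = (a, h)" and ah: "(a, h) \<in> em_algebras C (comp_func R L) \<eta>
        (\<lambda>a. FArr R (\<epsilon> (FObj L a)))"
      by (cases d) auto
    obtain x i where x: "x \<in> Obj D" and i: "i \<in> Hom C (FObj R x) a" "is_iso C i"
        "Comp C i (FArr R (\<epsilon> x)) = Comp C h (FArr R (FArr L i))"
      using es[OF ah] by blast
    have "(FObj ?K x, i, d) \<in> Hom ?EM (FObj ?K x) d"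
      using i ah functor_Obj[OF K x] by (simp add: d em_Hom)
    then show "\<exists>c\<in>Obj D. \<exists>i\<in>Hom ?EM (FObj ?K c) d. is_iso ?EM i"
      using x em_isoI[OF C T _ i(2)] unfolding d comparison_simps by blast
  qed
  then show ?thesis
    unfolding monadic_def using adj by blast
qed

section \<open>The pullback functor and its left adjoint\<close>

text \<open>The formal part of descent is done in any category having pullbacks along the single
  arrow \<open>p\<close>. Their existence is what gives the \<open>SOME\<close> in \<open>pb\<close>
  its meaning; everything about the chosen squares then comes from the universal property.\<close>

locale pullbacks_along =
  fixes C :: "('o, 'm) cat" and p :: 'm
  assumes category: "is_category C"
    and p_Arr: "p \<in> Arr C"
    and pullback_exists: "\<And>f. f \<in> Arr C \<Longrightarrow> Cod C f = Cod C p \<Longrightarrow> \<exists>q r. is_pullback C q r p f"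
begin

abbreviation comp (infixr "\<cdot>" 70) where "g \<cdot> f \<equiv> Comp C g f"

abbreviation "E \<equiv> Dom C p"
abbreviation "B \<equiv> Cod C p"
abbreviation "pr1 \<equiv> pb1 C p"
abbreviation "pr2 \<equiv> pb2 C p"
abbreviation "apex f \<equiv> Dom C (pb1 C p f)"

text \<open>The arrow into the chosen pullback with components \<open>u\<close> and
  \<open>v\<close>. The description operator has the same shape as the one in
  \<open>pullback_functor\<close>, so \<open>base_change\<close> below agrees with that functor on
  arrows by unfolding alone.\<close>

definition pair :: "'m \<Rightarrow> 'm \<Rightarrow> 'm \<Rightarrow> 'm" where
  "pair f u v = (THE k. k \<in> Hom C (Dom C u) (apex f) \<and> pr1 f \<cdot> k = u \<and> pr2 f \<cdot> k = v)"

lemmas Comp_Hom = Comp_Hom[OF category]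
  and Idt_Hom = Idt_Hom[OF category]
  and Comp_assoc = Comp_assoc[OF category]
  and Comp_Idt_left = Comp_Idt_left[OF category]
  and Comp_Idt_right = Comp_Idt_right[OF category]

lemma p_Hom: "p \<in> Hom C E B"
  using p_Arr by (rule Arr_Hom)

lemma chosen_pullback: "f \<in> Hom C a B \<Longrightarrow> is_pullback C (pr1 f) (pr2 f) p f"
  using pullback_exists[of f] someI_ex[of "\<lambda>(q, r). is_pullback C q r p f"]
  unfolding pb_def by (auto simp: Hom_def split: prod.splits)

lemma
  assumes "f \<in> Hom C a B"
  shows pr1_Hom: "pr1 f \<in> Hom C (apex f) E" and pr2_Hom: "pr2 f \<in> Hom C (apex f) a"
    and pr_commute: "p \<cdot> pr1 f = f \<cdot> pr2 f"
  using chosen_pullback[OF assms] assms unfolding is_pullback_def Hom_def by auto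

lemma pair_unique_exists:
  assumes "f \<in> Hom C a B" "u \<in> Hom C c E" "v \<in> Hom C c a" "p \<cdot> u = f \<cdot> v"
  shows "\<exists>!k. k \<in> Hom C c (apex f) \<and> pr1 f \<cdot> k = u \<and> pr2 f \<cdot> k = v"
  using pullback_unique_exists[OF chosen_pullback[OF assms(1)] assms(2)] assms(3,4) HomD[OF assms(1)]
  by simp

lemma
  assumes "f \<in> Hom C a B" "u \<in> Hom C c E" "v \<in> Hom C c a" "p \<cdot> u = f \<cdot> v"
  shows pair_Hom: "pair f u v \<in> Hom C c (apex f)"
    and pr1_pair: "pr1 f \<cdot> pair f u v = u"
    and pr2_pair: "pr2 f \<cdot> pair f u v = v"
  using theI'[OF pair_unique_exists[OF assms]] HomD[OF assms(2)] unfolding pair_def by auto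

lemma apex_eqI:
  assumes f: "f \<in> Hom C a B" and k: "k \<in> Hom C c (apex f)" and l: "l \<in> Hom C c (apex f)"
    and "pr1 f \<cdot> k = pr1 f \<cdot> l" "pr2 f \<cdot> k = pr2 f \<cdot> l"
  shows "k = l"
proof -
  have "p \<cdot> pr1 f \<cdot> k = f \<cdot> pr2 f \<cdot> k"
    using Comp_assoc[OF k pr1_Hom[OF f] p_Hom] Comp_assoc[OF k pr2_Hom[OF f] f] pr_commute[OF f] by simp
  from pair_unique_exists[OF f Comp_Hom[OF k pr1_Hom[OF f]] Comp_Hom[OF k pr2_Hom[OF f]] this]
  show ?thesis using assms by metis
qed

abbreviation "p_star \<equiv> pullback_functor C p"

lemma p_star_Obj: "FObj p_star f = pr1 f"
  by (simp add: pullback_functor_def)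

definition base_change :: "'m \<Rightarrow> 'm \<Rightarrow> 'm \<Rightarrow> 'm" where
  "base_change f h g = pair g (pr1 f) (h \<cdot> pr2 f)"

lemma p_star_Arr: "FArr p_star (f, h, g) = (pr1 f, base_change f h g, pr1 g)"
  by (simp add: pullback_functor_def base_change_def pair_def)

lemma
  assumes f: "f \<in> Hom C a B" and g: "g \<in> Hom C b B" and h: "h \<in> Hom C a b" and gh: "g \<cdot> h = f"
  shows base_change_Hom: "base_change f h g \<in> Hom C (apex f) (apex g)"
    and pr1_base_change: "pr1 g \<cdot> base_change f h g = pr1 f"
    and pr2_base_change: "pr2 g \<cdot> base_change f h g = h \<cdot> pr2 f"
proof -
  have "p \<cdot> pr1 f = g \<cdot> h \<cdot> pr2 f"
    using pr_commute[OF f] Comp_assoc[OF pr2_Hom[OF f] h g] gh by simp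
  note * = g pr1_Hom[OF f] Comp_Hom[OF pr2_Hom[OF f] h] this
  show "base_change f h g \<in> Hom C (apex f) (apex g)" "pr1 g \<cdot> base_change f h g = pr1 f"
    "pr2 g \<cdot> base_change f h g = h \<cdot> pr2 f"
    unfolding base_change_def by (rule pair_Hom[OF *] pr1_pair[OF *] pr2_pair[OF *])+
qed

lemma base_change_eqI:
  assumes "f \<in> Hom C a B" "g \<in> Hom C b B" "h \<in> Hom C a b" "g \<cdot> h = f"
    "k \<in> Hom C (apex f) (apex g)" "pr1 g \<cdot> k = pr1 f" "pr2 g \<cdot> k = h \<cdot> pr2 f"
  shows "k = base_change f h g"
  using apex_eqI[OF assms(2,5) base_change_Hom[OF assms(1-4)]] assms(6,7)
    pr1_base_change[OF assms(1-4)] pr2_base_change[OF assms(1-4)] by simp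

section \<open>Composition with \<open>p\<close> as left adjoint of pullback along
  \<open>p\<close>\<close>

definition p_shriek :: "('m, 'm \<times> 'm \<times> 'm, 'm, 'm \<times> 'm \<times> 'm) func" where
  "p_shriek = \<lparr>FObj = (\<lambda>f. p \<cdot> f), FArr = (\<lambda>(f, h, g). (p \<cdot> f, h, p \<cdot> g))\<rparr>"

lemma p_shriek_simps [simp]:
  "FObj p_shriek f = p \<cdot> f" "FArr p_shriek (f, h, g) = (p \<cdot> f, h, p \<cdot> g)"
  by (simp_all add: p_shriek_def)

text \<open>In elements \<open>a \<mapsto> (f a, a)\<close>, the graph of \<open>f\<close>, landing
  in the pullback of \<open>p \<cdot> f\<close> along \<open>p\<close>.\<close>

definition unit_map :: "'m \<Rightarrow> 'm" where
  "unit_map f = pair (p \<cdot> f) f (Idt C (Dom C f))"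

definition unit :: "'m \<Rightarrow> 'm \<times> 'm \<times> 'm" where
  "unit f = (f, unit_map f, pr1 (p \<cdot> f))"

definition counit :: "'m \<Rightarrow> 'm \<times> 'm \<times> 'm" where
  "counit x = (p \<cdot> pr1 x, pr2 x, x)"

lemma
  assumes f: "f \<in> Hom C a E"
  shows unit_map_Hom: "unit_map f \<in> Hom C a (apex (p \<cdot> f))"
    and pr1_unit_map: "pr1 (p \<cdot> f) \<cdot> unit_map f = f"
    and pr2_unit_map: "pr2 (p \<cdot> f) \<cdot> unit_map f = Idt C a"
proof -
  note pf = Comp_Hom[OF f p_Hom] and a = Hom_Obj(1)[OF category f]
  have *: "p \<cdot> f = (p \<cdot> f) \<cdot> Idt C a"
    using Comp_Idt_right[OF pf] by simp
  note ** = pair_Hom[OF pf f Idt_Hom[OF a] *] pr1_pair[OF pf f Idt_Hom[OF a] *]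
    pr2_pair[OF pf f Idt_Hom[OF a] *]
  show "unit_map f \<in> Hom C a (apex (p \<cdot> f))" "pr1 (p \<cdot> f) \<cdot> unit_map f = f"
    "pr2 (p \<cdot> f) \<cdot> unit_map f = Idt C a"
    using ** HomD[OF f] by (simp_all add: unit_map_def)
qed

lemma slice_ObjD: "f \<in> Obj (slice_cat C b) \<Longrightarrow> f \<in> Hom C (Dom C f) b"
  by (simp add: Hom_def)

lemma p_shriek_functor: "is_functor (slice_cat C E) (slice_cat C B) p_shriek"
  unfolding is_functor_def
proof (intro conjI ballI impI)
  fix f assume f: "f \<in> Obj (slice_cat C E)"
  note pf = Comp_Hom[OF slice_ObjD[OF f] p_Hom]
  show "FObj p_shriek f \<in> Obj (slice_cat C B)"
    "FArr p_shriek (Idt (slice_cat C E) f) = Idt (slice_cat C B) (FObj p_shriek f)"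
    using HomD[OF pf] by simp_all
next
  fix \<phi> assume "\<phi> \<in> Arr (slice_cat C E)"
  then obtain f h g where \<phi>: "\<phi> = (f, h, g)" "f \<in> Hom C (Dom C f) E" "g \<in> Hom C (Dom C g) E"
    "h \<in> Hom C (Dom C f) (Dom C g)" "g \<cdot> h = f"
    by (rule slice_ArrE)
  show "FArr p_shriek \<phi> \<in> Hom (slice_cat C B) (FObj p_shriek (Dom (slice_cat C E) \<phi>))
      (FObj p_shriek (Cod (slice_cat C E) \<phi>))"
    using Comp_Hom[OF \<phi>(2) p_Hom] Comp_Hom[OF \<phi>(3) p_Hom] Comp_assoc[OF \<phi>(4,3) p_Hom] \<phi>
      HomD(2)[OF Comp_Hom[OF \<phi>(2) p_Hom]] HomD(2)[OF Comp_Hom[OF \<phi>(3) p_Hom]]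
    by (auto simp: slice_Hom)
  fix \<psi> assume "\<psi> \<in> Arr (slice_cat C E)" "Cod (slice_cat C E) \<phi> = Dom (slice_cat C E) \<psi>"
  then show "FArr p_shriek (Comp (slice_cat C E) \<psi> \<phi>) =
      Comp (slice_cat C B) (FArr p_shriek \<psi>) (FArr p_shriek \<phi>)"
    by (elim slice_ArrE) (simp add: \<phi>(1))
qed

lemma p_star_functor: "is_functor (slice_cat C B) (slice_cat C E) p_star"
  unfolding is_functor_def
proof (intro conjI ballI impI)
  fix f assume "f \<in> Obj (slice_cat C B)"
  note f = slice_ObjD[OF this]
  note pf = pr1_Hom[OF f] pr2_Hom[OF f]
  show "FObj p_star f \<in> Obj (slice_cat C E)"
    using HomD[OF pf(1)] by (simp add: p_star_Obj)
  have "Idt C (apex f) = base_change f (Idt C (Dom C f)) f"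
    by (rule base_change_eqI[OF f f Idt_Hom[OF Hom_Obj(1)[OF category f]] Comp_Idt_right[OF f]
          Idt_Hom[OF Hom_Obj(1)[OF category pf(1)]] Comp_Idt_right[OF pf(1)]])
      (simp add: Comp_Idt_right[OF pf(2)] Comp_Idt_left[OF pf(2)])
  then show "FArr p_star (Idt (slice_cat C B) f) = Idt (slice_cat C E) (FObj p_star f)"
    by (simp add: p_star_Obj p_star_Arr)
next
  fix \<phi> assume "\<phi> \<in> Arr (slice_cat C B)"
  then obtain f h g where \<phi>: "\<phi> = (f, h, g)" "f \<in> Hom C (Dom C f) B" "g \<in> Hom C (Dom C g) B"
    "h \<in> Hom C (Dom C f) (Dom C g)" "g \<cdot> h = f"
    by (rule slice_ArrE)
  note bc = base_change_Hom[OF \<phi>(2-5)] pr1_base_change[OF \<phi>(2-5)] pr2_base_change[OF \<phi>(2-5)]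
  show "FArr p_star \<phi> \<in> Hom (slice_cat C E) (FObj p_star (Dom (slice_cat C B) \<phi>))
      (FObj p_star (Cod (slice_cat C B) \<phi>))"
    using pr1_Hom[OF \<phi>(2)] pr1_Hom[OF \<phi>(3)] bc
    by (simp add: \<phi>(1) p_star_Obj p_star_Arr slice_Hom)
  fix \<psi> assume "\<psi> \<in> Arr (slice_cat C B)" "Cod (slice_cat C B) \<phi> = Dom (slice_cat C B) \<psi>"
  then obtain h' k where \<psi>: "\<psi> = (g, h', k)" "k \<in> Hom C (Dom C k) B"
    "h' \<in> Hom C (Dom C g) (Dom C k)" "k \<cdot> h' = g"
    by (metis slice_ArrE slice_simps(2,3) \<phi>(1))
  note bc' = base_change_Hom[OF \<phi>(3) \<psi>(2-4)] pr1_base_change[OF \<phi>(3) \<psi>(2-4)]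
    pr2_base_change[OF \<phi>(3) \<psi>(2-4)]
  have "base_change g h' k \<cdot> base_change f h g = base_change f (h' \<cdot> h) k"
  proof (rule base_change_eqI[OF \<phi>(2) \<psi>(2) Comp_Hom[OF \<phi>(4) \<psi>(3)] _ Comp_Hom[OF bc(1) bc'(1)]])
    show "k \<cdot> h' \<cdot> h = f"
      using Comp_assoc[OF \<phi>(4) \<psi>(3,2)] \<phi>(5) \<psi>(4) by simp
    show "pr1 k \<cdot> base_change g h' k \<cdot> base_change f h g = pr1 f"
      using Comp_assoc[OF bc(1) bc'(1) pr1_Hom[OF \<psi>(2)]] bc(2) bc'(2) by simp
    show "pr2 k \<cdot> base_change g h' k \<cdot> base_change f h g = (h' \<cdot> h) \<cdot> pr2 f"
      using Comp_assoc[OF bc(1) bc'(1) pr2_Hom[OF \<psi>(2)]] bc(3) bc'(3)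
        Comp_assoc[OF bc(1) pr2_Hom[OF \<phi>(3)] \<psi>(3)] Comp_assoc[OF pr2_Hom[OF \<phi>(2)] \<phi>(4) \<psi>(3)]
      by simp
  qed
  then show "FArr p_star (Comp (slice_cat C B) \<psi> \<phi>) =
      Comp (slice_cat C E) (FArr p_star \<psi>) (FArr p_star \<phi>)"
    by (simp add: \<phi>(1) \<psi>(1) p_star_Arr)
qed

lemma unit_nat_trans:
  "nat_trans (slice_cat C E) (slice_cat C E) id_func (comp_func p_star p_shriek) unit"
  unfolding nat_trans_def
proof (intro conjI ballI)
  fix f assume "f \<in> Obj (slice_cat C E)"
  note f = slice_ObjD[OF this]
  show "unit f \<in> Hom (slice_cat C E) (FObj id_func f) (FObj (comp_func p_star p_shriek) f)"
    using f pr1_Hom[OF Comp_Hom[OF f p_Hom]] unit_map_Hom[OF f] pr1_unit_map[OF f]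
    by (simp add: unit_def p_star_Obj slice_Hom)
next
  fix \<phi> assume "\<phi> \<in> Arr (slice_cat C E)"
  then obtain f h g where \<phi>: "\<phi> = (f, h, g)" "f \<in> Hom C (Dom C f) E" "g \<in> Hom C (Dom C g) E"
    "h \<in> Hom C (Dom C f) (Dom C g)" "g \<cdot> h = f"
    by (rule slice_ArrE)
  note pf = Comp_Hom[OF \<phi>(2) p_Hom] and pg = Comp_Hom[OF \<phi>(3) p_Hom]
  have "(p \<cdot> g) \<cdot> h = p \<cdot> f"
    using Comp_assoc[OF \<phi>(4,3) p_Hom] \<phi>(5) by simp
  note bc = base_change_Hom[OF pf pg \<phi>(4) this] pr1_base_change[OF pf pg \<phi>(4) this]
    pr2_base_change[OF pf pg \<phi>(4) this]
  note uf = unit_map_Hom[OF \<phi>(2)] pr1_unit_map[OF \<phi>(2)] pr2_unit_map[OF \<phi>(2)]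
  note ug = unit_map_Hom[OF \<phi>(3)] pr1_unit_map[OF \<phi>(3)] pr2_unit_map[OF \<phi>(3)]
  have "unit_map g \<cdot> h = base_change (p \<cdot> f) h (p \<cdot> g) \<cdot> unit_map f"
  proof (rule apex_eqI[OF pg Comp_Hom[OF \<phi>(4) ug(1)] Comp_Hom[OF uf(1) bc(1)]])
    show "pr1 (p \<cdot> g) \<cdot> unit_map g \<cdot> h =
        pr1 (p \<cdot> g) \<cdot> base_change (p \<cdot> f) h (p \<cdot> g) \<cdot> unit_map f"
      using Comp_assoc[OF \<phi>(4) ug(1) pr1_Hom[OF pg]] Comp_assoc[OF uf(1) bc(1) pr1_Hom[OF pg]]
        bc uf ug \<phi>(5) by simp
    show "pr2 (p \<cdot> g) \<cdot> unit_map g \<cdot> h =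
        pr2 (p \<cdot> g) \<cdot> base_change (p \<cdot> f) h (p \<cdot> g) \<cdot> unit_map f"
      using Comp_assoc[OF \<phi>(4) ug(1) pr2_Hom[OF pg]] Comp_assoc[OF uf(1) bc(1) pr2_Hom[OF pg]]
        Comp_assoc[OF uf(1) pr2_Hom[OF pf] \<phi>(4)]
        bc(3) uf(3) ug(3) Comp_Idt_left[OF \<phi>(4)] Comp_Idt_right[OF \<phi>(4)] by simp
  qed
  then show "Comp (slice_cat C E) (unit (Cod (slice_cat C E) \<phi>)) (FArr id_func \<phi>) =
      Comp (slice_cat C E) (FArr (comp_func p_star p_shriek) \<phi>) (unit (Dom (slice_cat C E) \<phi>))"
    by (simp add: \<phi>(1) unit_def p_star_Arr)
qed

lemma counit_nat_trans:
  "nat_trans (slice_cat C B) (slice_cat C B) (comp_func p_shriek p_star) id_func counit"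
  unfolding nat_trans_def
proof (intro conjI ballI)
  fix f assume "f \<in> Obj (slice_cat C B)"
  note f = slice_ObjD[OF this]
  note pf = Comp_Hom[OF pr1_Hom[OF f] p_Hom]
  show "counit f \<in> Hom (slice_cat C B) (FObj (comp_func p_shriek p_star) f) (FObj id_func f)"
    using f pf HomD[OF pf] pr2_Hom[OF f] pr_commute[OF f]
    by (simp add: counit_def p_star_Obj slice_Hom)
next
  fix \<phi> assume "\<phi> \<in> Arr (slice_cat C B)"
  then obtain f h g where \<phi>: "\<phi> = (f, h, g)" "f \<in> Hom C (Dom C f) B" "g \<in> Hom C (Dom C g) B"
    "h \<in> Hom C (Dom C f) (Dom C g)" "g \<cdot> h = f"
    by (rule slice_ArrE)
  then show "Comp (slice_cat C B) (counit (Cod (slice_cat C B) \<phi>)) (FArr (comp_func p_shriek p_star) \<phi>) =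
      Comp (slice_cat C B) (FArr id_func \<phi>) (counit (Dom (slice_cat C B) \<phi>))"
    using pr2_base_change[OF \<phi>(2-5)] by (simp add: counit_def p_star_Arr)
qed

text \<open>The pullback functor applied to the counit at \<open>x\<close>, hence the structure map
  of the algebra that the comparison functor assigns to \<open>x\<close>. In elements
  \<open>(e, (e', a)) \<mapsto> (e, a)\<close>.\<close>

definition act :: "'m \<Rightarrow> 'm" where
  "act x = base_change (p \<cdot> pr1 x) (pr2 x) x"

lemma
  assumes x: "x \<in> Hom C a B"
  shows act_Hom: "act x \<in> Hom C (apex (p \<cdot> pr1 x)) (apex x)"
    and pr1_act: "pr1 x \<cdot> act x = pr1 (p \<cdot> pr1 x)"
    and pr2_act: "pr2 x \<cdot> act x = pr2 x \<cdot> pr2 (p \<cdot> pr1 x)"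
  unfolding act_def using Comp_Hom[OF pr1_Hom[OF x] p_Hom] x pr2_Hom[OF x] pr_commute[OF x]
  by (auto intro: base_change_Hom pr1_base_change pr2_base_change)

lemma p_star_counit: "FArr p_star (counit x) = (pr1 (p \<cdot> pr1 x), act x, pr1 x)"
  by (simp add: counit_def p_star_Arr act_def)

lemma adjunction:
  "is_adjunction (slice_cat C E) (slice_cat C B) p_shriek p_star unit counit"
  unfolding is_adjunction_def
proof (intro conjI ballI)
  fix f assume "f \<in> Obj (slice_cat C E)"
  note f = slice_ObjD[OF this]
  show "Comp (slice_cat C B) (counit (FObj p_shriek f)) (FArr p_shriek (unit f)) =
      Idt (slice_cat C B) (FObj p_shriek f)"
    using pr2_unit_map[OF f] HomD[OF Comp_Hom[OF f p_Hom]] by (simp add: counit_def unit_def)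
next
  fix x assume "x \<in> Obj (slice_cat C B)"
  note x = slice_ObjD[OF this]
  note px = pr1_Hom[OF x] pr2_Hom[OF x]
  note apx = Idt_Hom[OF Hom_Obj(1)[OF category px(1)]]
  note u = unit_map_Hom[OF px(1)] pr1_unit_map[OF px(1)] pr2_unit_map[OF px(1)]
  note ppx = Comp_Hom[OF px(1) p_Hom]
  \<comment> \<open>In elements this triangle identity reads
    \<open>(e, a) \<mapsto> (e, (e, a)) \<mapsto> (e, a)\<close>.\<close>
  have "act x \<cdot> unit_map (pr1 x) = Idt C (apex x)"
  proof (rule apex_eqI[OF x Comp_Hom[OF u(1) act_Hom[OF x]] apx])
    show "pr1 x \<cdot> act x \<cdot> unit_map (pr1 x) = pr1 x \<cdot> Idt C (apex x)"
      using Comp_assoc[OF u(1) act_Hom[OF x] px(1)] pr1_act[OF x] u(2) Comp_Idt_right[OF px(1)]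
      by simp
    show "pr2 x \<cdot> act x \<cdot> unit_map (pr1 x) = pr2 x \<cdot> Idt C (apex x)"
      using Comp_assoc[OF u(1) act_Hom[OF x] px(2)] pr2_act[OF x] u(3)
        Comp_assoc[OF u(1) pr2_Hom[OF ppx] px(2)] by simp
  qed
  then show "Comp (slice_cat C E) (FArr p_star (counit x)) (unit (FObj p_star x)) =
      Idt (slice_cat C E) (FObj p_star x)"
    by (simp add: p_star_counit unit_def p_star_Obj)
qed (rule p_shriek_functor p_star_functor unit_nat_trans counit_nat_trans)+

text \<open>The monadicity criterion with slice objects and slice arrows replaced by bare arrows of
  \<open>C\<close>. In \<open>ff\<close>, an arrow \<open>k\<close> over \<open>E\<close> commuting
  with the canonical actions descends uniquely; in \<open>es\<close>, every unital and associative
  action \<open>h\<close> on \<open>f\<close> is isomorphic to a canonical one.\<close>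

lemma effective_descentI:
  assumes ff: "\<And>x y k a b. x \<in> Hom C a B \<Longrightarrow> y \<in> Hom C b B \<Longrightarrow> k \<in> Hom C (apex x) (apex y) \<Longrightarrow>
      pr1 y \<cdot> k = pr1 x \<Longrightarrow> k \<cdot> act x = act y \<cdot> base_change (p \<cdot> pr1 x) k (p \<cdot> pr1 y) \<Longrightarrow>
      \<exists>!w. w \<in> Hom C a b \<and> y \<cdot> w = x \<and> pr2 y \<cdot> k = w \<cdot> pr2 x"
    and es: "\<And>a f h. f \<in> Hom C a E \<Longrightarrow> h \<in> Hom C (apex (p \<cdot> f)) a \<Longrightarrow> f \<cdot> h = pr1 (p \<cdot> f) \<Longrightarrow>
      h \<cdot> unit_map f = Idt C a \<Longrightarrow>
      h \<cdot> base_change (p \<cdot> pr1 (p \<cdot> f)) h (p \<cdot> f) = h \<cdot> act (p \<cdot> f) \<Longrightarrow>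
      \<exists>x\<in>Arr C. Cod C x = B \<and> (\<exists>i\<in>Hom C (apex x) a. is_iso C i \<and> f \<cdot> i = pr1 x \<and>
        i \<cdot> act x = h \<cdot> base_change (p \<cdot> pr1 x) i (p \<cdot> f))"
  shows "effective_descent C p"
  unfolding effective_descent_def
proof (intro conjI p_Arr monadicI[OF slice_category[OF category] slice_category[OF category] adjunction])
  fix x y \<phi> assume "x \<in> Obj (slice_cat C B)" "y \<in> Obj (slice_cat C B)"
    and \<phi>: "\<phi> \<in> Hom (slice_cat C E) (FObj p_star x) (FObj p_star y)"
    and eq: "Comp (slice_cat C E) \<phi> (FArr p_star (counit x)) =
      Comp (slice_cat C E) (FArr p_star (counit y)) (FArr p_star (FArr p_shriek \<phi>))"
  note x = slice_ObjD[OF this(1)] and y = slice_ObjD[OF this(2)]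
  from \<phi> obtain k where k: "\<phi> = (pr1 x, k, pr1 y)" "k \<in> Hom C (apex x) (apex y)" "pr1 y \<cdot> k = pr1 x"
    by (auto simp: p_star_Obj slice_Hom)
  have "k \<cdot> act x = act y \<cdot> base_change (p \<cdot> pr1 x) k (p \<cdot> pr1 y)"
    using eq by (simp add: k(1) p_star_counit p_star_Arr)
  then obtain w where w: "w \<in> Hom C (Dom C x) (Dom C y)" "y \<cdot> w = x" "pr2 y \<cdot> k = w \<cdot> pr2 x"
    and uniq: "\<And>v. v \<in> Hom C (Dom C x) (Dom C y) \<Longrightarrow> y \<cdot> v = x \<Longrightarrow> pr2 y \<cdot> k = v \<cdot> pr2 x \<Longrightarrow> v = w"
    using ff[OF x y k(2,3)] by blast
  show "\<exists>!\<psi>. \<psi> \<in> Hom (slice_cat C B) x y \<and> FArr p_star \<psi> = \<phi>"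
  proof (intro ex1I conjI)
    show "(x, w, y) \<in> Hom (slice_cat C B) x y"
      using x y w by (simp add: slice_Hom)
    show "FArr p_star (x, w, y) = \<phi>"
      using base_change_eqI[OF x y w(1,2) k(2,3) w(3)] by (simp add: k(1) p_star_Arr)
  next
    fix \<psi> assume \<psi>: "\<psi> \<in> Hom (slice_cat C B) x y \<and> FArr p_star \<psi> = \<phi>"
    then obtain v where v: "\<psi> = (x, v, y)" "v \<in> Hom C (Dom C x) (Dom C y)" "y \<cdot> v = x"
      by (auto simp: slice_Hom)
    with \<psi> have "k = base_change x v y"
      by (simp add: p_star_Arr k(1))
    then show "\<psi> = (x, w, y)"
      using uniq[OF v(2,3)] pr2_base_change[OF x y v(2,3)] by (simp add: v(1))
  qed
next
  fix f \<theta> assume alg: "(f, \<theta>) \<in> em_algebras (slice_cat C E) (comp_func p_star p_shriek) unit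
      (\<lambda>a. FArr p_star (counit (FObj p_shriek a)))"
  then have "f \<in> Obj (slice_cat C E)"
    by (auto simp: em_algebras_def)
  note f = slice_ObjD[OF this]
  from alg obtain h where h: "\<theta> = (pr1 (p \<cdot> f), h, f)" "h \<in> Hom C (apex (p \<cdot> f)) (Dom C f)"
    "f \<cdot> h = pr1 (p \<cdot> f)"
    by (auto simp: em_algebras_def slice_Hom p_star_Obj)
  have "h \<cdot> unit_map f = Idt C (Dom C f)"
    "h \<cdot> base_change (p \<cdot> pr1 (p \<cdot> f)) h (p \<cdot> f) = h \<cdot> act (p \<cdot> f)"
    using alg by (simp_all add: em_algebras_def h(1) unit_def p_star_Arr p_star_counit)
  from es[OF f h(2,3) this] obtain x i where x: "x \<in> Arr C" "Cod C x = B"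
    and i: "i \<in> Hom C (apex x) (Dom C f)" "is_iso C i" "f \<cdot> i = pr1 x"
      "i \<cdot> act x = h \<cdot> base_change (p \<cdot> pr1 x) i (p \<cdot> f)"
    by blast
  have x': "x \<in> Hom C (Dom C x) B"
    using x by (simp add: Hom_def)
  have "(pr1 x, i, f) \<in> Hom (slice_cat C E) (FObj p_star x) f"
    using pr1_Hom[OF x'] f i by (simp add: slice_Hom p_star_Obj)
  moreover from this have "is_iso (slice_cat C E) (pr1 x, i, f)"
    using slice_iso[of "pr1 x" i f C E, OF _ category] i(2) by (simp add: p_star_Obj)
  moreover have "Comp (slice_cat C E) (pr1 x, i, f) (FArr p_star (counit x)) =
      Comp (slice_cat C E) \<theta> (FArr p_star (FArr p_shriek (pr1 x, i, f)))"
    using i(4) by (simp add: h(1) p_star_counit p_star_Arr)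
  ultimately show "\<exists>x\<in>Obj (slice_cat C B). \<exists>i\<in>Hom (slice_cat C E) (FObj p_star x) f.
      is_iso (slice_cat C E) i \<and> Comp (slice_cat C E) i (FArr p_star (counit x)) =
        Comp (slice_cat C E) \<theta> (FArr p_star (FArr p_shriek i))"
    using x by (intro bexI[of _ x] bexI[of _ "(pr1 x, i, f)"] conjI) simp_all
qed

lemma effective_descent_reflects_iso:
  assumes p: "effective_descent C p"
    and f: "f \<in> Hom C a B" and g: "g \<in> Hom C b B" and h: "h \<in> Hom C a b" and gh: "g \<cdot> h = f"
    and iso: "is_iso C (base_change f h g)"
  shows "is_iso C h"
proof -
  have fhg: "(f, h, g) \<in> Hom (slice_cat C B) f g"
    using f g h gh HomD[OF f] HomD[OF g] by (simp add: slice_Hom)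
  have "(pr1 f, base_change f h g, pr1 g) \<in> Hom (slice_cat C E) (pr1 f) (pr1 g)"
    using functor_Hom[OF p_star_functor fhg] by (simp add: p_star_Obj p_star_Arr)
  from slice_iso[OF this category] have "is_iso (slice_cat C E) (FArr p_star (f, h, g))"
    using iso by (simp add: p_star_Arr)
  moreover have "monadic (slice_cat C B) (slice_cat C E) p_star"
    using p by (simp add: effective_descent_def)
  ultimately have "is_iso (slice_cat C B) (f, h, g)"
    using monadic_reflects_iso[OF slice_category[OF category] slice_category[OF category] _ fhg]
    by blast
  then show ?thesis
    using slice_iso[OF fhg category] by simp
qed

end

section \<open>Preordered sets\<close>

abbreviation app :: "'u mor \<Rightarrow> 'u \<Rightarrow> 'u" where
  "app f \<equiv> fst (snd f)"

text \<open>\<open>PreOrd\<close> and \<open>ParOrd\<close> are both full subcategories of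
  preordered sets on a class of objects, so arrows, composites and isomorphisms are analysed once
  for both.\<close>

locale preord_category =
  fixes C :: "('u preord, 'u mor) cat"
  assumes full: "C = preord_subcat (Obj C)"
    and preorder: "\<And>X. X \<in> Obj C \<Longrightarrow> preorder_on (fst X) (snd X)"
begin

lemma ord_carrier: "X \<in> Obj C \<Longrightarrow> (x, y) \<in> snd X \<Longrightarrow> x \<in> fst X \<and> y \<in> fst X"
  and ord_refl: "X \<in> Obj C \<Longrightarrow> x \<in> fst X \<Longrightarrow> (x, x) \<in> snd X"
  and ord_trans: "X \<in> Obj C \<Longrightarrow> (x, y) \<in> snd X \<Longrightarrow> (y, z) \<in> snd X \<Longrightarrow> (x, z) \<in> snd X"
  using preorder[of X] unfolding preorder_on_def by (auto simp: refl_on_def dest: transD)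

lemma C_simps:
  "Dom C f = fst f" "Cod C f = snd (snd f)" "Idt C X = (X, restrict (\<lambda>a. a) (fst X), X)"
  "Comp C g f = (fst f, compose (fst (fst f)) (app g) (app f), snd (snd g))"
  by (subst full, simp add: preord_subcat_def split_def)+

lemma Arr_iff: "f \<in> Arr C \<longleftrightarrow>
    fst f \<in> Obj C \<and> snd (snd f) \<in> Obj C \<and> app f \<in> monotone_maps (fst f) (snd (snd f))"
  by (subst (1) full) (auto simp: preord_subcat_def split_def)

lemma Hom_iff: "f \<in> Hom C X Y \<longleftrightarrow>
    X \<in> Obj C \<and> Y \<in> Obj C \<and> fst f = X \<and> snd (snd f) = Y \<and> app f \<in> monotone_maps X Y"
  by (auto simp: Hom_def Arr_iff C_simps)

lemma
  assumes "f \<in> Hom C X Y"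
  shows app_in: "x \<in> fst X \<Longrightarrow> app f x \<in> fst Y"
    and app_mono: "(x, x') \<in> snd X \<Longrightarrow> (app f x, app f x') \<in> snd Y"
  using assms by (auto simp: Hom_iff monotone_maps_def)

lemma Hom_eqI:
  assumes f: "f \<in> Hom C X Y" and g: "g \<in> Hom C X Y" and eq: "\<And>x. x \<in> fst X \<Longrightarrow> app f x = app g x"
  shows "f = g"
proof -
  have "app f \<in> extensional (fst X)" "app g \<in> extensional (fst X)"
    using f g by (auto simp: Hom_iff monotone_maps_def PiE_def)
  then have "app f = app g"
    using eq by (rule extensionalityI)
  then show ?thesis
    using f g by (metis Hom_iff prod.collapse)
qed

lemma app_Comp: "f \<in> Hom C X Y \<Longrightarrow> x \<in> fst X \<Longrightarrow> app (Comp C g f) x = app g (app f x)"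
  by (auto simp: C_simps Hom_iff compose_def)

lemma app_Idt: "x \<in> fst X \<Longrightarrow> app (Idt C X) x = x"
  by (simp add: C_simps)

lemma mor_Hom:
  assumes "X \<in> Obj C" "Y \<in> Obj C" "\<And>x. x \<in> fst X \<Longrightarrow> h x \<in> fst Y"
    and "\<And>x x'. (x, x') \<in> snd X \<Longrightarrow> (h x, h x') \<in> snd Y"
  shows "(X, restrict h (fst X), Y) \<in> Hom C X Y"
  using assms ord_carrier[OF assms(1)] by (auto simp: Hom_iff monotone_maps_def)

lemma category: "is_category C"
proof (rule is_categoryI, goal_cases)
  case (1 f X Y)
  then show ?case by (simp add: Hom_iff)
next
  case (2 X)
  then show ?case unfolding C_simps by (intro mor_Hom) auto
next
  case (3 f g X Y Z)
  then show ?case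
    using app_in[OF 3(1)] app_in[OF 3(2)] app_mono[OF 3(1)] app_mono[OF 3(2)]
    unfolding C_simps compose_def by (auto simp: Hom_iff[of f] Hom_iff[of g] intro!: mor_Hom)
next
  case (4 f X Y)
  have "app f \<in> fst X \<rightarrow>\<^sub>E fst Y" "fst f = X" "snd (snd f) = Y"
    using 4 by (auto simp: Hom_iff monotone_maps_def)
  moreover from this(1) have "compose (fst X) (app f) (\<lambda>a\<in>fst X. a) = app f"
    "compose (fst X) (\<lambda>a\<in>fst Y. a) (app f) = app f"
    by (auto intro!: extensionalityI[of _ "fst X"] simp: compose_def PiE_def)
  ultimately show ?case
    unfolding C_simps by (metis fst_conv snd_conv prod.collapse)
next
  case (5 f g h X Y Z W)
  then show ?case
    using app_in[OF 5(1)] by (auto simp: C_simps Hom_iff compose_def fun_eq_iff)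
qed

lemma Comp_eq_iff:
  assumes "f \<in> Hom C X Y" "g \<in> Hom C Y Z" "f' \<in> Hom C X Y'" "g' \<in> Hom C Y' Z"
  shows "Comp C g f = Comp C g' f' \<longleftrightarrow> (\<forall>x\<in>fst X. app g (app f x) = app g' (app f' x))"
proof
  assume "\<forall>x\<in>fst X. app g (app f x) = app g' (app f' x)"
  then show "Comp C g f = Comp C g' f'"
    by (intro Hom_eqI[OF Comp_Hom[OF category assms(1,2)] Comp_Hom[OF category assms(3,4)]])
      (simp add: app_Comp[OF assms(1)] app_Comp[OF assms(3)])
next
  assume eq: "Comp C g f = Comp C g' f'"
  show "\<forall>x\<in>fst X. app g (app f x) = app g' (app f' x)"
    using app_Comp[OF assms(1), of _ g] app_Comp[OF assms(3), of _ g'] eq by metis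
qed

text \<open>In a preorder, reflecting the order does not imply injectivity, so both are listed. The
  inverse map is monotone precisely because the order is reflected.\<close>

lemma is_iso_iff:
  assumes f: "f \<in> Hom C X Y"
  shows "is_iso C f \<longleftrightarrow> app f ` fst X = fst Y \<and>
    (\<forall>x\<in>fst X. \<forall>x'\<in>fst X. (app f x, app f x') \<in> snd Y \<longrightarrow> (x, x') \<in> snd X) \<and> inj_on (app f) (fst X)"
proof
  have X: "X \<in> Obj C" and Y: "Y \<in> Obj C"
    using f by (auto simp: Hom_iff)
  {
    assume "is_iso C f"
    then obtain g where g: "g \<in> Hom C Y X" "Comp C g f = Idt C X" "Comp C f g = Idt C Y"
      using f by (rule is_isoE)
    have gf: "app g (app f x) = x" if "x \<in> fst X" for x
      using app_Comp[OF f that, of g] app_Idt[OF that] g by simp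
    have fg: "app f (app g y) = y" if "y \<in> fst Y" for y
      using app_Comp[OF g(1) that, of f] app_Idt[OF that] g by simp
    show "app f ` fst X = fst Y \<and>
      (\<forall>x\<in>fst X. \<forall>x'\<in>fst X. (app f x, app f x') \<in> snd Y \<longrightarrow> (x, x') \<in> snd X) \<and> inj_on (app f) (fst X)"
    proof (intro conjI ballI impI)
      show "app f ` fst X = fst Y"
        using app_in[OF f] app_in[OF g(1)] fg by (auto simp: image_iff) metis
      show "inj_on (app f) (fst X)"
        using gf by (rule inj_on_inverseI)
    qed (use app_mono[OF g(1)] gf in metis)
  next
    assume *: "app f ` fst X = fst Y \<and>
      (\<forall>x\<in>fst X. \<forall>x'\<in>fst X. (app f x, app f x') \<in> snd Y \<longrightarrow> (x, x') \<in> snd X) \<and> inj_on (app f) (fst X)"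
    let ?g = "inv_into (fst X) (app f)"
    have g: "(Y, restrict ?g (fst Y), X) \<in> Hom C Y X"
    proof (rule mor_Hom[OF Y X])
      fix y y' assume yy': "(y, y') \<in> snd Y"
      then have "y \<in> app f ` fst X" "y' \<in> app f ` fst X"
        using * ord_carrier[OF Y] by auto
      then show "(?g y, ?g y') \<in> snd X"
        using * yy' by (simp add: f_inv_into_f inv_into_into)
    qed (use * in \<open>auto intro: inv_into_into\<close>)
    show "is_iso C f"
    proof (rule is_isoI[OF f g]; rule Hom_eqI)
      show "Comp C (Y, restrict ?g (fst Y), X) f \<in> Hom C X X" "Comp C f (Y, restrict ?g (fst Y), X) \<in> Hom C Y Y"
        "Idt C X \<in> Hom C X X" "Idt C Y \<in> Hom C Y Y"
        using Comp_Hom[OF category] Idt_Hom[OF category] f g X Y by blast+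
    qed (use * app_in[OF f] in \<open>auto simp: app_Comp[OF f] app_Comp[OF g] app_Idt f_inv_into_f\<close>)
  }
qed

text \<open>The projections are arrows, hence monotone, so the last clause, which gives the other
  inclusion, makes the order of the apex the one induced by both projections together.\<close>

definition ptwise_pullback :: "'u mor \<Rightarrow> 'u mor \<Rightarrow> 'u mor \<Rightarrow> 'u mor \<Rightarrow> bool" where
  "ptwise_pullback q r f g \<longleftrightarrow>
     (\<forall>w\<in>fst (Dom C q). app f (app q w) = app g (app r w)) \<and>
     (\<forall>x\<in>fst (Dom C f). \<forall>y\<in>fst (Dom C g). app f x = app g y \<longrightarrow>
        (\<exists>!w. w \<in> fst (Dom C q) \<and> app q w = x \<and> app r w = y)) \<and>
     (\<forall>w\<in>fst (Dom C q). \<forall>w'\<in>fst (Dom C q).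
        (app q w, app q w') \<in> snd (Dom C f) \<longrightarrow> (app r w, app r w') \<in> snd (Dom C g) \<longrightarrow>
        (w, w') \<in> snd (Dom C q))"

text \<open>The mediating map sends \<open>t\<close> to the unique element over
  \<open>app u t\<close> and \<open>app v t\<close>; the order clause for the apex is what makes it
  monotone.\<close>

lemma ptwise_is_pullback:
  assumes q: "q \<in> Hom C W X" and r: "r \<in> Hom C W Y" and f: "f \<in> Hom C X Z" and g: "g \<in> Hom C Y Z"
    and pt: "ptwise_pullback q r f g"
  shows "is_pullback C q r f g"
proof -
  note D = HomD[OF q] HomD[OF r] HomD[OF f] HomD[OF g]
  note pt = pt[unfolded ptwise_pullback_def D]
  show ?thesis
    unfolding is_pullback_def D
  proof (intro conjI ballI impI D refl)
    show "Comp C f q = Comp C g r"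
      using pt by (subst Comp_eq_iff[OF q f r g]) auto
    fix u v assume uv: "u \<in> Arr C" "v \<in> Arr C"
      "Dom C u = Dom C v \<and> Cod C u = X \<and> Cod C v = Y \<and> Comp C f u = Comp C g v"
    define T where "T = Dom C u"
    have u: "u \<in> Hom C T X" and v: "v \<in> Hom C T Y"
      using uv by (auto simp: Hom_def T_def)
    have eq: "\<forall>t\<in>fst T. app f (app u t) = app g (app v t)"
      using uv Comp_eq_iff[OF u f v g] by simp
    define h where "h t = (THE w. w \<in> fst W \<and> app q w = app u t \<and> app r w = app v t)" for t
    have h: "h t \<in> fst W \<and> app q (h t) = app u t \<and> app r (h t) = app v t" if "t \<in> fst T" for t
      unfolding h_def by (rule theI') (use pt eq that app_in[OF u] app_in[OF v] in blast)
    have T: "T \<in> Obj C" and W: "W \<in> Obj C"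
      using u q by (auto simp: Hom_iff)
    have k: "(T, restrict h (fst T), W) \<in> Hom C T W"
    proof (rule mor_Hom[OF T W])
      fix t t' assume t: "(t, t') \<in> snd T"
      then have "t \<in> fst T" "t' \<in> fst T"
        using ord_carrier[OF T] by auto
      then show "(h t, h t') \<in> snd W"
        using pt h app_mono[OF u t] app_mono[OF v t] by metis
    qed (use h in blast)
    show "\<exists>!k. k \<in> Hom C (Dom C u) W \<and> Comp C q k = u \<and> Comp C r k = v"
      unfolding T_def[symmetric]
    proof (intro ex1I conjI)
      show "Comp C q (T, restrict h (fst T), W) = u"
        by (rule Hom_eqI[OF Comp_Hom[OF category k q] u]) (use h in \<open>simp add: app_Comp[OF k]\<close>)
      show "Comp C r (T, restrict h (fst T), W) = v"
        by (rule Hom_eqI[OF Comp_Hom[OF category k r] v]) (use h in \<open>simp add: app_Comp[OF k]\<close>)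
    next
      fix l assume l: "l \<in> Hom C T W \<and> Comp C q l = u \<and> Comp C r l = v"
      show "l = (T, restrict h (fst T), W)"
      proof (rule Hom_eqI[OF _ k])
        fix t assume t: "t \<in> fst T"
        have "app l t \<in> fst W \<and> app q (app l t) = app u t \<and> app r (app l t) = app v t"
          using l app_in[of l T W t] app_Comp[of l T W t q] app_Comp[of l T W t r] t by auto
        then have "app l t = h t"
          using h[OF t] pt eq t app_in[OF u t] app_in[OF v t] by metis
        then show "app l t = app (T, restrict h (fst T), W) t"
          using t by simp
      qed (use l in blast)
    qed (rule k)
  qed
qed

text \<open>An arbitrary class of objects may lack the test objects that would probe the elements of
  a pullback, so the elementwise description is transported from one pullback known to have it. The
  universal properties give comparison arrows \<open>k\<close> and \<open>l\<close>; that
  \<open>k\<close> after \<open>l\<close> is the identity carries uniqueness and order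
  across.\<close>

lemma is_pullback_ptwise:
  assumes q: "q \<in> Hom C W X" and r: "r \<in> Hom C W Y" and f: "f \<in> Hom C X Z" and g: "g \<in> Hom C Y Z"
    and pb: "is_pullback C q r f g"
    and q0: "q0 \<in> Hom C W0 X" and r0: "r0 \<in> Hom C W0 Y" and pt: "ptwise_pullback q0 r0 f g"
  shows "ptwise_pullback q r f g"
proof -
  note D = HomD[OF q] HomD[OF r] HomD[OF f] HomD[OF g] HomD[OF q0] HomD[OF r0]
  have pb0: "is_pullback C q0 r0 f g"
    by (rule ptwise_is_pullback[OF q0 r0 f g pt])
  note pt = pt[unfolded ptwise_pullback_def D]
  have c: "Comp C f q = Comp C g r" "Comp C f q0 = Comp C g r0"
    using pb pb0 by (simp_all add: is_pullback_def)
  obtain k where k: "k \<in> Hom C W0 W" "Comp C q k = q0" "Comp C r k = r0"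
    using pullback_unique_exists[OF pb, unfolded D, OF q0 r0 c(2)] by blast
  obtain l where l: "l \<in> Hom C W W0" "Comp C q0 l = q" "Comp C r0 l = r"
    using pullback_unique_exists[OF pb0, unfolded D, OF q r c(1)] by blast
  have "Comp C q (Comp C k l) = q" "Comp C r (Comp C k l) = r"
    using Comp_assoc[OF category l(1) k(1) q] Comp_assoc[OF category l(1) k(1) r] k l by simp_all
  moreover have "\<exists>!k. k \<in> Hom C W W \<and> Comp C q k = q \<and> Comp C r k = r"
    using pullback_unique_exists[OF pb, unfolded D, OF q r c(1)] .
  then have "a = b" if "a \<in> Hom C W W" "b \<in> Hom C W W" "Comp C q a = q" "Comp C r a = r"
    "Comp C q b = q" "Comp C r b = r" for a b
    using that by blast
  ultimately have "Comp C k l = Idt C W"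
    by (simp add: Comp_Hom[OF category l(1) k(1)] Idt_Hom[OF category] Comp_Idt_right[OF category q]
        Comp_Idt_right[OF category r] Hom_Obj(1)[OF category q])
  then have kl: "app k (app l w) = w" if "w \<in> fst W" for w
    using app_Comp[OF l(1) that, of k] app_Idt[OF that] by simp
  have qk: "app q (app k w) = app q0 w" "app r (app k w) = app r0 w" if "w \<in> fst W0" for w
    using app_Comp[OF k(1) that, of q] app_Comp[OF k(1) that, of r] k by simp_all
  have ql: "app q0 (app l w) = app q w" "app r0 (app l w) = app r w" if "w \<in> fst W" for w
    using app_Comp[OF l(1) that, of q0] app_Comp[OF l(1) that, of r0] l by simp_all
  show ?thesis
    unfolding ptwise_pullback_def D
  proof (intro conjI ballI impI)
    show "app f (app q w) = app g (app r w)" if "w \<in> fst W" for w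
      using c Comp_eq_iff[OF q f r g] that by blast
  next
    fix x y assume xy: "x \<in> fst X" "y \<in> fst Y" "app f x = app g y"
    then obtain w0 where w0: "w0 \<in> fst W0" "app q0 w0 = x" "app r0 w0 = y"
      and uniq: "\<And>w. w \<in> fst W0 \<Longrightarrow> app q0 w = x \<Longrightarrow> app r0 w = y \<Longrightarrow> w = w0"
      using pt by metis
    have 1: "app k w0 \<in> fst W" "app q (app k w0) = x" "app r (app k w0) = y"
      using qk[OF w0(1)] app_in[OF k(1) w0(1)] w0(2,3) by simp_all
    moreover have "w = app k w0" if "w \<in> fst W" "app q w = x" "app r w = y" for w
      using uniq[of "app l w"] ql[OF that(1)] kl[OF that(1)] that app_in[OF l(1) that(1)] by simp
    ultimately show "\<exists>!w. w \<in> fst W \<and> app q w = x \<and> app r w = y"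
      by blast
  next
    fix w w' assume w: "w \<in> fst W" "w' \<in> fst W" and
      le: "(app q w, app q w') \<in> snd X" "(app r w, app r w') \<in> snd Y"
    have "(app l w, app l w') \<in> snd W0"
      using pt ql[OF w(1)] ql[OF w(2)] le app_in[OF l(1)] w by metis
    from app_mono[OF k(1) this] show "(w, w') \<in> snd W"
      using kl w by simp
  qed
qed

end

section \<open>Smallness and the construction of pullbacks\<close>

locale small_universe =
  fixes \<U> :: "'u set set"
  assumes small_sets: "small_sets \<U>"
begin

abbreviation "\<C> \<equiv> PreOrd \<U>"

text \<open>Smallness for sets over any type, so that sets of pairs and \<open>nat\<close> can
  qualify; the injection into \<open>'u\<close> later turns such a set into the carrier of an
  object.\<close>

definition is_small :: "'a set \<Rightarrow> bool" where
  "is_small X \<longleftrightarrow> (\<exists>e :: 'a \<Rightarrow> 'u. inj_on e X \<and> e ` X \<in> \<U>)"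

lemma subset_small: "A \<in> \<U> \<Longrightarrow> B \<subseteq> A \<Longrightarrow> B \<in> \<U>"
  and image_small: "A \<in> \<U> \<Longrightarrow> f ` A \<in> \<U>"
  and infinite_small: "\<exists>A\<in>\<U>. infinite A"
  using small_sets unfolding small_sets_def by blast+

lemma is_small_member: "A \<in> \<U> \<Longrightarrow> is_small A"
  unfolding is_small_def by (rule exI[of _ id]) simp

lemma is_small_inj:
  assumes "inj_on h X" "h ` X \<subseteq> Y" "is_small Y"
  shows "is_small X"
proof -
  obtain e :: "_ \<Rightarrow> 'u" where e: "inj_on e Y" "e ` Y \<in> \<U>"
    using assms(3) unfolding is_small_def by blast
  have "inj_on (e \<circ> h) X"
    using comp_inj_on[OF assms(1)] inj_on_subset[OF e(1) assms(2)] by blast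
  moreover have "(e \<circ> h) ` X \<in> \<U>"
    using subset_small[OF e(2)] assms(2) by (metis image_comp image_mono)
  ultimately show ?thesis
    unfolding is_small_def by blast
qed

lemma is_small_subset: "is_small Y \<Longrightarrow> X \<subseteq> Y \<Longrightarrow> is_small X"
  using is_small_inj[of id X Y] by simp

lemma is_small_nat: "is_small (UNIV :: nat set)"
proof -
  obtain A and f :: "nat \<Rightarrow> 'u" where "A \<in> \<U>" "inj f" "range f \<subseteq> A"
    using infinite_small infinite_countable_subset by metis
  then show ?thesis
    using is_small_inj[OF _ _ is_small_member] by blast
qed

text \<open>Closure of \<open>\<U>\<close> under unions is not among its axioms. Cardinals are
  comparable, however, so one of the two sets embeds into the other, which serves as
  \<open>D\<close>.\<close>

lemma common_bound:
  includes cardinal_syntax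
  assumes "A \<in> \<U>" "B \<in> \<U>"
  obtains D f g where "D \<in> \<U>" "inj_on f A" "f ` A \<subseteq> D" "inj_on g B" "g ` B \<subseteq> D"
proof -
  have "|A| \<le>o |B| \<or> |B| \<le>o |A|"
    by (rule ordLeq_total) (rule card_of_Well_order)+
  then consider f where "inj_on f A" "f ` A \<subseteq> B" | g where "inj_on g B" "g ` B \<subseteq> A"
    unfolding card_of_ordLeq[symmetric] by (elim disjE exE conjE)
  then show thesis
  proof cases
    case (1 f)
    then show ?thesis using that[of B f id] assms by simp
  next
    case (2 g)
    then show ?thesis using that[of A id g] assms by simp
  qed
qed

text \<open>Both factors and an infinite member embed into one member \<open>D'\<close>. Being
  infinite, \<open>D'\<close> is equinumerous to \<open>D' \<times> D'\<close>, which contains a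
  copy of the product.\<close>

lemma is_small_Times:
  includes cardinal_syntax
  assumes "is_small X" "is_small Y"
  shows "is_small (X \<times> Y)"
proof -
  obtain e e' where e: "inj_on e X" "e ` X \<in> \<U>" and e': "inj_on e' Y" "e' ` Y \<in> \<U>"
    using assms unfolding is_small_def by blast
  obtain I where I: "I \<in> \<U>" "infinite I"
    using infinite_small by blast
  obtain D f g where D: "D \<in> \<U>" and f: "inj_on f (e ` X)" "f ` e ` X \<subseteq> D"
    and g: "inj_on g (e' ` Y)" "g ` e' ` Y \<subseteq> D"
    by (rule common_bound[OF e(2) e'(2)])
  obtain D' h i where D': "D' \<in> \<U>" and h: "inj_on h D" "h ` D \<subseteq> D'" and i: "inj_on i I" "i ` I \<subseteq> D'"
    by (rule common_bound[OF D I(1)])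
  have "infinite D'"
    using i I(2) by (blast dest: finite_subset finite_imageD)
  then have "|D' \<times> D'| =o |D'|"
    by (rule card_of_Times_same_infinite)
  then obtain j where j: "bij_betw j (D' \<times> D') D'"
    using card_of_ordIso by blast
  have sm: "is_small (D' \<times> D')"
    by (rule is_small_inj[OF bij_betw_imp_inj_on[OF j] _ is_small_member[OF D']])
      (use j in \<open>auto simp: bij_betw_def\<close>)
  have "inj_on (h \<circ> f \<circ> e) X" "inj_on (h \<circ> g \<circ> e') Y"
    by (rule comp_inj_on[OF e(1) comp_inj_on[OF f(1) inj_on_subset[OF h(1) f(2)]]])
      (rule comp_inj_on[OF e'(1) comp_inj_on[OF g(1) inj_on_subset[OF h(1) g(2)]]])
  then have "inj_on (map_prod (h \<circ> f \<circ> e) (h \<circ> g \<circ> e')) (X \<times> Y)"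
    by (rule map_prod_inj_on)
  moreover have "map_prod (h \<circ> f \<circ> e) (h \<circ> g \<circ> e') ` (X \<times> Y) \<subseteq> D' \<times> D'"
    using f(2) g(2) h(2) by (auto simp: image_subset_iff)
  ultimately show ?thesis
    using sm by (rule is_small_inj)
qed

lemma PreOrd_Obj: "X \<in> Obj \<C> \<longleftrightarrow> fst X \<in> \<U> \<and> preorder_on (fst X) (snd X)"
  by (cases X) (simp add: PreOrd_def preord_subcat_def)

lemma ParOrd_Obj: "X \<in> Obj (ParOrd \<U>) \<longleftrightarrow> fst X \<in> \<U> \<and> partial_order_on (fst X) (snd X)"
  by (cases X) (simp add: ParOrd_def preord_subcat_def)

sublocale preord_category "PreOrd \<U>"
proof
  show "\<C> = preord_subcat (Obj \<C>)"
    by (simp add: PreOrd_def preord_subcat_def)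
qed (simp add: PreOrd_Obj)

sublocale par: preord_category "ParOrd \<U>"
proof
  show "ParOrd \<U> = preord_subcat (Obj (ParOrd \<U>))"
    by (simp add: ParOrd_def preord_subcat_def)
qed (simp add: ParOrd_Obj partial_order_on_def)

text \<open>Transport of structure. It supplies the objects whose natural elements are pairs: the
  apexes of pullbacks and the poset covering a given \<open>B\<close>.\<close>

lemma small_preorder_realization:
  assumes X: "is_small X" and R: "preorder_on X R"
  obtains Z e where "Z \<in> Obj \<C>" "bij_betw e X (fst Z)"
    "\<And>x y. x \<in> X \<Longrightarrow> y \<in> X \<Longrightarrow> (e x, e y) \<in> snd Z \<longleftrightarrow> (x, y) \<in> R"
proof -
  obtain e where e: "inj_on e X" "e ` X \<in> \<U>"
    using X unfolding is_small_def by blast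
  have R': "R \<subseteq> X \<times> X" "refl_on X R" "trans R"
    using R by (auto simp: preorder_on_def)
  let ?Z = "(e ` X, map_prod e e ` R)"
  have iff: "(e x, e y) \<in> snd ?Z \<longleftrightarrow> (x, y) \<in> R" if "x \<in> X" "y \<in> X" for x y
  proof
    assume "(e x, e y) \<in> snd ?Z"
    then obtain x' y' where xy: "(x', y') \<in> R" "e x = e x'" "e y = e y'"
      by auto
    moreover from this have "x = x'" "y = y'"
      using R'(1) that by (blast intro: inj_onD[OF e(1)])+
    ultimately show "(x, y) \<in> R"
      by simp
  qed force
  have "trans (snd ?Z)"
  proof (rule transI)
    fix a b c assume ab: "(a, b) \<in> snd ?Z" and bc: "(b, c) \<in> snd ?Z"
    then obtain x y z where "a = e x" "b = e y" "c = e z" "x \<in> X" "y \<in> X" "z \<in> X"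
      using R'(1) by auto
    then show "(a, c) \<in> snd ?Z"
      using ab bc iff R'(3) by (metis transD)
  qed
  moreover have "snd ?Z \<subseteq> fst ?Z \<times> fst ?Z"
    using R'(1) by auto
  moreover have "refl_on (fst ?Z) (snd ?Z)"
    using R'(2) iff unfolding refl_on_def by auto
  ultimately have "?Z \<in> Obj \<C>"
    using e(2) unfolding PreOrd_Obj preorder_on_def by simp
  then show thesis
    using that[of ?Z e] e(1) iff by (simp add: bij_betw_def)
qed

text \<open>The apex is a copy in \<open>'u\<close> of the set \<open>S\<close> of matching pairs
  under the componentwise order \<open>R\<close>; \<open>d\<close> decodes an element of the copy
  into its pair.\<close>

lemma ptwise_pullback_exists:
  assumes f: "f \<in> Hom \<C> X Z" and g: "g \<in> Hom \<C> Y Z"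
  shows "\<exists>W q r. q \<in> Hom \<C> W X \<and> r \<in> Hom \<C> W Y \<and> ptwise_pullback q r f g"
proof -
  have X: "X \<in> Obj \<C>" and Y: "Y \<in> Obj \<C>"
    using f g by (auto simp: Hom_iff)
  define S where "S = {(x, y). x \<in> fst X \<and> y \<in> fst Y \<and> app f x = app g y}"
  define R where "R = {((x, y), (x', y')). (x, y) \<in> S \<and> (x', y') \<in> S \<and> (x, x') \<in> snd X \<and> (y, y') \<in> snd Y}"
  have "is_small S"
    by (rule is_small_subset[OF is_small_Times[OF is_small_member is_small_member, of "fst X" "fst Y"]])
      (use X Y in \<open>auto simp: PreOrd_Obj S_def\<close>)
  moreover have "preorder_on S R"
    unfolding preorder_on_def refl_on_def trans_def R_def S_def
    using ord_refl[OF X] ord_refl[OF Y] ord_trans[OF X] ord_trans[OF Y] by blast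
  ultimately obtain W e where W: "W \<in> Obj \<C>" and e: "bij_betw e S (fst W)"
    and iff: "\<And>x y. x \<in> S \<Longrightarrow> y \<in> S \<Longrightarrow> (e x, e y) \<in> snd W \<longleftrightarrow> (x, y) \<in> R"
    by (rule small_preorder_realization) auto
  define d where "d = inv_into S e"
  have d: "d w \<in> S" "e (d w) = w" if "w \<in> fst W" for w
    using e inv_into_into[of w e S] f_inv_into_f[of w e S] that
    by (auto simp: d_def bij_betw_def)
  have de: "d (e s) = s" if "s \<in> S" for s
    using bij_betw_inv_into_left[OF e that] by (simp add: d_def)
  have le: "(fst (d w), fst (d w')) \<in> snd X \<and> (snd (d w), snd (d w')) \<in> snd Y \<longleftrightarrow> (w, w') \<in> snd W"
    if "w \<in> fst W" "w' \<in> fst W" for w w'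
    using iff[OF d(1)[OF that(1)] d(1)[OF that(2)]] d[OF that(1)] d[OF that(2)]
    by (simp add: R_def split_beta)
  have dS: "fst (d w) \<in> fst X" "snd (d w) \<in> fst Y" "app f (fst (d w)) = app g (snd (d w))"
    if "w \<in> fst W" for w
    using d(1)[OF that] by (auto simp: S_def)
  have q: "(W, restrict (\<lambda>w. fst (d w)) (fst W), X) \<in> Hom \<C> W X"
    using dS le ord_carrier[OF W] by (intro mor_Hom[OF W X]) blast+
  have r: "(W, restrict (\<lambda>w. snd (d w)) (fst W), Y) \<in> Hom \<C> W Y"
    using dS le ord_carrier[OF W] by (intro mor_Hom[OF W Y]) blast+
  have "ptwise_pullback (W, restrict (\<lambda>w. fst (d w)) (fst W), X) (W, restrict (\<lambda>w. snd (d w)) (fst W), Y) f g"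
    unfolding ptwise_pullback_def HomD[OF q] HomD[OF r] HomD[OF f] HomD[OF g]
  proof (intro conjI ballI impI)
    fix x y assume "x \<in> fst X" "y \<in> fst Y" "app f x = app g y"
    then have s: "(x, y) \<in> S" by (simp add: S_def)
    then have es: "e (x, y) \<in> fst W"
      using e by (auto simp: bij_betw_def)
    show "\<exists>!w. w \<in> fst W \<and> app (W, restrict (\<lambda>w. fst (d w)) (fst W), X) w = x \<and>
        app (W, restrict (\<lambda>w. snd (d w)) (fst W), Y) w = y"
    proof (rule ex1I[of _ "e (x, y)"])
      fix w assume "w \<in> fst W \<and> app (W, restrict (\<lambda>w. fst (d w)) (fst W), X) w = x \<and>
        app (W, restrict (\<lambda>w. snd (d w)) (fst W), Y) w = y"
      then have "w \<in> fst W" "d w = (x, y)" by (auto simp: prod_eq_iff)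
      then show "w = e (x, y)" using d(2)[of w] by simp
    qed (use es de[OF s] in simp)
  next
    fix w w' assume w: "w \<in> fst W" "w' \<in> fst W"
      and "(app (W, restrict (\<lambda>w. fst (d w)) (fst W), X) w, app (W, restrict (\<lambda>w. fst (d w)) (fst W), X) w') \<in> snd X"
        "(app (W, restrict (\<lambda>w. snd (d w)) (fst W), Y) w, app (W, restrict (\<lambda>w. snd (d w)) (fst W), Y) w') \<in> snd Y"
    then show "(w, w') \<in> snd W"
      using le[OF w] by simp
  qed (use dS in simp)
  then show ?thesis using q r by blast
qed

lemma is_pullback_iff:
  assumes q: "q \<in> Hom \<C> W X" and r: "r \<in> Hom \<C> W Y" and f: "f \<in> Hom \<C> X Z" and g: "g \<in> Hom \<C> Y Z"
  shows "is_pullback \<C> q r f g \<longleftrightarrow> ptwise_pullback q r f g"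
  using ptwise_is_pullback[OF q r f g] is_pullback_ptwise[OF q r f g] ptwise_pullback_exists[OF f g]
  by blast

lemma pullbacks_along_arrow: "p \<in> Arr \<C> \<Longrightarrow> pullbacks_along \<C> p"
proof
  fix f assume p: "p \<in> Arr \<C>" and f: "f \<in> Arr \<C>" "Cod \<C> f = Cod \<C> p"
  then have f': "f \<in> Hom \<C> (Dom \<C> f) (Cod \<C> p)"
    by (simp add: Hom_def)
  obtain W q r where "q \<in> Hom \<C> W (Dom \<C> p)" "r \<in> Hom \<C> W (Dom \<C> f)" "ptwise_pullback q r p f"
    using ptwise_pullback_exists[OF Arr_Hom[OF p] f'] by blast
  then show "\<exists>q r. is_pullback \<C> q r p f"
    using is_pullback_iff[OF _ _ Arr_Hom[OF p] f'] by blast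
qed (rule category)

end

section \<open>Effective descent for preordered sets\<close>

text \<open>Together with monotonicity of \<open>q\<close>, \<open>lift\<close> says that the order
  of \<open>A\<close> is the direct image of that of \<open>P\<close>, with no transitive closure
  taken; by reflexivity it also makes \<open>q\<close> surjective. A map constant on the fibres of
  \<open>q\<close> therefore stays monotone on \<open>A\<close>. Both the descent of morphisms and
  the diagonals of the factorization system are obtained this way.\<close>

lemma (in preord_category) quotient_factorization:
  assumes q: "q \<in> Hom C P A" and k: "k \<in> Hom C P Z"
    and lift: "\<And>a a'. (a, a') \<in> snd A \<Longrightarrow> \<exists>t t'. (t, t') \<in> snd P \<and> app q t = a \<and> app q t' = a'"
    and const: "\<And>t t'. t \<in> fst P \<Longrightarrow> t' \<in> fst P \<Longrightarrow> app q t = app q t' \<Longrightarrow> app k t = app k t'"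
  shows "\<exists>!w. w \<in> Hom C A Z \<and> Comp C w q = k"
proof -
  have P: "P \<in> Obj C" and A: "A \<in> Obj C" and Z: "Z \<in> Obj C"
    using q k by (auto simp: Hom_iff)
  have "\<exists>t\<in>fst P. app q t = a" if "a \<in> fst A" for a
    using lift[OF ord_refl[OF A that]] ord_carrier[OF P] by blast
  then obtain s where s: "\<And>a. a \<in> fst A \<Longrightarrow> s a \<in> fst P" "\<And>a. a \<in> fst A \<Longrightarrow> app q (s a) = a"
    by metis
  have ks: "app k (s (app q t)) = app k t" if "t \<in> fst P" for t
    using const s app_in[OF q that] that by blast
  let ?w = "(A, restrict (\<lambda>a. app k (s a)) (fst A), Z)"
  have w: "?w \<in> Hom C A Z"
  proof (rule mor_Hom[OF A Z])
    fix a a' assume "(a, a') \<in> snd A"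
    then obtain t t' where t: "(t, t') \<in> snd P" and "a = app q t" "a' = app q t'"
      using lift by blast
    then show "(app k (s a), app k (s a')) \<in> snd Z"
      using ks ord_carrier[OF P t] app_mono[OF k t] by simp
  qed (use s app_in[OF k] in blast)
  have wq: "Comp C ?w q = k"
    by (rule Hom_eqI[OF Comp_Hom[OF category q w] k]) (simp add: app_Comp[OF q] app_in[OF q] ks)
  have "v = ?w" if v: "v \<in> Hom C A Z" "Comp C v q = k" for v
  proof (rule Hom_eqI[OF v(1) w])
    fix a assume a: "a \<in> fst A"
    show "app v a = app ?w a"
      using app_Comp[OF q s(1)[OF a], of v] v(2) s(2)[OF a] a by simp
  qed
  then show ?thesis
    using w wq by blast
qed

section \<open>Chosen pullbacks of preordered sets, in elements\<close>

locale small_pullbacks = small_universe \<U> + pullbacks_along "PreOrd \<U>" p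
  for \<U> :: "'u set set" and p
begin

notation comp (infixr "\<cdot>" 70)

lemma pr_ptwise:
  assumes x: "x \<in> Hom \<C> X B"
  shows "ptwise_pullback (pr1 x) (pr2 x) p x"
  using is_pullback_iff[OF pr1_Hom[OF x] pr2_Hom[OF x] p_Hom x] chosen_pullback[OF x] by simp

lemma
  assumes x: "x \<in> Hom \<C> X B"
  shows pr_eq: "t \<in> fst (apex x) \<Longrightarrow> app p (app (pr1 x) t) = app x (app (pr2 x) t)"
    and apex_exists: "e \<in> fst E \<Longrightarrow> a \<in> fst X \<Longrightarrow> app p e = app x a \<Longrightarrow>
      \<exists>t\<in>fst (apex x). app (pr1 x) t = e \<and> app (pr2 x) t = a"
    and apex_elem_eqI: "t \<in> fst (apex x) \<Longrightarrow> t' \<in> fst (apex x) \<Longrightarrow> app (pr1 x) t = app (pr1 x) t' \<Longrightarrow>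
      app (pr2 x) t = app (pr2 x) t' \<Longrightarrow> t = t'"
    and apex_le: "t \<in> fst (apex x) \<Longrightarrow> t' \<in> fst (apex x) \<Longrightarrow>
      (app (pr1 x) t, app (pr1 x) t') \<in> snd E \<Longrightarrow> (app (pr2 x) t, app (pr2 x) t') \<in> snd X \<Longrightarrow>
      (t, t') \<in> snd (apex x)"
proof -
  note pt = pr_ptwise[OF x, unfolded ptwise_pullback_def HomD[OF x]]
  show 1: "app p (app (pr1 x) t) = app x (app (pr2 x) t)" if "t \<in> fst (apex x)" for t
    using pt that by blast
  show "\<exists>t\<in>fst (apex x). app (pr1 x) t = e \<and> app (pr2 x) t = a"
    if "e \<in> fst E" "a \<in> fst X" "app p e = app x a" for e a
    using pt that by blast
  show "t = t'" if "t \<in> fst (apex x)" "t' \<in> fst (apex x)" "app (pr1 x) t = app (pr1 x) t'"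
      "app (pr2 x) t = app (pr2 x) t'" for t t'
  proof -
    have "\<exists>!w. w \<in> fst (apex x) \<and> app (pr1 x) w = app (pr1 x) t \<and> app (pr2 x) w = app (pr2 x) t"
      using pt 1[OF that(1)] app_in[OF pr1_Hom[OF x] that(1)] app_in[OF pr2_Hom[OF x] that(1)] by blast
    then show ?thesis
      using that by metis
  qed
  show "(t, t') \<in> snd (apex x)" if "t \<in> fst (apex x)" "t' \<in> fst (apex x)"
    "(app (pr1 x) t, app (pr1 x) t') \<in> snd E" "(app (pr2 x) t, app (pr2 x) t') \<in> snd X" for t t'
    using pt that by blast
qed

lemma
  assumes fgh: "f \<in> Hom \<C> X B" "g \<in> Hom \<C> Y B" "h \<in> Hom \<C> X Y" "g \<cdot> h = f"
    and t: "t \<in> fst (apex f)"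
  shows app_pr1_base_change: "app (pr1 g) (app (base_change f h g) t) = app (pr1 f) t"
    and app_pr2_base_change: "app (pr2 g) (app (base_change f h g) t) = app h (app (pr2 f) t)"
  using app_Comp[OF base_change_Hom[OF fgh] t, of "pr1 g"] pr1_base_change[OF fgh]
    app_Comp[OF base_change_Hom[OF fgh] t, of "pr2 g"] pr2_base_change[OF fgh]
    app_Comp[OF pr2_Hom[OF fgh(1)] t, of h] by simp_all

lemma
  assumes x: "x \<in> Hom \<C> X B" and t: "t \<in> fst (apex (p \<cdot> pr1 x))"
  shows app_pr1_act: "app (pr1 x) (app (act x) t) = app (pr1 (p \<cdot> pr1 x)) t"
    and app_pr2_act: "app (pr2 x) (app (act x) t) = app (pr2 x) (app (pr2 (p \<cdot> pr1 x)) t)"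
  using app_Comp[OF act_Hom[OF x] t, of "pr1 x"] pr1_act[OF x]
    app_Comp[OF act_Hom[OF x] t, of "pr2 x"] pr2_act[OF x]
    app_Comp[OF pr2_Hom[OF Comp_Hom[OF pr1_Hom[OF x] p_Hom]] t, of "pr2 x"] by simp_all

lemma effective_descent_surj:
  assumes ed: "effective_descent \<C> p"
  shows "app p ` fst E = fst B"
proof
  show "app p ` fst E \<subseteq> fst B"
    using app_in[OF p_Hom] by blast
  have B: "B \<in> Obj \<C>"
    using p_Hom by (simp add: Hom_iff)
  \<comment> \<open>The image of \<open>p\<close> carries the order induced from \<open>B\<close>,
    so that the base change of its inclusion reflects the order. That base change is onto because a
    point \<open>(e, b)\<close> of the pullback of the identity has \<open>b = p e\<close>, which
    lies in the image.\<close>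
  define S where "S = (app p ` fst E, snd B \<inter> (app p ` fst E \<times> app p ` fst E))"
  have Im: "app p ` fst E \<subseteq> fst B"
    using app_in[OF p_Hom] by blast
  have S: "S \<in> Obj \<C>"
    using B Im unfolding S_def PreOrd_Obj preorder_on_def refl_on_def trans_def fst_conv snd_conv
    by (blast intro: subset_small)
  define i where "i = (S, restrict (\<lambda>b. b) (fst S), B)"
  have i: "i \<in> Hom \<C> S B"
    unfolding i_def using Im by (intro mor_Hom[OF S B]) (auto simp: S_def)
  have idB: "Idt \<C> B \<in> Hom \<C> B B"
    by (rule Idt_Hom[OF B])
  have comm: "Idt \<C> B \<cdot> i = i"
    by (rule Comp_Idt_left[OF i])
  note bc = base_change_Hom[OF i idB i comm]
  note bc_app = app_pr1_base_change[OF i idB i comm] app_pr2_base_change[OF i idB i comm]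
  have pr2i: "app i (app (pr2 i) t) = app (pr2 i) t" if "t \<in> fst (apex i)" for t
    using app_in[OF pr2_Hom[OF i] that] by (simp add: i_def)
  have "is_iso \<C> (base_change i i (Idt \<C> B))"
    unfolding is_iso_iff[OF bc]
  proof (intro conjI ballI impI)
    show "inj_on (app (base_change i i (Idt \<C> B))) (fst (apex i))"
    proof (rule inj_onI)
      fix t t' assume t: "t \<in> fst (apex i)" "t' \<in> fst (apex i)"
        and "app (base_change i i (Idt \<C> B)) t = app (base_change i i (Idt \<C> B)) t'"
      then show "t = t'"
        using bc_app[OF t(1)] bc_app[OF t(2)] pr2i[OF t(1)] pr2i[OF t(2)]
        by (intro apex_elem_eqI[OF i t]) simp_all
    qed
    show "(t, t') \<in> snd (apex i)" if t: "t \<in> fst (apex i)" "t' \<in> fst (apex i)"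
      and le: "(app (base_change i i (Idt \<C> B)) t, app (base_change i i (Idt \<C> B)) t')
        \<in> snd (apex (Idt \<C> B))" for t t'
    proof (rule apex_le[OF i t])
      show "(app (pr1 i) t, app (pr1 i) t') \<in> snd E"
        using app_mono[OF pr1_Hom[OF idB] le] bc_app(1)[OF t(1)] bc_app(1)[OF t(2)] by simp
      have "(app (pr2 i) t, app (pr2 i) t') \<in> snd B"
        using app_mono[OF pr2_Hom[OF idB] le] bc_app(2)[OF t(1)] bc_app(2)[OF t(2)]
          pr2i[OF t(1)] pr2i[OF t(2)] by simp
      then show "(app (pr2 i) t, app (pr2 i) t') \<in> snd S"
        using app_in[OF pr2_Hom[OF i]] t by (auto simp: S_def)
    qed
    show "app (base_change i i (Idt \<C> B)) ` fst (apex i) = fst (apex (Idt \<C> B))"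
    proof
      show "fst (apex (Idt \<C> B)) \<subseteq> app (base_change i i (Idt \<C> B)) ` fst (apex i)"
      proof
        fix t assume t: "t \<in> fst (apex (Idt \<C> B))"
        have e: "app (pr1 (Idt \<C> B)) t \<in> fst E"
          by (rule app_in[OF pr1_Hom[OF idB] t])
        have pe: "app p (app (pr1 (Idt \<C> B)) t) = app (pr2 (Idt \<C> B)) t"
          using pr_eq[OF idB t] app_Idt[OF app_in[OF pr2_Hom[OF idB] t]] by simp
        obtain u where u: "u \<in> fst (apex i)" "app (pr1 i) u = app (pr1 (Idt \<C> B)) t"
          "app (pr2 i) u = app p (app (pr1 (Idt \<C> B)) t)"
          using apex_exists[OF i e, of "app p (app (pr1 (Idt \<C> B)) t)"] e
          by (auto simp: S_def i_def)
        have "app (base_change i i (Idt \<C> B)) u = t"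
          using apex_elem_eqI[OF idB app_in[OF bc u(1)] t] bc_app[OF u(1)] pr2i[OF u(1)] u(2,3) pe
          by simp
        then show "t \<in> app (base_change i i (Idt \<C> B)) ` fst (apex i)"
          using u(1) by blast
      qed
    qed (use app_in[OF bc] in blast)
  qed
  then have "is_iso \<C> i"
    by (rule effective_descent_reflects_iso[OF ed i idB i comm])
  then have "app i ` fst S = fst B"
    unfolding is_iso_iff[OF i] by blast
  then show "fst B \<subseteq> app p ` fst E"
    by (auto simp: S_def i_def)
qed

end

section \<open>Descent along maps that lift chains of three elements\<close>

locale chain_lifting = small_pullbacks +
  assumes chain_lift: "\<And>b0 b1 b2. (b0, b1) \<in> snd B \<Longrightarrow> (b1, b2) \<in> snd B \<Longrightarrow>
    \<exists>e0 e1 e2. (e0, e1) \<in> snd E \<and> (e1, e2) \<in> snd E \<and> app p e0 = b0 \<and> app p e1 = b1 \<and> app p e2 = b2"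
begin

lemma E_Obj: "E \<in> Obj \<C>" and B_Obj: "B \<in> Obj \<C>"
  using p_Hom by (auto simp: Hom_iff)

text \<open>Repeating an element turns the pair into a chain of three.\<close>

lemma pair_lift: "(b, b') \<in> snd B \<Longrightarrow> \<exists>e e'. (e, e') \<in> snd E \<and> app p e = b \<and> app p e' = b'"
  using chain_lift ord_refl[OF B_Obj] ord_carrier[OF B_Obj] by metis

text \<open>The arrow \<open>w\<close> is \<open>pr2 y \<cdot> k\<close> factored through
  \<open>pr2 x\<close>, which lifts related pairs because \<open>p\<close> does. That
  \<open>w\<close> lies over \<open>B\<close> is then automatic, because \<open>k\<close> lies over
  \<open>E\<close> and both pullback squares commute.\<close>

lemma comparison_fully_faithful:
  assumes x: "x \<in> Hom \<C> X B" and y: "y \<in> Hom \<C> Y B"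
    and k: "k \<in> Hom \<C> (apex x) (apex y)" "pr1 y \<cdot> k = pr1 x"
    and alg: "k \<cdot> act x = act y \<cdot> base_change (p \<cdot> pr1 x) k (p \<cdot> pr1 y)"
  shows "\<exists>!w. w \<in> Hom \<C> X Y \<and> y \<cdot> w = x \<and> pr2 y \<cdot> k = w \<cdot> pr2 x"
proof -
  have X: "X \<in> Obj \<C>"
    using x by (simp add: Hom_iff)
  note px = Comp_Hom[OF pr1_Hom[OF x] p_Hom] and py = Comp_Hom[OF pr1_Hom[OF y] p_Hom]
  have pyk: "(p \<cdot> pr1 y) \<cdot> k = p \<cdot> pr1 x"
    using Comp_assoc[OF k(1) pr1_Hom[OF y] p_Hom] k(2) by simp
  have pr1_k: "app (pr1 y) (app k t) = app (pr1 x) t" if "t \<in> fst (apex x)" for t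
    using app_Comp[OF k(1) that, of "pr1 y"] k(2) by simp
  have lift: "\<exists>t t'. (t, t') \<in> snd (apex x) \<and> app (pr2 x) t = a \<and> app (pr2 x) t' = a'"
    if a: "(a, a') \<in> snd X" for a a'
  proof -
    obtain e e' where e: "(e, e') \<in> snd E" "app p e = app x a" "app p e' = app x a'"
      using pair_lift[OF app_mono[OF x a]] by blast
    obtain t where t: "t \<in> fst (apex x)" "app (pr1 x) t = e" "app (pr2 x) t = a"
      using apex_exists[OF x _ _ e(2)] ord_carrier[OF E_Obj e(1)] ord_carrier[OF X a] by blast
    obtain t' where t': "t' \<in> fst (apex x)" "app (pr1 x) t' = e'" "app (pr2 x) t' = a'"
      using apex_exists[OF x _ _ e(3)] ord_carrier[OF E_Obj e(1)] ord_carrier[OF X a] by blast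
    show ?thesis
      using apex_le[OF x t(1) t'(1)] t t' e a by auto
  qed
  have const: "app (pr2 y \<cdot> k) t = app (pr2 y \<cdot> k) t'"
    if t: "t \<in> fst (apex x)" "t' \<in> fst (apex x)" "app (pr2 x) t = app (pr2 x) t'" for t t'
  proof -
    have "app p (app (pr1 x) t) = app (p \<cdot> pr1 x) t'"
      using app_Comp[OF pr1_Hom[OF x] t(2), of p] pr_eq[OF x t(1)] pr_eq[OF x t(2)] t(3) by simp
    \<comment> \<open>With \<open>t = (e, a)\<close> and \<open>t' = (e', a)\<close> take
      \<open>s = (e, t')\<close>. The action sends \<open>s\<close> to \<open>t\<close>, so
      compatibility of \<open>k\<close> with the actions forces \<open>k t\<close> and
      \<open>k t'\<close> to have the same second component.\<close>
    then obtain s where s: "s \<in> fst (apex (p \<cdot> pr1 x))" "app (pr1 (p \<cdot> pr1 x)) s = app (pr1 x) t"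
        "app (pr2 (p \<cdot> pr1 x)) s = t'"
      using apex_exists[OF px app_in[OF pr1_Hom[OF x] t(1)] t(2)] by blast
    have act_s: "app (act x) s = t"
      by (rule apex_elem_eqI[OF x app_in[OF act_Hom[OF x] s(1)] t(1)])
        (simp_all add: app_pr1_act[OF x s(1)] app_pr2_act[OF x s(1)] s(2,3) t(3))
    note bc = base_change_Hom[OF px py k(1) pyk]
    have "app k t = app (act y) (app (base_change (p \<cdot> pr1 x) k (p \<cdot> pr1 y)) s)"
      using app_Comp[OF act_Hom[OF x] s(1), of k] app_Comp[OF bc s(1), of "act y"] alg act_s by simp
    then have "app (pr2 y) (app k t) = app (pr2 y) (app k t')"
      using app_pr2_act[OF y app_in[OF bc s(1)]] app_pr2_base_change[OF px py k(1) pyk s(1)] s(3)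
      by simp
    then show ?thesis
      using app_Comp[OF k(1) t(1)] app_Comp[OF k(1) t(2)] by simp
  qed
  have eq: "y \<cdot> w = x" if w: "w \<in> Hom \<C> X Y" "w \<cdot> pr2 x = pr2 y \<cdot> k" for w
  proof (rule Hom_eqI[OF Comp_Hom[OF w(1) y] x])
    fix a assume a: "a \<in> fst X"
    then obtain t where t: "t \<in> fst (apex x)" "app (pr2 x) t = a"
      using lift[OF ord_refl[OF X a]] ord_carrier[OF Hom_Obj(1)[OF category pr1_Hom[OF x]]] by blast
    have "app y (app w a) = app y (app (pr2 y) (app k t))"
      using app_Comp[OF pr2_Hom[OF x] t(1), of w] app_Comp[OF k(1) t(1), of "pr2 y"] w(2) t(2) by simp
    also have "\<dots> = app x a"
      using pr_eq[OF y app_in[OF k(1) t(1)]] pr1_k[OF t(1)] pr_eq[OF x t(1)] t(2) by simp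
    finally show "app (y \<cdot> w) a = app x a"
      using app_Comp[OF w(1) a] by simp
  qed
  have "\<exists>!w. w \<in> Hom \<C> X Y \<and> w \<cdot> pr2 x = pr2 y \<cdot> k"
    by (rule quotient_factorization[OF pr2_Hom[OF x] Comp_Hom[OF k(1) pr2_Hom[OF y]] lift const])
  then show ?thesis
    using eq by metis
qed

text \<open>An algebra structure \<open>h\<close> amounts to a transport: whenever
  \<open>p e = g a\<close>, the element \<open>m e a\<close> is \<open>a\<close> moved into the
  fibre of \<open>f\<close> over \<open>e\<close>. The object sought over \<open>B\<close> is the
  set of orbits, realized on representatives and ordered by comparing transports.\<close>

lemma comparison_ess_surj:
  assumes f: "f \<in> Hom \<C> A E" and h: "h \<in> Hom \<C> (apex (p \<cdot> f)) A" and fh: "f \<cdot> h = pr1 (p \<cdot> f)"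
    and unit: "h \<cdot> unit_map f = Idt \<C> A"
    and assoc: "h \<cdot> base_change (p \<cdot> pr1 (p \<cdot> f)) h (p \<cdot> f) = h \<cdot> act (p \<cdot> f)"
  shows "\<exists>x\<in>Arr \<C>. Cod \<C> x = B \<and> (\<exists>i\<in>Hom \<C> (apex x) A. is_iso \<C> i \<and> f \<cdot> i = pr1 x \<and>
    i \<cdot> act x = h \<cdot> base_change (p \<cdot> pr1 x) i (p \<cdot> f))"
proof -
  have A: "A \<in> Obj \<C>"
    using f by (simp add: Hom_iff)
  note pf = Comp_Hom[OF f p_Hom]
  note ppf = Comp_Hom[OF pr1_Hom[OF pf] p_Hom]
  define g where "g a = app p (app f a)" for a
  have app_pf: "app (p \<cdot> f) a = g a" if "a \<in> fst A" for a
    using app_Comp[OF f that, of p] by (simp add: g_def)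
  have fA: "app f a \<in> fst E" if "a \<in> fst A" for a
    by (rule app_in[OF f that])
  have gA: "g a \<in> fst B" if "a \<in> fst A" for a
    unfolding g_def by (rule app_in[OF p_Hom fA[OF that]])
  have "\<exists>e\<in>fst E. app p e = b" if "b \<in> fst B" for b
    using pair_lift[OF ord_refl[OF B_Obj that]] ord_carrier[OF E_Obj] by blast
  then obtain s where s: "\<And>b. b \<in> fst B \<Longrightarrow> s b \<in> fst E" "\<And>b. b \<in> fst B \<Longrightarrow> app p (s b) = b"
    by metis
  have "\<exists>t. t \<in> fst (apex (p \<cdot> f)) \<and> app (pr1 (p \<cdot> f)) t = e \<and> app (pr2 (p \<cdot> f)) t = a"
    if "e \<in> fst E" "a \<in> fst A" "app p e = g a" for e a
    using apex_exists[OF pf that(1,2)] that app_pf by auto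
  \<comment> \<open>\<open>pr e a\<close> names the point \<open>(e, a)\<close> of the chosen
    pullback, whose elements are otherwise known only through their projections.\<close>
  then obtain pr where pr: "\<And>e a. e \<in> fst E \<Longrightarrow> a \<in> fst A \<Longrightarrow> app p e = g a \<Longrightarrow> pr e a \<in> fst (apex (p \<cdot> f)) \<and>
      app (pr1 (p \<cdot> f)) (pr e a) = e \<and> app (pr2 (p \<cdot> f)) (pr e a) = a"
    by metis
  define m where "m e a = app h (pr e a)" for e a
  have h_m: "app h t = m (app (pr1 (p \<cdot> f)) t) (app (pr2 (p \<cdot> f)) t)" if t: "t \<in> fst (apex (p \<cdot> f))" for t
  proof -
    have "app (pr1 (p \<cdot> f)) t \<in> fst E" "app (pr2 (p \<cdot> f)) t \<in> fst A"
      using app_in[OF pr1_Hom[OF pf] t] app_in[OF pr2_Hom[OF pf] t] by auto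
    moreover from this have "app p (app (pr1 (p \<cdot> f)) t) = g (app (pr2 (p \<cdot> f)) t)"
      using pr_eq[OF pf t] app_pf by simp
    ultimately have "pr (app (pr1 (p \<cdot> f)) t) (app (pr2 (p \<cdot> f)) t) = t"
      using pr by (intro apex_elem_eqI[OF pf _ t]) auto
    then show ?thesis by (simp add: m_def)
  qed
  have m_in: "m e a \<in> fst A" and f_m: "app f (m e a) = e"
    if ea: "e \<in> fst E" "a \<in> fst A" "app p e = g a" for e a
    using pr[OF ea] app_in[OF h] app_Comp[OF h, of "pr e a" f] fh by (auto simp: m_def)
  have g_m: "g (m e a) = g a" if ea: "e \<in> fst E" "a \<in> fst A" "app p e = g a" for e a
    using f_m[OF ea] ea(3) by (simp add: g_def)
  have m_unit: "m (app f a) a = a" if a: "a \<in> fst A" for a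
  proof -
    note u = unit_map_Hom[OF f] pr1_unit_map[OF f] pr2_unit_map[OF f]
    have "app (pr1 (p \<cdot> f)) (app (unit_map f) a) = app f a"
      "app (pr2 (p \<cdot> f)) (app (unit_map f) a) = a"
      using app_Comp[OF u(1) a, of "pr1 (p \<cdot> f)"] app_Comp[OF u(1) a, of "pr2 (p \<cdot> f)"] u(2,3)
        app_Idt[OF a] by simp_all
    then show ?thesis
      using h_m[OF app_in[OF u(1) a]] app_Comp[OF u(1) a, of h] unit app_Idt[OF a] by simp
  qed
  \<comment> \<open>Evaluate \<open>assoc\<close> at the point \<open>(e, (e', a))\<close> of the
    iterated pullback: one side transports twice, the other forgets \<open>e'\<close>.\<close>
  have m_assoc: "m e (m e' a) = m e a"
    if e: "e \<in> fst E" "app p e = g a" and ea: "e' \<in> fst E" "a \<in> fst A" "app p e' = g a" for e e' a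
  proof -
    have pre': "app (p \<cdot> pr1 (p \<cdot> f)) (pr e' a) = app p e"
      using app_Comp[OF pr1_Hom[OF pf], of "pr e' a" p] pr[OF ea] e ea by simp
    then obtain u where u: "u \<in> fst (apex (p \<cdot> pr1 (p \<cdot> f)))" "app (pr1 (p \<cdot> pr1 (p \<cdot> f))) u = e"
        "app (pr2 (p \<cdot> pr1 (p \<cdot> f))) u = pr e' a"
      using apex_exists[OF ppf e(1)] pr[OF ea] by metis
    have "(p \<cdot> f) \<cdot> h = p \<cdot> pr1 (p \<cdot> f)"
      using Comp_assoc[OF h f p_Hom] fh by simp
    note bc = ppf pf h this
    have "app h (app (base_change (p \<cdot> pr1 (p \<cdot> f)) h (p \<cdot> f)) u) = m e (m e' a)"
      using h_m[OF app_in[OF base_change_Hom[OF bc] u(1)]] u app_pr1_base_change[OF bc u(1)]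
        app_pr2_base_change[OF bc u(1)] by (simp add: m_def)
    moreover have "app h (app (act (p \<cdot> f)) u) = m e a"
      using h_m[OF app_in[OF act_Hom[OF pf] u(1)]] u app_pr1_act[OF pf u(1)] app_pr2_act[OF pf u(1)]
        pr[OF ea] by simp
    ultimately show ?thesis
      using app_Comp[OF base_change_Hom[OF bc] u(1), of h] app_Comp[OF act_Hom[OF pf] u(1), of h] assoc
      by simp
  qed
  have m_mono: "(m e a, m e' a') \<in> snd A" if "(e, e') \<in> snd E" "(a, a') \<in> snd A" "app p e = g a" "app p e' = g a'"
    for e e' a a'
  proof -
    have "e \<in> fst E" "a \<in> fst A" "e' \<in> fst E" "a' \<in> fst A"
      using that ord_carrier[OF E_Obj] ord_carrier[OF A] by blast+
    then have "(pr e a, pr e' a') \<in> snd (apex (p \<cdot> f))"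
      using pr that by (intro apex_le[OF pf]) auto
    then show ?thesis
      unfolding m_def by (rule app_mono[OF h])
  qed
  \<comment> \<open>The section \<open>s\<close> of the map underlying \<open>p\<close> picks one element out of each orbit of the action \<open>m\<close>.\<close>
  define Q where "Q = {a \<in> fst A. app f a = s (g a)}"
  \<comment> \<open>Orbits are compared through some pair of transports. Comparability of these
    already yields \<open>e \<le> e'\<close>, by applying \<open>f\<close>.\<close>
  define R where "R = {(q, q') \<in> Q \<times> Q. \<exists>e\<in>fst E. \<exists>e'\<in>fst E.
    app p e = g q \<and> app p e' = g q' \<and> (m e q, m e' q') \<in> snd A}"
  have QA: "q \<in> fst A" if "q \<in> Q" for q
    using that by (simp add: Q_def)
  have R_carrier: "q \<in> Q" "q' \<in> Q" if "(q, q') \<in> R" for q q'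
    using that by (auto simp: R_def)
  \<comment> \<open>The relation is independent of its witnesses: for any \<open>e \<le> e'\<close>
    over the two base points, \<open>m_mono\<close> carries the comparison from \<open>d\<close>,
    \<open>d'\<close> to \<open>e\<close>, \<open>e'\<close>, and \<open>m_assoc\<close> erases
    \<open>d\<close> and \<open>d'\<close>.\<close>
  have R_m: "(m e q, m e' q') \<in> snd A" if "(q, q') \<in> R" "(e, e') \<in> snd E" "app p e = g q" "app p e' = g q'"
    for e e' q q'
  proof -
    from that(1) obtain d d' where d: "d \<in> fst E" "d' \<in> fst E" "app p d = g q" "app p d' = g q'"
      "(m d q, m d' q') \<in> snd A" and q: "q \<in> fst A" "q' \<in> fst A"
      by (auto simp: R_def QA)
    have "e \<in> fst E" "e' \<in> fst E"
      using ord_carrier[OF E_Obj that(2)] by auto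
    then show ?thesis
      using m_mono[OF that(2) d(5)] m_assoc[of e q d] m_assoc[of e' q' d'] g_m[OF d(1) q(1) d(3)]
        g_m[OF d(2) q(2) d(4)] d q that(3,4) by simp
  qed
  have R_g: "(g q, g q') \<in> snd B" if "(q, q') \<in> R" for q q'
  proof -
    from that obtain d d' where d: "d \<in> fst E" "d' \<in> fst E" "app p d = g q" "app p d' = g q'"
      "(m d q, m d' q') \<in> snd A" and q: "q \<in> fst A" "q' \<in> fst A"
      by (auto simp: R_def QA)
    have "(d, d') \<in> snd E"
      using app_mono[OF f d(5)] f_m[OF d(1) q(1) d(3)] f_m[OF d(2) q(2) d(4)] by simp
    from app_mono[OF p_Hom this] show ?thesis
      using d by simp
  qed
  have R_refl: "(q, q) \<in> R" if q: "q \<in> Q" for q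
  proof -
    have "app p (app f q) = g q" "(m (app f q) q, m (app f q) q) \<in> snd A"
      using m_unit[OF QA[OF q]] ord_refl[OF A QA[OF q]] by (simp_all add: g_def)
    then show ?thesis
      using q fA[OF QA[OF q]] unfolding R_def by blast
  qed
  have R_trans: "(q, q'') \<in> R" if qq': "(q, q') \<in> R" and q'q'': "(q', q'') \<in> R" for q q' q''
  proof -
    \<comment> \<open>Lifting the chain as a whole gives both comparisons the same middle term
      \<open>m e1 q'\<close>, so transitivity in \<open>A\<close> applies. Two separate lifts of
      pairs could have different middle points.\<close>
    obtain e0 e1 e2 where e: "(e0, e1) \<in> snd E" "(e1, e2) \<in> snd E" "app p e0 = g q" "app p e1 = g q'"
        "app p e2 = g q''"
      using chain_lift[OF R_g[OF qq'] R_g[OF q'q'']] by blast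
    have "(m e0 q, m e2 q'') \<in> snd A"
      using ord_trans[OF A R_m[OF qq' e(1,3,4)] R_m[OF q'q'' e(2,4,5)]] .
    then show ?thesis
      using e ord_carrier[OF E_Obj] R_carrier[OF qq'] R_carrier[OF q'q''] unfolding R_def by blast
  qed
  have QR: "(Q, R) \<in> Obj \<C>"
    unfolding PreOrd_Obj preorder_on_def refl_on_def fst_conv snd_conv
  proof (intro conjI ballI transI)
    show "Q \<in> \<U>"
      by (rule subset_small[of "fst A"]) (use A in \<open>auto simp: PreOrd_Obj Q_def\<close>)
    show "R \<subseteq> Q \<times> Q"
      using R_carrier by auto
  qed (fact R_refl, fact R_trans)
  define x where "x = ((Q, R), restrict g (fst (Q, R)), B)"
  have x: "x \<in> Hom \<C> (Q, R) B"
    unfolding x_def using R_g gA[OF QA] by (intro mor_Hom[OF QR B_Obj]) auto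
  have app_x: "app x q = g q" if "q \<in> Q" for q
    using that by (simp add: x_def)
  note px = Comp_Hom[OF pr1_Hom[OF x] p_Hom]
  have apx: "apex x \<in> Obj \<C>"
    using pr1_Hom[OF x] by (simp add: Hom_iff)
  have t_in: "app (pr1 x) t \<in> fst E" "app (pr2 x) t \<in> Q" "app p (app (pr1 x) t) = g (app (pr2 x) t)"
    if t: "t \<in> fst (apex x)" for t
    using app_in[OF pr1_Hom[OF x] t] app_in[OF pr2_Hom[OF x] t] pr_eq[OF x t] app_x by auto
  \<comment> \<open>In elements \<open>(e, q) \<mapsto> m e q\<close>; the inverse sends
    \<open>a\<close> to \<open>(f a, m (s (g a)) a)\<close>.\<close>
  define i where "i = (apex x, restrict (\<lambda>t. m (app (pr1 x) t) (app (pr2 x) t)) (fst (apex x)), A)"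
  have i: "i \<in> Hom \<C> (apex x) A"
    unfolding i_def
  proof (rule mor_Hom[OF apx A])
    fix t t' assume t: "(t, t') \<in> snd (apex x)"
    have tt': "t \<in> fst (apex x)" "t' \<in> fst (apex x)"
      using ord_carrier[OF apx t] by auto
    have "(app (pr2 x) t, app (pr2 x) t') \<in> R"
      using app_mono[OF pr2_Hom[OF x] t] by simp
    from R_m[OF this app_mono[OF pr1_Hom[OF x] t] t_in(3)[OF tt'(1)] t_in(3)[OF tt'(2)]]
    show "(m (app (pr1 x) t) (app (pr2 x) t), m (app (pr1 x) t') (app (pr2 x) t')) \<in> snd A" .
  qed (use t_in QA m_in in blast)
  have app_i: "app i t = m (app (pr1 x) t) (app (pr2 x) t)" if "t \<in> fst (apex x)" for t
    using that by (simp add: i_def)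
  have f_i: "app f (app i t) = app (pr1 x) t" if t: "t \<in> fst (apex x)" for t
    using f_m[OF t_in(1)[OF t] QA[OF t_in(2)[OF t]] t_in(3)[OF t]] app_i[OF t] by simp
  \<comment> \<open>Transport to the chosen point of the fibre returns the second component:
    \<open>q\<close> lies in \<open>Q\<close>, hence over \<open>s (g q)\<close>, and is fixed by
    that transport. This is what makes \<open>i\<close> injective.\<close>
  have recover: "m (s (g (app i t))) (app i t) = app (pr2 x) t" if t: "t \<in> fst (apex x)" for t
  proof -
    define q where "q = app (pr2 x) t"
    have q: "q \<in> fst A" "app f q = s (g q)"
      using t_in(2)[OF t] by (auto simp: Q_def q_def)
    have "g (app i t) = g q"
      using g_m[OF t_in(1)[OF t] _ t_in(3)[OF t]] app_i[OF t] q(1) by (simp add: q_def)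
    then show ?thesis
      using m_assoc[of "s (g q)" q "app (pr1 x) t"] s[OF gA[OF q(1)]] t_in[OF t] q m_unit[OF q(1)]
        app_i[OF t] by (simp add: q_def)
  qed
  have iso: "is_iso \<C> i"
    unfolding is_iso_iff[OF i]
  proof (intro conjI ballI impI)
    show "app i ` fst (apex x) = fst A"
    proof
      show "fst A \<subseteq> app i ` fst (apex x)"
      proof
        fix a assume a: "a \<in> fst A"
        define q where "q = m (s (g a)) a"
        note sa = s[OF gA[OF a]]
        have gq: "g q = g a"
          using g_m[OF sa(1) a sa(2)] by (simp add: q_def)
        have "q \<in> Q"
          using m_in[OF sa(1) a sa(2)] f_m[OF sa(1) a sa(2)] gq by (simp add: Q_def q_def)
        then obtain t where t: "t \<in> fst (apex x)" "app (pr1 x) t = app f a" "app (pr2 x) t = q"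
          using apex_exists[OF x fA[OF a], of q] app_x gq by (auto simp: g_def)
        have "app i t = a"
          using app_i[OF t(1)] t m_assoc[OF fA[OF a] _ sa(1) a sa(2)] m_unit[OF a]
          by (simp add: q_def g_def)
        then show "a \<in> app i ` fst (apex x)"
          using t(1) by blast
      qed
    qed (use app_in[OF i] in blast)
    show "inj_on (app i) (fst (apex x))"
    proof (rule inj_onI)
      fix t t' assume t: "t \<in> fst (apex x)" "t' \<in> fst (apex x)" and "app i t = app i t'"
      then show "t = t'"
        using f_i[OF t(1)] f_i[OF t(2)] recover[OF t(1)] recover[OF t(2)]
        by (intro apex_elem_eqI[OF x t]) simp_all
    qed
    show "(t, t') \<in> snd (apex x)" if t: "t \<in> fst (apex x)" "t' \<in> fst (apex x)"
      and le: "(app i t, app i t') \<in> snd A" for t t'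
    proof (rule apex_le[OF x t])
      show "(app (pr1 x) t, app (pr1 x) t') \<in> snd E"
        using app_mono[OF f le] f_i[OF t(1)] f_i[OF t(2)] by simp
      show "(app (pr2 x) t, app (pr2 x) t') \<in> snd (Q, R)"
        using le t_in[OF t(1)] t_in[OF t(2)] app_i[OF t(1)] app_i[OF t(2)] by (auto simp: R_def)
    qed
  qed
  have fi: "f \<cdot> i = pr1 x"
    by (rule Hom_eqI[OF Comp_Hom[OF i f] pr1_Hom[OF x]]) (simp add: app_Comp[OF i] f_i)
  have "(p \<cdot> f) \<cdot> i = p \<cdot> pr1 x"
    using Comp_assoc[OF i f p_Hom] fi by simp
  note bc = px pf i this
  \<comment> \<open>At \<open>(e, u)\<close> both sides are the transport to \<open>e\<close> of the
    second component of \<open>u\<close>; on the right this takes \<open>m_assoc\<close>.\<close>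
  have "i \<cdot> act x = h \<cdot> base_change (p \<cdot> pr1 x) i (p \<cdot> f)"
  proof (rule Hom_eqI[OF Comp_Hom[OF act_Hom[OF x] i] Comp_Hom[OF base_change_Hom[OF bc] h]])
    fix t assume t: "t \<in> fst (apex (p \<cdot> pr1 x))"
    define e u where "e = app (pr1 (p \<cdot> pr1 x)) t" and "u = app (pr2 (p \<cdot> pr1 x)) t"
    have u: "u \<in> fst (apex x)"
      unfolding u_def by (rule app_in[OF pr2_Hom[OF px] t])
    have e: "e \<in> fst E" "app p e = app p (app (pr1 x) u)"
      using app_in[OF pr1_Hom[OF px] t] pr_eq[OF px t] app_Comp[OF pr1_Hom[OF x] u, of p]
      by (simp_all add: e_def u_def)
    have "app i (app (act x) t) = m e (app (pr2 x) u)"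
      using app_i[OF app_in[OF act_Hom[OF x] t]] app_pr1_act[OF x t] app_pr2_act[OF x t]
      by (simp add: e_def u_def)
    moreover have "app h (app (base_change (p \<cdot> pr1 x) i (p \<cdot> f)) t) = m e (app i u)"
      using h_m[OF app_in[OF base_change_Hom[OF bc] t]] app_pr1_base_change[OF bc t]
        app_pr2_base_change[OF bc t] by (simp add: e_def u_def)
    moreover have "m e (app i u) = m e (app (pr2 x) u)"
      using app_i[OF u] m_assoc[OF e(1) _ t_in(1)[OF u] QA[OF t_in(2)[OF u]] t_in(3)[OF u]]
        e(2) t_in(3)[OF u] by simp
    ultimately show "app (i \<cdot> act x) t = app (h \<cdot> base_change (p \<cdot> pr1 x) i (p \<cdot> f)) t"
      using app_Comp[OF act_Hom[OF x] t, of i] app_Comp[OF base_change_Hom[OF bc] t, of h] by simp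
  qed
  then show ?thesis
    using i iso fi HomD(1,3)[OF x] by blast
qed

lemma effective_descent: "effective_descent \<C> p"
  using comparison_fully_faithful comparison_ess_surj by (rule effective_descentI)

end

section \<open>Coverings and the factorization system\<close>

context small_universe
begin

section \<open>The reflection onto posets, in elements\<close>

lemma
  assumes X: "X \<in> Obj \<C>"
  shows cls_in: "a \<in> fst X \<Longrightarrow> cls (snd X) a \<in> fst X"
    and cls_sim: "a \<in> fst X \<Longrightarrow> (a, cls (snd X) a) \<in> snd X \<and> (cls (snd X) a, a) \<in> snd X"
    and cls_eq_iff: "a \<in> fst X \<Longrightarrow> b \<in> fst X \<Longrightarrow>
      cls (snd X) a = cls (snd X) b \<longleftrightarrow> (a, b) \<in> snd X \<and> (b, a) \<in> snd X"
proof -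
  show sim: "(a, cls (snd X) a) \<in> snd X \<and> (cls (snd X) a, a) \<in> snd X" if "a \<in> fst X" for a
  proof -
    have "a \<in> sim (snd X) `` {a}"
      using ord_refl[OF X that] by (simp add: sim_def)
    then have "cls (snd X) a \<in> sim (snd X) `` {a}"
      unfolding cls_def by (rule someI)
    then show ?thesis by (simp add: sim_def)
  qed
  show "cls (snd X) a \<in> fst X" if "a \<in> fst X" for a
    using sim[OF that] ord_carrier[OF X] by blast
  show "cls (snd X) a = cls (snd X) b \<longleftrightarrow> (a, b) \<in> snd X \<and> (b, a) \<in> snd X"
    if ab: "a \<in> fst X" "b \<in> fst X" for a b
  proof
    assume "cls (snd X) a = cls (snd X) b"
    then show "(a, b) \<in> snd X \<and> (b, a) \<in> snd X"
      using sim[OF ab(1)] sim[OF ab(2)] ord_trans[OF X] by metis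
  next
    assume "(a, b) \<in> snd X \<and> (b, a) \<in> snd X"
    then have "sim (snd X) `` {a} = sim (snd X) `` {b}"
      using ord_trans[OF X] by (auto simp: sim_def)
    then show "cls (snd X) a = cls (snd X) b"
      by (simp add: cls_def)
  qed
qed

lemma refl_obj_simps:
  "fst (refl_obj X) = cls (snd X) ` fst X"
  "snd (refl_obj X) = {(cls (snd X) a, cls (snd X) a') | a a'. (a, a') \<in> snd X}"
  by (simp_all add: refl_obj_def split_def)

text \<open>The order of the reflection asks for some related representatives; by transitivity
  equivalent elements have the same relations, so any representatives decide it.\<close>

lemma refl_le_iff:
  assumes X: "X \<in> Obj \<C>" and ab: "a \<in> fst X" "b \<in> fst X"
  shows "(cls (snd X) a, cls (snd X) b) \<in> snd (refl_obj X) \<longleftrightarrow> (a, b) \<in> snd X"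
proof
  assume "(cls (snd X) a, cls (snd X) b) \<in> snd (refl_obj X)"
  then obtain a' b' where *: "(a', b') \<in> snd X" "cls (snd X) a = cls (snd X) a'"
      "cls (snd X) b = cls (snd X) b'"
    by (auto simp: refl_obj_simps)
  then have "(a, a') \<in> snd X" "(b', b) \<in> snd X"
    using cls_eq_iff[OF X ab(1), of a'] cls_eq_iff[OF X ab(2), of b'] ord_carrier[OF X *(1)] by auto
  then show "(a, b) \<in> snd X"
    using *(1) ord_trans[OF X] by blast
qed (auto simp: refl_obj_simps)

lemma refl_obj_ParOrd: assumes X: "X \<in> Obj \<C>" shows "refl_obj X \<in> Obj (ParOrd \<U>)"
  unfolding ParOrd_Obj partial_order_on_def preorder_on_def
proof (intro conjI)
  show "fst (refl_obj X) \<in> \<U>"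
    using X by (simp add: refl_obj_simps PreOrd_Obj image_small)
  show "snd (refl_obj X) \<subseteq> fst (refl_obj X) \<times> fst (refl_obj X)"
    using ord_carrier[OF X] by (auto simp: refl_obj_simps)
  show "refl_on (fst (refl_obj X)) (snd (refl_obj X))"
    unfolding refl_on_def using refl_le_iff[OF X] ord_refl[OF X] by (auto simp: refl_obj_simps(1))
  have car: "x \<in> cls (snd X) ` fst X" "y \<in> cls (snd X) ` fst X" if "(x, y) \<in> snd (refl_obj X)" for x y
    using that ord_carrier[OF X] by (auto simp: refl_obj_simps)
  show "trans (snd (refl_obj X))"
  proof (rule transI)
    fix x y z assume xy: "(x, y) \<in> snd (refl_obj X)" and yz: "(y, z) \<in> snd (refl_obj X)"
    then obtain a b c where "a \<in> fst X" "b \<in> fst X" "c \<in> fst X"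
      "x = cls (snd X) a" "y = cls (snd X) b" "z = cls (snd X) c"
      using car[OF xy] car[OF yz] by auto
    then show "(x, z) \<in> snd (refl_obj X)"
      using xy yz ord_trans[OF X, of a b c] by (simp add: refl_le_iff[OF X])
  qed
  show "antisym (snd (refl_obj X))"
  proof (rule antisymI)
    fix x y assume xy: "(x, y) \<in> snd (refl_obj X)" and yx: "(y, x) \<in> snd (refl_obj X)"
    then obtain a b where "a \<in> fst X" "b \<in> fst X" "x = cls (snd X) a" "y = cls (snd X) b"
      using car[OF xy] by auto
    then show "x = y"
      using xy yx by (simp add: refl_le_iff[OF X] cls_eq_iff[OF X])
  qed
qed

lemma ParOrd_PreOrd_Obj: "X \<in> Obj (ParOrd \<U>) \<Longrightarrow> X \<in> Obj \<C>"
  by (simp add: ParOrd_Obj PreOrd_Obj partial_order_on_def)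

lemma ParOrd_PreOrd_Hom: "f \<in> Hom (ParOrd \<U>) X Y \<Longrightarrow> f \<in> Hom \<C> X Y"
  by (simp add: Hom_iff par.Hom_iff ParOrd_PreOrd_Obj)

lemma refl_unit_Hom:
  assumes X: "X \<in> Obj \<C>"
  shows "refl_unit X \<in> Hom \<C> X (refl_obj X)"
  unfolding refl_unit_def
  by (rule mor_Hom[OF X ParOrd_PreOrd_Obj[OF refl_obj_ParOrd[OF X]]]) (auto simp: refl_obj_simps)

lemma app_refl_unit: "x \<in> fst X \<Longrightarrow> app (refl_unit X) x = cls (snd X) x"
  by (simp add: refl_unit_def)

text \<open>The reflector evaluates \<open>f\<close> at the chosen representative of a class.
  Monotone maps preserve equivalence, so the class of the value does not depend on that
  choice.\<close>

lemma
  assumes f: "f \<in> Hom \<C> X Y"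
  shows reflector_Hom: "FArr reflector f \<in> Hom (ParOrd \<U>) (refl_obj X) (refl_obj Y)"
    and app_reflector: "x \<in> fst X \<Longrightarrow> app (FArr reflector f) (cls (snd X) x) = cls (snd Y) (app f x)"
proof -
  have X: "X \<in> Obj \<C>" and Y: "Y \<in> Obj \<C>"
    using f by (auto simp: Hom_iff)
  have F: "FArr reflector f =
      (refl_obj X, restrict (\<lambda>x. cls (snd Y) (app f x)) (fst (refl_obj X)), refl_obj Y)"
    using f by (auto simp: reflector_def Hom_iff split_def)
  show "FArr reflector f \<in> Hom (ParOrd \<U>) (refl_obj X) (refl_obj Y)"
    unfolding F
  proof (rule par.mor_Hom[OF refl_obj_ParOrd[OF X] refl_obj_ParOrd[OF Y]])
    show "cls (snd Y) (app f x) \<in> fst (refl_obj Y)" if "x \<in> fst (refl_obj X)" for x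
      using that app_in[OF f cls_in[OF X]] by (auto simp: refl_obj_simps)
    fix x x' assume xx': "(x, x') \<in> snd (refl_obj X)"
    then obtain a a' where a: "a \<in> fst X" "a' \<in> fst X" "(a, a') \<in> snd X"
      "x = cls (snd X) a" "x' = cls (snd X) a'"
      using ord_carrier[OF X] by (auto simp: refl_obj_simps)
    then have "(x, x') \<in> snd X"
      using cls_sim[OF X a(1)] cls_sim[OF X a(2)] ord_trans[OF X] by blast
    from app_mono[OF f this]
    show "(cls (snd Y) (app f x), cls (snd Y) (app f x')) \<in> snd (refl_obj Y)"
      by (auto simp: refl_obj_simps)
  qed
  show "app (FArr reflector f) (cls (snd X) x) = cls (snd Y) (app f x)" if x: "x \<in> fst X"
  proof -
    have "app (FArr reflector f) (cls (snd X) x) = cls (snd Y) (app f (cls (snd X) x))"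
      using x by (simp add: F refl_obj_simps)
    also have "\<dots> = cls (snd Y) (app f x)"
      using cls_sim[OF X x] app_mono[OF f] app_in[OF f] cls_in[OF X x] x by (simp add: cls_eq_iff[OF Y])
    finally show ?thesis .
  qed
qed

text \<open>Through \<open>cls\<close>, surjectivity of the reflected map becomes meeting every
  equivalence class. Its injectivity follows from order reflection, because two classes are equal
  exactly when their members are comparable both ways.\<close>

lemma E_class_iff:
  assumes f: "f \<in> Hom \<C> X Y"
  shows "f \<in> E_class \<U> \<longleftrightarrow>
    (\<forall>a\<in>fst X. \<forall>a'\<in>fst X. (app f a, app f a') \<in> snd Y \<longrightarrow> (a, a') \<in> snd X) \<and>
    (\<forall>b\<in>fst Y. \<exists>a\<in>fst X. (app f a, b) \<in> snd Y \<and> (b, app f a) \<in> snd Y)"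
proof -
  have X: "X \<in> Obj \<C>" and Y: "Y \<in> Obj \<C>"
    using f by (auto simp: Hom_iff)
  let ?F = "app (FArr reflector f)"
  have F: "?F (cls (snd X) a) = cls (snd Y) (app f a)" if "a \<in> fst X" for a
    by (rule app_reflector[OF f that])
  have "f \<in> E_class \<U> \<longleftrightarrow> is_iso (ParOrd \<U>) (FArr reflector f)"
    using HomD[OF f] by (simp add: E_class_def inverted_by_def)
  also have "\<dots> \<longleftrightarrow> ?F ` fst (refl_obj X) = fst (refl_obj Y) \<and>
      (\<forall>a\<in>fst X. \<forall>a'\<in>fst X. (app f a, app f a') \<in> snd Y \<longrightarrow> (a, a') \<in> snd X) \<and>
      inj_on ?F (fst (refl_obj X))"
    unfolding par.is_iso_iff[OF reflector_Hom[OF f]]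
    by (simp add: refl_obj_simps(1) F refl_le_iff[OF X] refl_le_iff[OF Y] app_in[OF f])
  also have "?F ` fst (refl_obj X) = fst (refl_obj Y) \<longleftrightarrow>
      (\<forall>b\<in>fst Y. \<exists>a\<in>fst X. (app f a, b) \<in> snd Y \<and> (b, app f a) \<in> snd Y)"
  proof
    assume eq: "?F ` fst (refl_obj X) = fst (refl_obj Y)"
    show "\<forall>b\<in>fst Y. \<exists>a\<in>fst X. (app f a, b) \<in> snd Y \<and> (b, app f a) \<in> snd Y"
    proof
      fix b assume b: "b \<in> fst Y"
      then have "cls (snd Y) b \<in> ?F ` fst (refl_obj X)"
        using eq by (simp add: refl_obj_simps)
      then obtain a where a: "a \<in> fst X" "cls (snd Y) b = cls (snd Y) (app f a)"
        using F by (auto simp: refl_obj_simps(1))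
      then show "\<exists>a\<in>fst X. (app f a, b) \<in> snd Y \<and> (b, app f a) \<in> snd Y"
        using cls_eq_iff[OF Y b app_in[OF f a(1)]] by blast
    qed
  next
    assume ex: "\<forall>b\<in>fst Y. \<exists>a\<in>fst X. (app f a, b) \<in> snd Y \<and> (b, app f a) \<in> snd Y"
    show "?F ` fst (refl_obj X) = fst (refl_obj Y)"
    proof
      show "fst (refl_obj Y) \<subseteq> ?F ` fst (refl_obj X)"
      proof
        fix y assume "y \<in> fst (refl_obj Y)"
        then obtain b where b: "b \<in> fst Y" "y = cls (snd Y) b"
          by (auto simp: refl_obj_simps)
        obtain a where a: "a \<in> fst X" "(app f a, b) \<in> snd Y" "(b, app f a) \<in> snd Y"
          using ex b(1) by blast
        then have "y = ?F (cls (snd X) a)"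
          using F[OF a(1)] cls_eq_iff[OF Y b(1) app_in[OF f a(1)]] b(2) by simp
        then show "y \<in> ?F ` fst (refl_obj X)"
          using a(1) by (simp add: refl_obj_simps)
      qed
    qed (use app_in[OF ParOrd_PreOrd_Hom[OF reflector_Hom[OF f]]] in blast)
  qed
  also have "(\<forall>a\<in>fst X. \<forall>a'\<in>fst X. (app f a, app f a') \<in> snd Y \<longrightarrow> (a, a') \<in> snd X) \<Longrightarrow>
      inj_on ?F (fst (refl_obj X))"
    by (rule inj_onI) (auto simp: refl_obj_simps(1) F cls_eq_iff[OF Y] cls_eq_iff[OF X] app_in[OF f])
  ultimately show ?thesis
    by blast
qed

section \<open>Fully faithful surjections as the stably inverted morphisms\<close>

lemma E_bar_iff:
  assumes f: "f \<in> Hom \<C> X Y"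
  shows "f \<in> E_bar \<U> \<longleftrightarrow> app f ` fst X = fst Y \<and>
    (\<forall>a\<in>fst X. \<forall>a'\<in>fst X. (app f a, app f a') \<in> snd Y \<longrightarrow> (a, a') \<in> snd X)"
proof -
  have "surjective f \<longleftrightarrow> app f ` fst X = fst Y"
    "fully_faithful f \<longleftrightarrow> (\<forall>a\<in>fst X. \<forall>a'\<in>fst X. (a, a') \<in> snd X \<longleftrightarrow> (app f a, app f a') \<in> snd Y)"
    using f by (auto simp: surjective_def fully_faithful_def split_beta Hom_iff)
  then show ?thesis
    using HomD[OF f] app_mono[OF f] by (auto simp: E_bar_def)
qed

lemma is_pullback_Hom:
  assumes "is_pullback C q r g f" "f \<in> Hom C X Y"
  shows "q \<in> Hom C (Dom C q) (Dom C g)" "r \<in> Hom C (Dom C q) X" "g \<in> Hom C (Dom C g) Y"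
  using assms by (auto simp: is_pullback_def Hom_def)

text \<open>Membership in \<open>E_class\<close> only makes \<open>f\<close> meet every equivalence
  class. Pulling back along a single point separates \<open>b\<close> from the elements equivalent
  to it and so yields surjectivity; pulling back along the identity of \<open>Y\<close> yields full
  faithfulness. Conversely, both properties survive every pullback.\<close>

lemma E_bar_eq_E_stable: "E_bar \<U> = E_stable \<U>"
proof (intro equalityI subsetI)
  fix f assume fE: "f \<in> E_bar \<U>"
  then have "f \<in> Arr \<C>"
    by (simp add: E_bar_def)
  then obtain X Y where f: "f \<in> Hom \<C> X Y"
    by (rule that[OF Arr_Hom])
  note fE = fE[unfolded E_bar_iff[OF f]]
  have "q \<in> E_class \<U>" if pb: "is_pullback \<C> q r g f" for q r g
  proof -
    obtain W T where q: "q \<in> Hom \<C> W T" and r: "r \<in> Hom \<C> W X" and g: "g \<in> Hom \<C> T Y"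
      using is_pullback_Hom[OF pb f] by blast
    have T: "T \<in> Obj \<C>"
      using q by (simp add: Hom_iff)
    note pt = pb[unfolded is_pullback_iff[OF q r g f] ptwise_pullback_def HomD[OF q] HomD[OF g] HomD[OF f]]
    show ?thesis
      unfolding E_class_iff[OF q]
    proof (intro conjI ballI impI)
      fix w w' assume w: "w \<in> fst W" "w' \<in> fst W" and le: "(app q w, app q w') \<in> snd T"
      have "(app f (app r w), app f (app r w')) \<in> snd Y"
        using app_mono[OF g le] pt w by simp
      then have "(app r w, app r w') \<in> snd X"
        using fE app_in[OF r] w by blast
      then show "(w, w') \<in> snd W"
        using pt w le by blast
    next
      fix t assume t: "t \<in> fst T"
      obtain a where "a \<in> fst X" "app g t = app f a"
        using fE app_in[OF g t] by (metis imageE)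
      then obtain w where "w \<in> fst W" "app q w = t"
        using pt t by metis
      then show "\<exists>w\<in>fst W. (app q w, t) \<in> snd T \<and> (t, app q w) \<in> snd T"
        using ord_refl[OF T t] by blast
    qed
  qed
  then show "f \<in> E_stable \<U>"
    using HomD(1)[OF f] unfolding E_stable_def stably_in_def by blast
next
  fix f assume fE: "f \<in> E_stable \<U>"
  then have "f \<in> Arr \<C>"
    by (simp add: E_stable_def stably_in_def)
  then obtain X Y where f: "f \<in> Hom \<C> X Y"
    by (rule that[OF Arr_Hom])
  have X: "X \<in> Obj \<C>" and Y: "Y \<in> Obj \<C>"
    using f by (auto simp: Hom_iff)
  have "\<forall>q r g. is_pullback \<C> q r g f \<longrightarrow> q \<in> E_class \<U>"
    using fE by (simp add: E_stable_def stably_in_def del: split_paired_All)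
  note stable = this[rule_format]
  note idX = Idt_Hom[OF category X] and idY = Idt_Hom[OF category Y]
  have "ptwise_pullback f (Idt \<C> X) (Idt \<C> Y) f"
    unfolding ptwise_pullback_def HomD[OF f] HomD[OF idY]
  proof (intro conjI ballI impI)
    fix y x assume y: "y \<in> fst Y" and x: "x \<in> fst X" and eq: "app (Idt \<C> Y) y = app f x"
    show "\<exists>!w. w \<in> fst X \<and> app f w = y \<and> app (Idt \<C> X) w = x"
    proof (rule ex1I[of _ x])
      show "x \<in> fst X \<and> app f x = y \<and> app (Idt \<C> X) x = x"
        using x eq app_Idt[OF x] app_Idt[OF y] by simp
      fix w assume "w \<in> fst X \<and> app f w = y \<and> app (Idt \<C> X) w = x"
      then show "w = x"
        using app_Idt[of w X] by simp
    qed
  qed (simp_all add: app_Idt app_in[OF f])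
  then have "is_pullback \<C> f (Idt \<C> X) (Idt \<C> Y) f"
    by (rule ptwise_is_pullback[OF f idX idY f])
  from stable[OF this] have ff: "(a, a') \<in> snd X"
    if "a \<in> fst X" "a' \<in> fst X" "(app f a, app f a') \<in> snd Y" for a a'
    using that unfolding E_class_iff[OF f] by blast
  have "\<exists>a\<in>fst X. app f a = b" if b: "b \<in> fst Y" for b
  proof -
    \<comment> \<open>A one-element object placed at \<open>b\<close>: its pullback consists of the
      fibre of \<open>f\<close> over \<open>b\<close>, and meeting the only class of
      \<open>T\<close> says that this fibre is nonempty.\<close>
    define T where "T = ({b}, {(b, b)})"
    have T: "T \<in> Obj \<C>"
      using Y b subset_small[of "fst Y" "{b}"]
      by (auto simp: T_def PreOrd_Obj preorder_on_def refl_on_def trans_def)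
    define g where "g = (T, restrict (\<lambda>t. t) (fst T), Y)"
    have g: "g \<in> Hom \<C> T Y"
      unfolding g_def using b ord_refl[OF Y b] by (intro mor_Hom[OF T Y]) (auto simp: T_def)
    obtain W q r where q: "q \<in> Hom \<C> W T" and r: "r \<in> Hom \<C> W X" and pt: "ptwise_pullback q r g f"
      using ptwise_pullback_exists[OF g f] by blast
    have "q \<in> E_class \<U>"
      by (rule stable[OF ptwise_is_pullback[OF q r g f pt]])
    then obtain w where w: "w \<in> fst W"
      using E_class_iff[OF q] by (auto simp: T_def)
    have "app f (app r w) = app g (app q w)"
      using pt w HomD[OF q] by (simp add: ptwise_pullback_def)
    also have "\<dots> = b"
      using app_in[OF q w] by (simp add: g_def T_def)
    finally show ?thesis
      using app_in[OF r w] by blast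
  qed
  then have "app f ` fst X = fst Y"
    using app_in[OF f] by (auto simp: image_iff)
  then show "f \<in> E_bar \<U>"
    using ff unfolding E_bar_iff[OF f] by blast
qed

section \<open>Trivial coverings and coverings\<close>

lemma M_class_iff:
  assumes g: "g \<in> Hom \<C> X Y"
  shows "g \<in> M_class \<U> \<longleftrightarrow> ptwise_pullback (refl_unit X) g (FArr reflector g) (refl_unit Y)"
proof -
  have "X \<in> Obj \<C>" "Y \<in> Obj \<C>"
    using g by (auto simp: Hom_iff)
  then show ?thesis
    using is_pullback_iff[OF refl_unit_Hom g ParOrd_PreOrd_Hom[OF reflector_Hom[OF g]] refl_unit_Hom]
      HomD[OF g] by (simp add: M_class_def trivial_coverings_def inclusion_def)
qed

text \<open>The elements \<open>x\<close> and \<open>x'\<close> have the same class and the same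
  image under \<open>g\<close>, so they have equal projections in a pullback.\<close>

lemma M_class_inj:
  assumes g: "g \<in> Hom \<C> X Y" and M: "g \<in> M_class \<U>"
    and x: "(x, x') \<in> snd X" "(x', x) \<in> snd X" "app g x = app g x'"
  shows "x = x'"
proof -
  have X: "X \<in> Obj \<C>" and Y: "Y \<in> Obj \<C>"
    using g by (auto simp: Hom_iff)
  have xX: "x \<in> fst X" "x' \<in> fst X"
    using ord_carrier[OF X x(1)] by auto
  note F = ParOrd_PreOrd_Hom[OF reflector_Hom[OF g]]
  note pt = M[unfolded M_class_iff[OF g] ptwise_pullback_def HomD[OF refl_unit_Hom[OF X]] HomD[OF F]
      HomD[OF refl_unit_Hom[OF Y]]]
  have eq: "app (refl_unit X) x = app (refl_unit X) x'"
    using x xX cls_eq_iff[OF X xX] by (simp add: app_refl_unit)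
  have "app (FArr reflector g) (app (refl_unit X) x) = app (refl_unit Y) (app g x)"
    using pt xX(1) by blast
  then have "\<exists>!w. w \<in> fst X \<and> app (refl_unit X) w = app (refl_unit X) x \<and> app g w = app g x"
    using pt app_in[OF refl_unit_Hom[OF X] xX(1)] app_in[OF g xX(1)] by blast
  then show ?thesis
    using eq x(3) xX by metis
qed

text \<open>The unit at a poset is an isomorphism, so the naturality square has isomorphisms on two
  opposite sides and is a pullback.\<close>

lemma M_classI_antisym:
  assumes g: "g \<in> Hom \<C> X Y" and aX: "antisym (snd X)" and aY: "antisym (snd Y)"
  shows "g \<in> M_class \<U>"
proof -
  have X: "X \<in> Obj \<C>" and Y: "Y \<in> Obj \<C>"
    using g by (auto simp: Hom_iff)
  have inj: "a = b" if "Z \<in> Obj \<C>" "antisym (snd Z)" "a \<in> fst Z" "b \<in> fst Z" "cls (snd Z) a = cls (snd Z) b" for Z a b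
    using that cls_eq_iff[OF that(1,3,4)] by (auto dest: antisymD)
  note F = ParOrd_PreOrd_Hom[OF reflector_Hom[OF g]]
  show ?thesis
    unfolding M_class_iff[OF g] ptwise_pullback_def HomD[OF refl_unit_Hom[OF X]] HomD[OF F]
      HomD[OF refl_unit_Hom[OF Y]]
  proof (intro conjI ballI impI)
    show "app (FArr reflector g) (app (refl_unit X) x) = app (refl_unit Y) (app g x)" if "x \<in> fst X" for x
      using that app_in[OF g that] by (simp add: app_refl_unit app_reflector[OF g])
    show "(x, x') \<in> snd X" if "x \<in> fst X" "x' \<in> fst X"
      "(app (refl_unit X) x, app (refl_unit X) x') \<in> snd (refl_obj X)" for x x'
      using that by (simp add: app_refl_unit refl_le_iff[OF X])
  next
    fix z y assume z: "z \<in> fst (refl_obj X)" and y: "y \<in> fst Y"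
      and eq: "app (FArr reflector g) z = app (refl_unit Y) y"
    obtain x where x: "x \<in> fst X" "z = cls (snd X) x"
      using z by (auto simp: refl_obj_simps)
    have "cls (snd Y) (app g x) = cls (snd Y) y"
      using eq x y by (simp add: app_refl_unit app_reflector[OF g])
    then have gx: "app g x = y"
      by (rule inj[OF Y aY app_in[OF g x(1)] y])
    show "\<exists>!w. w \<in> fst X \<and> app (refl_unit X) w = z \<and> app g w = y"
    proof (rule ex1I[of _ x])
      fix w assume w: "w \<in> fst X \<and> app (refl_unit X) w = z \<and> app g w = y"
      then have "cls (snd X) w = cls (snd X) x"
        using x(2) by (metis app_refl_unit)
      then show "w = x"
        using w by (intro inj[OF X aX _ x(1)]) simp_all
    qed (use x gx in \<open>simp add: app_refl_unit\<close>)
  qed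
qed

text \<open>On \<open>B \<times> \<nat>\<close>, requiring distinct related elements to have strictly increasing
  second components destroys all nontrivial equivalences but no chain of \<open>B\<close>.\<close>

lemma poset_cover:
  assumes B: "B \<in> Obj \<C>"
  shows "\<exists>p Z. p \<in> Hom \<C> Z B \<and> antisym (snd Z) \<and> effective_descent \<C> p"
proof -
  define S where "S = fst B \<times> (UNIV :: nat set)"
  define R where "R = {((b, i :: nat), (b', j :: nat)). b \<in> fst B \<and> b' \<in> fst B \<and>
    ((b, i) = (b', j) \<or> i < j \<and> (b, b') \<in> snd B)}"
  have "is_small S"
    unfolding S_def by (rule is_small_Times[OF is_small_member is_small_nat]) (use B in \<open>simp add: PreOrd_Obj\<close>)
  moreover have "preorder_on S R"
    unfolding preorder_on_def refl_on_def trans_def R_def S_def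
    using ord_trans[OF B] by (auto intro: less_trans)
  ultimately obtain Z e where Z: "Z \<in> Obj \<C>" and e: "bij_betw e S (fst Z)"
    and iff: "\<And>x y. x \<in> S \<Longrightarrow> y \<in> S \<Longrightarrow> (e x, e y) \<in> snd Z \<longleftrightarrow> (x, y) \<in> R"
    by (rule small_preorder_realization) auto
  have rep: "\<exists>x\<in>S. z = e x" if "z \<in> fst Z" for z
    using e that by (auto simp: bij_betw_def)
  have "antisym (snd Z)"
  proof (rule antisymI)
    fix z z' assume zz': "(z, z') \<in> snd Z" "(z', z) \<in> snd Z"
    then obtain x x' where x: "x \<in> S" "x' \<in> S" "z = e x" "z' = e x'"
      using rep ord_carrier[OF Z] by metis
    then have "(x, x') \<in> R" "(x', x) \<in> R"
      using zz' iff by auto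
    \<comment> \<open>Distinct elements related both ways would have second components
      \<open>i < j\<close> and \<open>j < i\<close>.\<close>
    then show "z = z'"
      using x by (auto simp: R_def)
  qed
  define p where "p = (Z, restrict (\<lambda>z. fst (inv_into S e z)) (fst Z), B)"
  have pe: "fst (inv_into S e (e x)) = fst x" if "x \<in> S" for x
    using bij_betw_inv_into_left[OF e that] by simp
  have p: "p \<in> Hom \<C> Z B"
    unfolding p_def
  proof (rule mor_Hom[OF Z B])
    show "fst (inv_into S e z) \<in> fst B" if "z \<in> fst Z" for z
      using rep[OF that] pe by (auto simp: S_def)
    fix z z' assume zz': "(z, z') \<in> snd Z"
    then obtain x x' where x: "x \<in> S" "x' \<in> S" "z = e x" "z' = e x'"
      using rep ord_carrier[OF Z] by metis
    then have "(x, x') \<in> R"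
      using zz' iff by auto
    then have "(fst x, fst x') \<in> snd B"
      using ord_refl[OF B] by (auto simp: R_def)
    then show "(fst (inv_into S e z), fst (inv_into S e z')) \<in> snd B"
      using x pe by simp
  qed
  have app_p: "app p (e x) = fst x" if "x \<in> S" for x
    using that e pe by (auto simp: p_def bij_betw_def)
  interpret pullbacks_along \<C> p
    by (rule pullbacks_along_arrow[OF HomD(1)[OF p]])
  interpret chain_lifting \<U> p
  proof
    fix b0 b1 b2 assume b: "(b0, b1) \<in> snd (Cod \<C> p)" "(b1, b2) \<in> snd (Cod \<C> p)"
    then have b': "(b0, b1) \<in> snd B" "(b1, b2) \<in> snd B" "b0 \<in> fst B" "b1 \<in> fst B" "b2 \<in> fst B"
      using HomD[OF p] ord_carrier[OF B] by auto
    \<comment> \<open>Levels 0, 1 and 2 increase strictly, so the chain lifts even when some of its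
      elements are equal or equivalent.\<close>
    then have S: "(b0, 0) \<in> S" "(b1, 1) \<in> S" "(b2, 2) \<in> S"
      by (auto simp: S_def)
    have "((b0, 0), (b1, 1)) \<in> R" "((b1, 1), (b2, 2)) \<in> R"
      using b' by (auto simp: R_def)
    then show "\<exists>e0 e1 e2. (e0, e1) \<in> snd (Dom \<C> p) \<and> (e1, e2) \<in> snd (Dom \<C> p) \<and>
        app p e0 = b0 \<and> app p e1 = b1 \<and> app p e2 = b2"
      unfolding HomD[OF p] using S iff app_p by (metis fst_conv)
  qed
  show ?thesis
    using p \<open>antisym (snd Z)\<close> effective_descent by blast
qed

lemma M_star_iff:
  assumes f: "f \<in> Hom \<C> X Y"
  shows "f \<in> M_star \<U> \<longleftrightarrow>
    (\<forall>a a'. (a, a') \<in> snd X \<longrightarrow> (a', a) \<in> snd X \<longrightarrow> app f a = app f a' \<longrightarrow> a = a')"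
proof
  have X: "X \<in> Obj \<C>" and Y: "Y \<in> Obj \<C>"
    using f by (auto simp: Hom_iff)
  {
    assume "f \<in> M_star \<U>"
    then obtain p where p: "effective_descent \<C> p" "Cod \<C> p = Y" "pb1 \<C> p f \<in> M_class \<U>"
      using HomD[OF f] by (auto simp: M_star_def coverings_def)
    have pA: "p \<in> Arr \<C>"
      using p(1) by (simp add: effective_descent_def)
    interpret pullbacks_along \<C> p
      by (rule pullbacks_along_arrow[OF pA])
    interpret small_pullbacks \<U> p ..
    have f': "f \<in> Hom \<C> X B"
      using f p(2) by simp
    show "\<forall>a a'. (a, a') \<in> snd X \<longrightarrow> (a', a) \<in> snd X \<longrightarrow> app f a = app f a' \<longrightarrow> a = a'"
    proof (intro allI impI)
      fix a a' assume a: "(a, a') \<in> snd X" "(a', a) \<in> snd X" "app f a = app f a'"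
      have aX: "a \<in> fst X" "a' \<in> fst X"
        using ord_carrier[OF X a(1)] by auto
      have "app f a \<in> app p ` fst E"
        using app_in[OF f aX(1)] effective_descent_surj[OF p(1)] p(2) by simp
      then obtain e where e: "e \<in> fst E" "app p e = app f a"
        by auto
      \<comment> \<open>The points \<open>(e, a)\<close> and \<open>(e, a')\<close> share one
        \<open>e\<close> over \<open>f a = f a'\<close>. They are equivalent in the pullback and
        have the same image in \<open>E\<close>, so a trivial covering identifies them.\<close>
      obtain t where t: "t \<in> fst (apex f)" "app (pr1 f) t = e" "app (pr2 f) t = a"
        using apex_exists[OF f' e(1) aX(1) e(2)] by blast
      obtain t' where t': "t' \<in> fst (apex f)" "app (pr1 f) t' = e" "app (pr2 f) t' = a'"
        using apex_exists[OF f' e(1) aX(2)] e(2) a(3) by auto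
      have "E \<in> Obj \<C>"
        using p_Hom by (simp add: Hom_iff)
      then have "(e, e) \<in> snd E"
        using e(1) by (rule ord_refl)
      then have "(t, t') \<in> snd (apex f)" "(t', t) \<in> snd (apex f)"
        using apex_le[OF f' t(1) t'(1)] apex_le[OF f' t'(1) t(1)] t t' a by auto
      then have "t = t'"
        using M_class_inj[OF pr1_Hom[OF f'] p(3)] t t' by simp
      then show "a = a'"
        using t t' by simp
    qed
  next
    assume inj: "\<forall>a a'. (a, a') \<in> snd X \<longrightarrow> (a', a) \<in> snd X \<longrightarrow> app f a = app f a' \<longrightarrow> a = a'"
    obtain p Z where p: "p \<in> Hom \<C> Z Y" "antisym (snd Z)" "effective_descent \<C> p"
      using poset_cover[OF Y] by blast
    interpret pullbacks_along \<C> p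
      by (rule pullbacks_along_arrow[OF HomD(1)[OF p(1)]])
    interpret small_pullbacks \<U> p ..
    have f': "f \<in> Hom \<C> X B"
      using f HomD[OF p(1)] by simp
    have aE: "antisym (snd E)"
      using p(2) HomD[OF p(1)] by simp
    have ap: "apex f \<in> Obj \<C>"
      using pr1_Hom[OF f'] by (simp add: Hom_iff)
    have "antisym (snd (apex f))"
    proof (rule antisymI)
      fix t t' assume t: "(t, t') \<in> snd (apex f)" "(t', t) \<in> snd (apex f)"
      have tt': "t \<in> fst (apex f)" "t' \<in> fst (apex f)"
        using ord_carrier[OF ap t(1)] by auto
      \<comment> \<open>Equivalent points have equal first components because \<open>E\<close> is a
        poset. Their second components are then equivalent with equal images under \<open>f\<close>,
        hence equal by \<open>inj\<close>.\<close>
      have 1: "app (pr1 f) t = app (pr1 f) t'"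
        using app_mono[OF pr1_Hom[OF f'] t(1)] app_mono[OF pr1_Hom[OF f'] t(2)] aE
        by (blast dest: antisymD)
      have "app f (app (pr2 f) t) = app f (app (pr2 f) t')"
        using pr_eq[OF f' tt'(1)] pr_eq[OF f' tt'(2)] 1 by simp
      then have "app (pr2 f) t = app (pr2 f) t'"
        using app_mono[OF pr2_Hom[OF f'] t(1)] app_mono[OF pr2_Hom[OF f'] t(2)] inj by blast
      with 1 show "t = t'"
        by (rule apex_elem_eqI[OF f' tt'])
    qed
    then have "pr1 f \<in> M_class \<U>"
      using M_classI_antisym[OF pr1_Hom[OF f']] aE by blast
    then show "f \<in> M_star \<U>"
      unfolding M_star_def coverings_def
      by (intro CollectI conjI exI[of _ p]) (simp_all add: p(3) HomD[OF p(1)] HomD[OF f])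
  }
qed

section \<open>The factorization system\<close>

lemma E_bar_closed: "closed_under_isos \<C> (E_bar \<U>)"
  unfolding closed_under_isos_def
proof (intro ballI allI impI conjI)
  fix f i assume fE: "f \<in> E_bar \<U>" and i: "is_iso \<C> i"
  then have "f \<in> Arr \<C>" "i \<in> Arr \<C>"
    by (auto simp: E_bar_def is_iso_def)
  then obtain X Y V W where f: "f \<in> Hom \<C> X Y" and iH: "i \<in> Hom \<C> V W"
    using Arr_Hom by metis
  note fE = fE[unfolded E_bar_iff[OF f]] and i = i[unfolded is_iso_iff[OF iH]]
  show "Comp \<C> i f \<in> E_bar \<U>" if "Dom \<C> i = Cod \<C> f"
  proof -
    have iH: "i \<in> Hom \<C> Y W" and "V = Y"
      using that iH HomD[OF f] HomD[OF iH] by auto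
    then show ?thesis
      using fE i app_in[OF f] unfolding E_bar_iff[OF Comp_Hom[OF category f iH]]
      by (simp add: app_Comp[OF f] image_image[of "app i" "app f", symmetric] cong: image_cong_simp)
  qed
  show "Comp \<C> f i \<in> E_bar \<U>" if "Cod \<C> i = Dom \<C> f"
  proof -
    have iH: "i \<in> Hom \<C> V X" and "W = X"
      using that iH HomD[OF f] HomD[OF iH] by auto
    then show ?thesis
      using fE i app_in[OF iH] unfolding E_bar_iff[OF Comp_Hom[OF category iH f]]
      by (simp add: app_Comp[OF iH] image_image[of "app f" "app i", symmetric] cong: image_cong_simp)
  qed
qed

lemma M_star_Arr: "M_star \<U> \<subseteq> Arr \<C>"
  by (auto simp: M_star_def coverings_def)

text \<open>By \<open>M_star_iff\<close> this is a check on elements; no descent morphism has to be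
  carried along the isomorphism.\<close>

lemma M_star_closed: "closed_under_isos \<C> (M_star \<U>)"
  unfolding closed_under_isos_def
proof (intro ballI allI impI conjI)
  fix f i assume fM: "f \<in> M_star \<U>" and i: "is_iso \<C> i"
  then have "f \<in> Arr \<C>" "i \<in> Arr \<C>"
    using M_star_Arr by (auto simp: is_iso_def)
  then obtain X Y V W where f: "f \<in> Hom \<C> X Y" and iH: "i \<in> Hom \<C> V W"
    using Arr_Hom by metis
  have X: "X \<in> Obj \<C>" and V: "V \<in> Obj \<C>"
    using f iH by (auto simp: Hom_iff)
  note fM = fM[unfolded M_star_iff[OF f]] and i = i[unfolded is_iso_iff[OF iH]]
  show "Comp \<C> i f \<in> M_star \<U>" if "Dom \<C> i = Cod \<C> f"
  proof -
    have VY: "V = Y"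
      using that HomD[OF f] HomD[OF iH] by simp
    note iH' = iH[unfolded VY] and i' = i[unfolded VY]
    show ?thesis
      unfolding M_star_iff[OF Comp_Hom[OF category f iH']]
    proof (intro allI impI)
      fix a a' assume a: "(a, a') \<in> snd X" "(a', a) \<in> snd X"
        and eq: "app (Comp \<C> i f) a = app (Comp \<C> i f) a'"
      have aX: "a \<in> fst X" "a' \<in> fst X"
        using ord_carrier[OF X a(1)] by auto
      have "app i (app f a) = app i (app f a')"
        using eq aX by (simp add: app_Comp[OF f])
      then have "app f a = app f a'"
        using i' app_in[OF f] aX by (blast dest: inj_onD)
      then show "a = a'"
        using fM a by blast
    qed
  qed
  show "Comp \<C> f i \<in> M_star \<U>" if "Cod \<C> i = Dom \<C> f"
  proof -
    have WX: "W = X"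
      using that HomD[OF f] HomD[OF iH] by simp
    note iH' = iH[unfolded WX] and i' = i[unfolded WX]
    show ?thesis
      unfolding M_star_iff[OF Comp_Hom[OF category iH' f]]
    proof (intro allI impI)
      fix a a' assume a: "(a, a') \<in> snd V" "(a', a) \<in> snd V"
        and eq: "app (Comp \<C> f i) a = app (Comp \<C> f i) a'"
      have aV: "a \<in> fst V" "a' \<in> fst V"
        using ord_carrier[OF V a(1)] by auto
      then have "app i a = app i a'"
        using fM app_mono[OF iH' a(1)] app_mono[OF iH' a(2)] eq by (simp add: app_Comp[OF iH'])
      then show "a = a'"
        using i' aV by (blast dest: inj_onD)
    qed
  qed
qed

lemma E_bar_M_star_factorization:
  assumes f: "f \<in> Hom \<C> X Y"
  shows "\<exists>e\<in>E_bar \<U>. \<exists>m\<in>M_star \<U>. Cod \<C> e = Dom \<C> m \<and> f = Comp \<C> m e"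
proof -
  have X: "X \<in> Obj \<C>" and Y: "Y \<in> Obj \<C>"
    using f by (auto simp: Hom_iff)
  \<comment> \<open>\<open>K a\<close> is the class of \<open>a\<close> for equivalence within a
    fibre of \<open>f\<close>. The middle object consists of one chosen element per class, so its
    carrier is an image of that of \<open>X\<close> and hence small.\<close>
  define K where "K a = {a'. (a, a') \<in> snd X \<and> (a', a) \<in> snd X \<and> app f a' = app f a}" for a
  define r where "r a = (SOME a'. a' \<in> K a)" for a
  have "r a \<in> K a" if "a \<in> fst X" for a
    unfolding r_def by (rule someI[of _ a]) (use ord_refl[OF X that] in \<open>simp add: K_def\<close>)
  then have r: "(a, r a) \<in> snd X" "(r a, a) \<in> snd X" "app f (r a) = app f a" if "a \<in> fst X" for a
    using that by (auto simp: K_def)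
  have r_in: "r a \<in> fst X" if "a \<in> fst X" for a
    using ord_carrier[OF X r(1)[OF that]] by simp
  \<comment> \<open>Equivalent elements of one fibre have literally the same set \<open>K\<close>,
    so \<open>SOME\<close> returns the same element for both.\<close>
  have r_eq: "r a = r a'" if "(a, a') \<in> snd X" "(a', a) \<in> snd X" "app f a = app f a'" for a a'
  proof -
    have "K a = K a'"
      using that(3) by (auto simp: K_def intro: ord_trans[OF X that(1)] ord_trans[OF X that(2)]
          ord_trans[OF X _ that(1)] ord_trans[OF X _ that(2)])
    then show ?thesis by (simp add: r_def)
  qed
  have r_le: "(r a, r a') \<in> snd X \<longleftrightarrow> (a, a') \<in> snd X" if "a \<in> fst X" "a' \<in> fst X" for a a'
    using r[OF that(1)] r[OF that(2)] ord_trans[OF X] by blast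
  \<comment> \<open>As \<open>r a\<close> is equivalent to \<open>a\<close>, the order induced on
    representatives is the quotient order, and \<open>e\<close> both preserves and reflects
    it.\<close>
  define Q where "Q = (r ` fst X, snd X \<inter> (r ` fst X \<times> r ` fst X))"
  have Q: "Q \<in> Obj \<C>"
    unfolding PreOrd_Obj preorder_on_def refl_on_def trans_def Q_def fst_conv snd_conv
  proof (intro conjI)
    show "r ` fst X \<in> \<U>"
      using X by (simp add: PreOrd_Obj image_small)
  qed (use r_in ord_refl[OF X] ord_trans[OF X] in blast)+
  define e where "e = (X, restrict r (fst X), Q)"
  define m where "m = (Q, restrict (app f) (fst Q), Y)"
  have e: "e \<in> Hom \<C> X Q"
    unfolding e_def using r_le ord_carrier[OF X] by (intro mor_Hom[OF X Q]) (auto simp: Q_def)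
  have m: "m \<in> Hom \<C> Q Y"
    unfolding m_def using app_in[OF f] app_mono[OF f] r_in by (intro mor_Hom[OF Q Y]) (auto simp: Q_def)
  have app_e: "app e a = r a" if "a \<in> fst X" for a
    using that by (simp add: e_def)
  have app_m: "app m q = app f q" if "q \<in> fst Q" for q
    using that by (simp add: m_def)
  have "e \<in> E_bar \<U>"
    unfolding E_bar_iff[OF e] by (auto simp: app_e Q_def r_le)
  moreover have "m \<in> M_star \<U>"
    unfolding M_star_iff[OF m]
  proof (intro allI impI)
    fix q q' assume q: "(q, q') \<in> snd Q" "(q', q) \<in> snd Q" and eq: "app m q = app m q'"
    then obtain a a' where a: "a \<in> fst X" "a' \<in> fst X" "q = r a" "q' = r a'"
      by (auto simp: Q_def)
    have "app f q = app f q'"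
      using eq app_m ord_carrier[OF Q q(1)] by simp
    then have "app f a = app f a'"
      using r(3) a by simp
    moreover have "(a, a') \<in> snd X" "(a', a) \<in> snd X"
      using q r_le a by (auto simp: Q_def)
    ultimately show "q = q'"
      using r_eq[of a a'] a(3,4) by simp
  qed
  moreover have "f = Comp \<C> m e"
  proof (rule Hom_eqI[OF f Comp_Hom[OF category e m]])
    fix a assume a: "a \<in> fst X"
    show "app f a = app (Comp \<C> m e) a"
      using app_Comp[OF e a, of m] app_m[OF app_in[OF e a]] app_e[OF a] r(3)[OF a] by simp
  qed
  moreover have "Cod \<C> e = Dom \<C> m"
    using HomD[OF e] HomD[OF m] by simp
  ultimately show ?thesis by blast
qed

text \<open>The diagonal is \<open>u\<close> descended along \<open>e\<close>. Elements of one fibre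
  of \<open>e\<close> are equivalent because \<open>e\<close> reflects the order; their images under
  \<open>u\<close> are therefore equivalent and, by the square, have the same image under
  \<open>m\<close>, so \<open>M_star_iff\<close> makes them equal. Surjectivity of \<open>e\<close>
  gives the lower triangle.\<close>

lemma E_bar_M_star_orthogonal:
  assumes eE: "e \<in> E_bar \<U>" and mM: "m \<in> M_star \<U>"
  shows "orthogonal \<C> e m"
proof -
  have "e \<in> Arr \<C>" "m \<in> Arr \<C>"
    using eE mM M_star_Arr by (auto simp: E_bar_def)
  then obtain A B X Y where e: "e \<in> Hom \<C> A B" and m: "m \<in> Hom \<C> X Y"
    using Arr_Hom by metis
  note eE = eE[unfolded E_bar_iff[OF e]] and mM = mM[unfolded M_star_iff[OF m]]
  have A: "A \<in> Obj \<C>" and B: "B \<in> Obj \<C>"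
    using e by (auto simp: Hom_iff)
  show ?thesis
    unfolding orthogonal_def HomD[OF e] HomD[OF m]
  proof (intro ballI impI)
    fix u v assume u: "u \<in> Hom \<C> A X" and v: "v \<in> Hom \<C> B Y" and sq: "Comp \<C> v e = Comp \<C> m u"
    have sq': "app v (app e a) = app m (app u a)" if "a \<in> fst A" for a
      using sq Comp_eq_iff[OF e v u m] that by blast
    have "\<exists>!d. d \<in> Hom \<C> B X \<and> Comp \<C> d e = u"
    proof (rule quotient_factorization[OF e u])
      show "\<exists>t t'. (t, t') \<in> snd A \<and> app e t = b \<and> app e t' = b'" if bb': "(b, b') \<in> snd B" for b b'
      proof -
        have "b \<in> app e ` fst A" "b' \<in> app e ` fst A"
          using eE ord_carrier[OF B bb'] by auto
        then obtain t t' where "t \<in> fst A" "t' \<in> fst A" "b = app e t" "b' = app e t'"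
          by blast
        then show ?thesis
          using eE bb' by blast
      qed
      fix a a' assume a: "a \<in> fst A" "a' \<in> fst A" "app e a = app e a'"
      then have "(app e a, app e a') \<in> snd B" "(app e a', app e a) \<in> snd B"
        using ord_refl[OF B app_in[OF e a(2)]] by simp_all
      then have "(a, a') \<in> snd A" "(a', a) \<in> snd A"
        using eE a by blast+
      then have "(app u a, app u a') \<in> snd X" "(app u a', app u a) \<in> snd X"
        using app_mono[OF u] by blast+
      moreover have "app m (app u a) = app m (app u a')"
        using sq' a by metis
      ultimately show "app u a = app u a'"
        using mM by blast
    qed
    moreover have "Comp \<C> m d = v" if d: "d \<in> Hom \<C> B X" "Comp \<C> d e = u" for d
    proof (rule Hom_eqI[OF Comp_Hom[OF category d(1) m] v])
      fix b assume b: "b \<in> fst B"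
      then obtain a where a: "a \<in> fst A" "b = app e a"
        using eE by blast
      show "app (Comp \<C> m d) b = app v b"
        using app_Comp[OF d(1) b, of m] app_Comp[OF e a(1), of d] d(2) sq'[OF a(1)] a(2) by simp
    qed
    ultimately show "\<exists>!d. d \<in> Hom \<C> B X \<and> Comp \<C> d e = u \<and> Comp \<C> m d = v"
      by metis
  qed
qed

end

theorem proposition2p8:
  fixes \<U> :: "'u set set"
  assumes "small_sets \<U>"
  shows "E_bar \<U> = E_stable \<U> \<and>
         factorization_system (PreOrd \<U>) (E_stable \<U>) (M_star \<U>)"
proof -
  interpret small_universe \<U>
    by standard (rule assms)
  \<comment> \<open>The axioms are verified for \<open>E_bar\<close>, where membership is a
    condition on elements, and transferred along the equality of the two classes.\<close>
  have "factorization_system \<C> (E_bar \<U>) (M_star \<U>)"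
    unfolding factorization_system_def
    using M_star_Arr E_bar_closed M_star_closed E_bar_M_star_factorization[OF Arr_Hom]
      E_bar_M_star_orthogonal by (auto simp: E_bar_def)
  then show ?thesis
    using E_bar_eq_E_stable by simp
qed

end
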